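(* Let $\mathcal{L}$ be a finite meet-distributive meet-semilattice. The Alexander dual $\Gamma_{\mathcal{L}}$ of $\mathcal{L}$ is a level complex (over a field $K$) if and only if the simplicial complex $\{S(\alpha) : \alpha\in\mathcal{L}\}$ is pure. Thus in particular, for a finite distributive lattice $\mathcal{L}=\mathcal{J}(P)$, where $P$ is a finite poset, the Alexander dual $\Gamma_{\mathcal{L}}$ is level if and only if the simplicial complex consisting of all antichains of $P$ is pure.
   Context: Let $\mathcal{L}$ be a finite meet-semilattice with unique minimal element $\hat 0$. An element $\beta$ is a lower neighbor of $\alpha$ (i.e. $\alpha$ covers $\beta$) if $\beta<\alpha$ and there is no $\gamma$ with $\beta<\gamma<\alpha$; $N(\alpha)$ is the set of lower neighbors of $\alpha$. A join-irreducible element of $\mathcal{L}$ is one that covers exactly one element of $\mathcal{L}$ (so $\hat 0$ is not join-irreducible). $P\subset\mathcal{L}$ is the set of join-irreducible elements with the induced order, and $\ell(\alpha)=\{p\in P : p\le\alpha\}$ for $\alpha\in\mathcal{L}$. $\mathcal{L}$ is called meet-distributive if every interval $[\alpha,\beta]=\{\gamma\in\mathcal{L}:\alpha\le\gamma\le\beta\}$ such that $\alpha$ is the meet of the lower neighbors of $\beta$ in $[\alpha,\beta]$ is a boolean lattice. For $\alpha\in\mathcal{L}$, let $\alpha'$ be the meet of all $\beta\in N(\alpha)$ (with $\hat 0'=\hat 0$), and $S(\alpha)=\ell(\alpha)\setminus\ell(\alpha')\subset P$. For meet-distributive $\mathcal{L}$, the family $\{S(\alpha):\alpha\in\mathcal{L}\}$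 is a simplicial complex on the vertex set $P$. A simplicial complex is pure if all its facets (maximal faces) have the same cardinality. The Alexander dual $\Gamma_{\mathcal{L}}$ of $\mathcal{L}$ is the simplicial complex on the $2|P|$ vertices $\{x_p,y_p\}_{p\in P}$ whose facets are the sets $F_\alpha=\{x_q : q\in P\setminus\ell(\alpha)\}\cup\{y_q : q\in\ell(\alpha)\}$, $\alpha\in\mathcal{L}$. (It is the Alexander dual of the simplicial complex whose Stanley–Reisner ideal is generated by the monomials $\prod_{p\in\ell(\alpha)}x_p\prod_{p\in P\setminus\ell(\alpha)}y_p$, $\alpha\in\mathcal{L}$.) $K$ is a field. A simplicial complex $\Gamma$ is level (over $K$) if its Stanley–Reisner ring $K[\Gamma]$ is a level ring, i.e. $K[\Gamma]$ is Cohen–Macaulay and its canonical module is generated in a single degree (equivalently, for $K[\Gamma]$ Cohen–Macaulay with a linear system of parameters $\theta$, the socle of $K[\Gamma]/(\theta)$ is concentrated in one degree). For a finite poset $P$, $\mathcal{J}(P)$ is the distributive lattice of all poset ideals (down-closed subsets) of $P$ ordered by inclusion; its poset of join-irreducible elements is identified with $P$. *)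

theory Defs
  imports "HOL-Library.Poly_Mapping" "HOL-Library.Extended_Nat" "HOL-Library.Lub_Glb"
begin

section \<open>Finite meet-semilattices\<close>

text \<open>
  Posets are subsets of a type of class \<open>order\<close>, with the induced order.
  \<open>isGlb L A m\<close> (from \<open>Lub_Glb\<close>) says that \<open>m\<close> is the greatest lower bound of \<open>A\<close>
  in the poset \<open>L\<close>.
\<close>

definition meet_semilattice :: "'a::order set \<Rightarrow> bool" where
  "meet_semilattice L \<longleftrightarrow> L \<noteq> {} \<and> (\<forall>a\<in>L. \<forall>b\<in>L. \<exists>m. isGlb L {a, b} m)"

definition lower_neighbors :: "'a::order set \<Rightarrow> 'a \<Rightarrow> 'a set" where
  "lower_neighbors L a = {b \<in> L. b < a \<and> \<not> (\<exists>c\<in>L. b < c \<and> c < a)}"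

definition join_irreducibles :: "'a::order set \<Rightarrow> 'a set" where
  "join_irreducibles L = {p \<in> L. \<exists>!b. b \<in> lower_neighbors L p}"

definition ell :: "'a::order set \<Rightarrow> 'a \<Rightarrow> 'a set" where
  "ell L a = {p \<in> join_irreducibles L. p \<le> a}"

text \<open>A finite poset is a boolean lattice if it is isomorphic to the lattice of all subsets
  of some finite set.\<close>

definition boolean_lattice :: "'a::order set \<Rightarrow> bool" where
  "boolean_lattice B \<longleftrightarrow> (\<exists>(X :: nat set) f. finite X \<and> bij_betw f B (Pow X) \<and>
     (\<forall>x\<in>B. \<forall>y\<in>B. x \<le> y \<longleftrightarrow> f x \<subseteq> f y))"

definition meet_distributive :: "'a::order set \<Rightarrow> bool" where
  "meet_distributive L \<longleftrightarrow> (\<forall>a\<in>L. \<forall>b\<in>L.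
     a \<le> b \<and> isGlb L (lower_neighbors L b \<inter> {a..b}) a \<longrightarrow> boolean_lattice (L \<inter> {a..b}))"

text \<open>In a finite meet-semilattice only the minimal element has no lower neighbors.\<close>

definition lower_meet :: "'a::order set \<Rightarrow> 'a \<Rightarrow> 'a" where
  "lower_meet L a =
     (if lower_neighbors L a = {} then a else (THE m. isGlb L (lower_neighbors L a) m))"

definition S_set :: "'a::order set \<Rightarrow> 'a \<Rightarrow> 'a set" where
  "S_set L a = ell L a - ell L (lower_meet L a)"

definition S_complex :: "'a::order set \<Rightarrow> 'a set set" where
  "S_complex L = S_set L ` L"

definition poset_ideals :: "'p::order set \<Rightarrow> 'p set set" where
  "poset_ideals P = {I. I \<subseteq> P \<and> (\<forall>x\<in>I. \<forall>y\<in>P. y \<le> x \<longrightarrow> y \<in> I)}"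

definition antichains :: "'p::order set \<Rightarrow> 'p set set" where
  "antichains P = {A. A \<subseteq> P \<and> (\<forall>x\<in>A. \<forall>y\<in>A. x \<le> y \<longrightarrow> x = y)}"


section \<open>Simplicial complexes\<close>

definition facets :: "'v set set \<Rightarrow> 'v set set" where
  "facets \<Delta> = {F \<in> \<Delta>. \<forall>G\<in>\<Delta>. F \<subseteq> G \<longrightarrow> F = G}"

definition pure_complex :: "'v set set \<Rightarrow> bool" where
  "pure_complex \<Delta> \<longleftrightarrow> (\<forall>F\<in>facets \<Delta>. \<forall>G\<in>facets \<Delta>. card F = card G)"

datatype 'a vertex = Xv 'a | Yv 'a

definition dual_facet :: "'a::order set \<Rightarrow> 'a \<Rightarrow> 'a vertex set" where
  "dual_facet L a = Xv ` (join_irreducibles L - ell L a) \<union> Yv ` ell L a"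

definition alexander_dual :: "'a::order set \<Rightarrow> 'a vertex set set" where
  "alexander_dual L = {F. \<exists>a\<in>L. F \<subseteq> dual_facet L a}"


section \<open>Graded quotients of polynomial rings\<close>

type_synonym ('v, 'k) mpoly = "('v \<Rightarrow>\<^sub>0 nat) \<Rightarrow>\<^sub>0 'k"

text \<open>Ideals of a commutative ring are its submodules: \<open>ideal.subspace I\<close> says that \<open>I\<close>
  is an ideal, and \<open>ideal.span G\<close> is the ideal generated by \<open>G\<close>.\<close>

global_interpretation ideal: module "(*) :: 'r::comm_ring_1 \<Rightarrow> 'r \<Rightarrow> 'r"
  by unfold_locales (simp_all add: algebra_simps)

definition coeff_scale :: "'k::field \<Rightarrow> ('v, 'k) mpoly \<Rightarrow> ('v, 'k) mpoly" where
  "coeff_scale c f = Poly_Mapping.single 0 c * f"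

global_interpretation mpoly: vector_space "coeff_scale :: 'k::field \<Rightarrow> _ \<Rightarrow> ('v, 'k) mpoly"
proof
  fix a b :: 'k and x y :: "('v, 'k) mpoly"
  show "coeff_scale a (x + y) = coeff_scale a x + coeff_scale a y"
    by (simp add: coeff_scale_def distrib_left)
  show "coeff_scale (a + b) x = coeff_scale a x + coeff_scale b x"
    by (simp add: coeff_scale_def single_add distrib_right)
  show "coeff_scale a (coeff_scale b x) = coeff_scale (a * b) x"
    by (simp add: coeff_scale_def mult_single flip: mult.assoc)
  show "coeff_scale 1 x = x"
    by (simp add: coeff_scale_def)
qed

definition Var :: "'v \<Rightarrow> ('v, 'k::field) mpoly" where
  "Var v = Poly_Mapping.single (Poly_Mapping.single v 1) 1"

definition monomial_degree :: "('v \<Rightarrow>\<^sub>0 nat) \<Rightarrow> nat" where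
  "monomial_degree m = (\<Sum>v\<in>Poly_Mapping.keys m. Poly_Mapping.lookup m v)"

definition homogeneous :: "nat \<Rightarrow> ('v, 'k::field) mpoly \<Rightarrow> bool" where
  "homogeneous d f \<longleftrightarrow> (\<forall>m\<in>Poly_Mapping.keys f. monomial_degree m = d)"

text \<open>
  Below, an ideal \<open>I\<close> of the polynomial ring \<open>S\<close> stands for the quotient ring \<open>S / I\<close>.
  Prime ideals of \<open>S / I\<close> are the prime ideals of \<open>S\<close> containing \<open>I\<close>, and
  \<open>(S / I) / (\<theta>)\<close> is \<open>S / (I + (\<theta>))\<close>.
\<close>

definition prime_ideal :: "'r::comm_ring_1 set \<Rightarrow> bool" where
  "prime_ideal Q \<longleftrightarrow> ideal.subspace Q \<and> 1 \<notin> Q \<and> (\<forall>a b. a * b \<in> Q \<longrightarrow> a \<in> Q \<or> b \<in> Q)"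

definition krull_dim :: "'r::comm_ring_1 set \<Rightarrow> enat" where
  "krull_dim I = Sup {enat n | n. \<exists>Q :: nat \<Rightarrow> 'r set.
     (\<forall>i\<le>n. prime_ideal (Q i) \<and> I \<subseteq> Q i) \<and> (\<forall>i<n. Q i \<subset> Q (Suc i))}"

definition add_gens :: "'r::comm_ring_1 set \<Rightarrow> 'r list \<Rightarrow> 'r set" where
  "add_gens I \<theta> = ideal.span (I \<union> set \<theta>)"

definition regular_sequence :: "'r::comm_ring_1 set \<Rightarrow> 'r list \<Rightarrow> bool" where
  "regular_sequence I \<theta> \<longleftrightarrow> 1 \<notin> add_gens I \<theta> \<and>
     (\<forall>i<length \<theta>. \<forall>f. \<theta> ! i * f \<in> add_gens I (take i \<theta>) \<longrightarrow> f \<in> add_gens I (take i \<theta>))"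

text \<open>Homogeneous systems of parameters of \<open>S / I\<close>.  The degrees are not required to be one,
  since over a finite field there may be no linear system of parameters.\<close>

definition hsop :: "('v, 'k::field) mpoly set \<Rightarrow> ('v, 'k) mpoly list \<Rightarrow> bool" where
  "hsop I \<theta> \<longleftrightarrow> enat (length \<theta>) = krull_dim I \<and>
     (\<forall>f\<in>set \<theta>. \<exists>d>0. homogeneous d f) \<and>
     (\<exists>B. finite B \<and> mpoly.span (B \<union> add_gens I \<theta>) = UNIV)"

definition cohen_macaulay :: "('v, 'k::field) mpoly set \<Rightarrow> bool" where
  "cohen_macaulay I \<longleftrightarrow> (\<exists>\<theta>. hsop I \<theta> \<and> regular_sequence I \<theta>)"

text \<open>The socle of \<open>S / J\<close> consists of the classes annihilated by all variables.\<close>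

definition socle_in_one_degree :: "('v, 'k::field) mpoly set \<Rightarrow> bool" where
  "socle_in_one_degree J \<longleftrightarrow> (\<exists>e. \<forall>f. (\<forall>v. Var v * f \<in> J) \<longrightarrow> (\<exists>g. homogeneous e g \<and> f - g \<in> J))"

text \<open>In a Cohen-Macaulay ring every homogeneous system of parameters is a regular sequence,
  so the regularity premise does not restrict \<open>\<theta>\<close>.  For such \<open>\<theta>\<close> the socle of \<open>S / (I + (\<theta>))\<close>
  lies in one degree iff the canonical module of \<open>S / I\<close> is generated in one degree.\<close>

definition level_ring :: "('v, 'k::field) mpoly set \<Rightarrow> bool" where
  "level_ring I \<longleftrightarrow> cohen_macaulay I \<and>
     (\<forall>\<theta>. hsop I \<theta> \<and> regular_sequence I \<theta> \<longrightarrow> socle_in_one_degree (add_gens I \<theta>))"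

text \<open>All elements of the type \<open>'v\<close> are variables here.  If \<open>v\<close> is not a vertex of \<open>\<Delta>\<close> then
  \<open>{v}\<close> is a nonface and \<open>Var v\<close> is among the generators, so the quotient is the
  Stanley-Reisner ring on the actual vertices.\<close>

definition stanley_reisner_ideal :: "'v set set \<Rightarrow> ('v, 'k::field) mpoly set" where
  "stanley_reisner_ideal \<Delta> = ideal.span {\<Prod>v\<in>F. Var v | F. finite F \<and> F \<notin> \<Delta>}"

definition level_complex :: "'k::field itself \<Rightarrow> 'v set set \<Rightarrow> bool" where
  "level_complex _ \<Delta> \<longleftrightarrow> level_ring (stanley_reisner_ideal \<Delta> :: ('v, 'k) mpoly set)"

end

theory Submission
  imports Defs "HOL-Library.FuncSet"
begin

text \<open>
  The linear forms \<open>x\<^sub>p - y\<^sub>p\<close> are a regular system of parameters of the Stanley-Reisner ring of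
  the Alexander dual.  Killing some of them amounts to identifying \<open>x\<^sub>q\<close> with \<open>y\<^sub>q\<close>, and the
  quotient is again given by monomials: its standard monomials are those whose support is shattered
  by suitable sets \<open>\<ell>(\<alpha>)\<close>.  After killing all of them, the standard monomials are the squarefree
  ones of the shattered sets, and in a convex geometry these are exactly the sets of extreme points,
  that is, the \<open>S(\<alpha>)\<close>.  So the socle is spanned by the facets of the complex of the \<open>S(\<alpha>)\<close>, and it
  lies in one degree iff this complex is pure.

  Levelness quantifies over all systems of parameters, hence one has to know that concentration of
  the socle in one degree does not depend on the regular sequence.  If \<open>a\<close> and \<open>b\<close> are regular on
  \<open>A\<close>, then \<open>b x = a y\<close> matches the socle elements \<open>x\<close> of \<open>A/a\<close> with the socle elements \<open>y\<close> of
  \<open>A/b\<close>.  Two regular sequences with last elements \<open>\<alpha>\<close> and \<open>\<beta>\<close> can therefore both be given the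
  last element \<open>\<alpha>\<^sup>q + t \<beta>\<^sup>p\<close> with a new variable \<open>t\<close> of degree \<open>0\<close>; moving it to the front
  allows induction on the length.
\<close>

text \<open>The obstacle is that two systems of parameters need not share an element, and that over
  a finite field no generic linear combination is at hand. The new variable \<open>t\<close> acts as
  the generic scalar; its degree 0 and the exponents, each the degree of the other element, keep the
  combination homogeneous. Placing it first leaves two shorter sequences over one common ideal,
  which is what the induction consumes.

  Shattering arises because, modulo the forms for \<open>q\<close> in \<open>Q\<close>, a monomial
  survives only if every way of reading its variables of index \<open>q\<close> as \<open>x\<close>
  or as \<open>y\<close> yields a face, and each reading prescribes whether \<open>q\<close> belongs
  to the set \<open>\<ell>(\<alpha>)\<close>. Squares of identified variables vanish because no face
  contains both vertices of a pair.

  The algebra sees only a set family closed under intersection in which every member is determined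
  by its extreme points. Meet-distributivity makes these points agree with
  \<open>S(\<alpha>)\<close>; the poset ideals are checked to form such a family directly, so the
  statement on antichains does not pass through boolean intervals.\<close>

section \<open>Reindexing of monomials\<close>

text \<open>As a simplification rule this is the reverse of \<open>mult.assoc\<close>.\<close>
declare ideal.scale_scale [simp del]

text \<open>One linear operator serves for homogeneous components, coefficients in an indeterminate,
  projections to standard monomials, substitutions of variables and evaluation maps. On an exponent
  vector, itself a finitely supported map, it renames variables and adds up the exponents that
  meet.\<close>

definition push :: "('a \<Rightarrow> 'c) \<Rightarrow> 'a set \<Rightarrow> ('a \<Rightarrow>\<^sub>0 'b::comm_monoid_add) \<Rightarrow> ('c \<Rightarrow>\<^sub>0 'b)" where
  "push \<phi> A f = (\<Sum>m\<in>Poly_Mapping.keys f \<inter> A. Poly_Mapping.single (\<phi> m) (Poly_Mapping.lookup f m))"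

lemma push_superset:
  assumes "finite B" "Poly_Mapping.keys f \<subseteq> B"
  shows "push \<phi> A f = (\<Sum>m\<in>B \<inter> A. Poly_Mapping.single (\<phi> m) (Poly_Mapping.lookup f m))"
  unfolding push_def using assms
  by (intro sum.mono_neutral_left) (auto simp: in_keys_iff)

lemma push_zero [simp]: "push \<phi> A 0 = 0"
  by (simp add: push_def)

lemma push_add: "push \<phi> A (f + g) = push \<phi> A f + push \<phi> A g"
proof -
  let ?B = "Poly_Mapping.keys f \<union> Poly_Mapping.keys g"
  have "push \<phi> A h = (\<Sum>m\<in>?B \<inter> A. Poly_Mapping.single (\<phi> m) (Poly_Mapping.lookup h m))"
    if "h \<in> {f, g, f + g}" for h
    using that keys_add[of f g] by (intro push_superset) auto
  then show ?thesis
    by (simp add: lookup_add single_add sum.distrib)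
qed

lemma push_single [simp]:
  "push \<phi> A (Poly_Mapping.single m c) = (if m \<in> A then Poly_Mapping.single (\<phi> m) c else 0)"
  by (cases "c = 0") (auto simp: push_def)

lemma push_sum: "push \<phi> A (sum f B) = (\<Sum>b\<in>B. push \<phi> A (f b))"
  by (induction B rule: infinite_finite_induct) (auto simp: push_add)

lemma push_minus: "push \<phi> A (f - g) = push \<phi> A f - push \<phi> A (g :: _ \<Rightarrow>\<^sub>0 'b::ab_group_add)"
  using push_add[of \<phi> A "f - g" g] by simp

lemma pm_expand: "f = (\<Sum>m\<in>Poly_Mapping.keys f. Poly_Mapping.single m (Poly_Mapping.lookup f m))"
  by (rule poly_mapping_eqI)
    (auto simp: lookup_sum lookup_single when_def in_keys_iff)

lemma pm_induct [case_names zero single add]: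
  fixes f :: "'a \<Rightarrow>\<^sub>0 'b::comm_monoid_add"
  assumes "P 0"
    "\<And>m. m \<in> Poly_Mapping.keys f \<Longrightarrow> P (Poly_Mapping.single m (Poly_Mapping.lookup f m))"
    "\<And>g h. P g \<Longrightarrow> P h \<Longrightarrow> P (g + h)"
  shows "P f"
proof -
  have "P (\<Sum>m\<in>K. Poly_Mapping.single m (Poly_Mapping.lookup f m))"
    if "finite K" "K \<subseteq> Poly_Mapping.keys f" for K
    using that by (induction K) (auto intro: assms)
  from this[of "Poly_Mapping.keys f"] show ?thesis
    by (subst pm_expand) simp
qed

lemma lookup_push:
  "Poly_Mapping.lookup (push \<phi> A f) n
     = (\<Sum>m\<in>{m \<in> Poly_Mapping.keys f \<inter> A. \<phi> m = n}. Poly_Mapping.lookup f m)"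
  by (auto simp: push_def lookup_sum lookup_single when_def sum.If_cases Int_def)

lemma keys_push: "Poly_Mapping.keys (push \<phi> A f) \<subseteq> \<phi> ` (Poly_Mapping.keys f \<inter> A)"
proof
  fix n assume "n \<in> Poly_Mapping.keys (push \<phi> A f)"
  then have "(\<Sum>m\<in>{m \<in> Poly_Mapping.keys f \<inter> A. \<phi> m = n}. Poly_Mapping.lookup f m) \<noteq> 0"
    by (simp add: in_keys_iff lookup_push)
  then have "{m \<in> Poly_Mapping.keys f \<inter> A. \<phi> m = n} \<noteq> {}" by (metis sum.empty)
  then show "n \<in> \<phi> ` (Poly_Mapping.keys f \<inter> A)" by auto
qed

lemma lookup_push_id [simp]:
  "Poly_Mapping.lookup (push (\<lambda>m. m) A f) m = (if m \<in> A then Poly_Mapping.lookup f m else 0)"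
proof -
  have "{k \<in> Poly_Mapping.keys f \<inter> A. k = m} = (if m \<in> Poly_Mapping.keys f \<inter> A then {m} else {})"
    by auto
  then show ?thesis by (simp add: lookup_push in_keys_iff)
qed

lemma push_push: "push \<psi> B (push \<phi> A f) = push (\<lambda>m. \<psi> (\<phi> m)) (A \<inter> {m. \<phi> m \<in> B}) f"
  by (induction f rule: pm_induct) (auto simp: push_add)

text \<open>The hypotheses range only over the monomials of \<open>g\<close>. Hence the rule also
  covers factors of a special shape, such as homogeneous ones or ones free of an indeterminate, for
  maps that are not multiplicative in general.\<close>

lemma push_mult:
  fixes f g :: "'a::comm_monoid_add \<Rightarrow>\<^sub>0 'b::comm_semiring_1" and \<phi> :: "'a \<Rightarrow> 'c::comm_monoid_add"
  assumes "\<And>m n. m \<in> Poly_Mapping.keys g \<Longrightarrow> (m + n \<in> A \<longleftrightarrow> m \<in> B \<and> n \<in> C)"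
    and "\<And>m n. m \<in> Poly_Mapping.keys g \<Longrightarrow> m \<in> B \<Longrightarrow> n \<in> C \<Longrightarrow> \<phi> (m + n) = \<psi> m + \<chi> n"
  shows "push \<phi> A (g * f) = push \<psi> B g * push \<chi> C f"
proof -
  have *: "push \<phi> A (Poly_Mapping.single m c * f) = push \<psi> B (Poly_Mapping.single m c) * push \<chi> C f"
    if "m \<in> Poly_Mapping.keys g" for m c
    by (induction f rule: pm_induct)
      (auto simp: push_add distrib_left mult_single assms that)
  show ?thesis
    by (induction g rule: pm_induct) (auto simp: push_add distrib_right * )
qed

lemma push_mult_hom:
  fixes f g :: "'a::comm_monoid_add \<Rightarrow>\<^sub>0 'b::comm_semiring_1" and \<phi> :: "'a \<Rightarrow> 'c::comm_monoid_add"
  assumes "\<And>m n. \<phi> (m + n) = \<phi> m + \<phi> n"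
  shows "push \<phi> UNIV (g * f) = push \<phi> UNIV g * push \<phi> UNIV f"
  by (rule push_mult) (auto simp: assms)

lemma push_id_UNIV [simp]: "push (\<lambda>m. m) UNIV f = f"
  by (rule poly_mapping_eqI) simp

lemma push_one [simp]: "\<phi> 0 = 0 \<Longrightarrow> 0 \<in> A \<Longrightarrow> push \<phi> A 1 = 1"
  by (simp flip: single_one)

lemma lookup_single_mult_add:
  fixes f :: "'a::cancel_comm_monoid_add \<Rightarrow>\<^sub>0 'b::comm_semiring_1"
  shows "Poly_Mapping.lookup (Poly_Mapping.single m c * f) (m + n) = c * Poly_Mapping.lookup f n"
  by (induction f rule: pm_induct)
    (auto simp: distrib_left lookup_add mult_single lookup_single when_def)

lemma lookup_single_mult_zero:
  fixes f :: "'a::cancel_comm_monoid_add \<Rightarrow>\<^sub>0 'b::comm_semiring_1"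
  assumes "\<And>n. k \<noteq> m + n"
  shows "Poly_Mapping.lookup (Poly_Mapping.single m c * f) k = 0"
  by (induction f rule: pm_induct)
    (use assms in \<open>auto simp: distrib_left lookup_add mult_single lookup_single when_def\<close>)

section \<open>Graded rings\<close>

lemma span_insertE:
  assumes "x \<in> ideal.span (insert a J)"
  obtains k j where "x = k * a + j" "j \<in> ideal.span J"
  using assms by (auto simp: ideal.span_breakdown_eq) (metis add.commute diff_add_cancel)

lemma span_insertI: "j \<in> ideal.span J \<Longrightarrow> k * a + j \<in> ideal.span (insert a J)"
  by (auto simp: ideal.span_breakdown_eq intro!: exI[of _ k])

definition nzd :: "'r::comm_ring_1 set \<Rightarrow> 'r \<Rightarrow> bool" where
  "nzd J a \<longleftrightarrow> (\<forall>f. a * f \<in> ideal.span J \<longrightarrow> f \<in> ideal.span J)"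

text \<open>In contrast to \<open>regular_sequence\<close>, this works with generating sets and
  leaves properness of the quotient aside, so it follows the structure of the list.\<close>

fun regular_on :: "'r::comm_ring_1 set \<Rightarrow> 'r list \<Rightarrow> bool" where
  "regular_on J [] \<longleftrightarrow> True"
| "regular_on J (a # as) \<longleftrightarrow> nzd J a \<and> regular_on (insert a J) as"

lemma regular_on_append: "regular_on J (as @ bs) \<longleftrightarrow> regular_on J as \<and> regular_on (J \<union> set as) bs"
  by (induction as arbitrary: J) auto

lemma regular_on_iff:
  "regular_on J \<theta> \<longleftrightarrow> (\<forall>i<length \<theta>. nzd (J \<union> set (take i \<theta>)) (\<theta> ! i))"
proof (induction \<theta> rule: rev_induct)
  case (snoc x xs)
  then show ?case
    by (auto simp: regular_on_append nth_append less_Suc_eq)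
qed simp

lemma nzd_power: "nzd J a \<Longrightarrow> nzd J (a ^ n)"
proof (induction n)
  case (Suc n)
  then show ?case unfolding nzd_def by (metis mult.assoc power_Suc)
qed (simp add: nzd_def)

text \<open>The grading is given by its projections. The set \<open>M\<close> stands for the
  variables and is only asked to generate all elements of positive degree; the part of degree 0 is
  arbitrary, which leaves room for indeterminates of degree 0.\<close>

locale graded =
  fixes comp :: "nat \<Rightarrow> 'r::comm_ring_1 \<Rightarrow> 'r" and M :: "'r set"
  assumes comp_add: "comp d (f + g) = comp d f + comp d g"
    and comp_comp: "comp d (comp e f) = (if d = e then comp e f else 0)"
    and comp_mult: "comp e g = g \<Longrightarrow> comp d (g * f) = (if e \<le> d then g * comp (d - e) f else 0)"
    and comp_sum: "\<exists>N. f = (\<Sum>e<N. comp e f)"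
    and irrelevant: "comp e g = g \<Longrightarrow> e > 0 \<Longrightarrow> g \<in> ideal.span M"
begin

definition hom_gens :: "'r set \<Rightarrow> bool" where
  "hom_gens J \<longleftrightarrow> (\<forall>g\<in>J. \<exists>e. comp e g = g)"

definition socle_degree :: "'r set \<Rightarrow> nat \<Rightarrow> bool" where
  "socle_degree J e \<longleftrightarrow>
     (\<forall>f. (\<forall>v\<in>M. v * f \<in> ideal.span J) \<longrightarrow> (\<forall>d. d \<noteq> e \<longrightarrow> comp d f \<in> ideal.span J))"

lemma comp_0 [simp]: "comp d 0 = 0"
  using comp_add[of d 0 0] by simp

lemma comp_minus: "comp d (f - g) = comp d f - comp d g"
  using comp_add[of d "f - g" g] by simp

lemma comp_sum_dist: "comp d (sum f A) = (\<Sum>a\<in>A. comp d (f a))"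
  by (induction A rule: infinite_finite_induct) (auto simp: comp_add)

lemma in_span_if_comps: "(\<And>d. comp d f \<in> ideal.span J) \<Longrightarrow> f \<in> ideal.span J"
  using comp_sum[of f] by (metis ideal.span_sum)

lemma comp_in_span:
  assumes "hom_gens J" "f \<in> ideal.span J"
  shows "comp d f \<in> ideal.span J"
  using assms(2)
proof (induction arbitrary: d rule: ideal.span_induct_alt)
  case base
  show ?case by (simp add: ideal.span_zero)
next
  case (step c x y)
  obtain e where e: "comp e x = x" using step assms(1) by (auto simp: hom_gens_def)
  have "comp d (x * c) \<in> ideal.span J"
    unfolding comp_mult[OF e] using ideal.span_scale[OF ideal.span_base[OF step(1)], of "comp (d - e) c"]
    by (simp add: mult.commute ideal.span_zero)
  with step(2) show ?case by (simp add: comp_add mult.commute[of c] ideal.span_add)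
qed

lemma hom_gens_insert [simp]: "hom_gens (insert a J) \<longleftrightarrow> (\<exists>e. comp e a = a) \<and> hom_gens J"
  by (auto simp: hom_gens_def)

text \<open>The component \<open>comp 0 1\<close> acts as an identity on every component of
  \<open>1\<close>, hence on \<open>1\<close> itself.\<close>

lemma comp_one: "comp 0 1 = 1"
proof -
  obtain N where N: "(1::'r) = (\<Sum>e<N. comp e 1)" using comp_sum by blast
  have "comp d 1 * comp 0 1 = comp d 1" for d
  proof -
    have "comp d (comp d 1 * 1) = comp d 1 * comp 0 1"
      by (subst comp_mult[of d]) (auto simp: comp_comp)
    then show ?thesis by (simp add: comp_comp)
  qed
  then have "(\<Sum>e<N. comp e 1) * comp 0 1 = (\<Sum>e<N. comp e 1)"
    by (simp add: sum_distrib_right)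
  then show ?thesis using N by simp
qed

lemma comp_power:
  assumes "comp p a = a"
  shows "comp (n * p) (a ^ n) = a ^ n"
proof (induction n)
  case (Suc n)
  then show ?case using comp_mult[OF assms, of "p + n * p" "a ^ n"] by simp
qed (simp add: comp_one)

text \<open>The multipliers that send \<open>f\<close> into the ideal form an ideal; it contains
  \<open>M\<close> and therefore everything of positive degree.\<close>

lemma socle_mult:
  assumes "\<And>v. v \<in> M \<Longrightarrow> v * f \<in> ideal.span J" "comp e g = g" "e > 0"
  shows "g * f \<in> ideal.span J"
proof -
  have "ideal.subspace {r. r * f \<in> ideal.span J}"
  proof (rule ideal.subspaceI)
    show "0 \<in> {r. r * f \<in> ideal.span J}" by (simp add: ideal.span_zero)
    show "x + y \<in> {r. r * f \<in> ideal.span J}"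
      if "x \<in> {r. r * f \<in> ideal.span J}" "y \<in> {r. r * f \<in> ideal.span J}" for x y
      using that ideal.span_add[of "x * f" J "y * f"] by (simp only: mem_Collect_eq distrib_right)
    show "c * x \<in> {r. r * f \<in> ideal.span J}" if "x \<in> {r. r * f \<in> ideal.span J}" for c x
      using that ideal.span_scale[of "x * f" J c] by (simp only: mem_Collect_eq mult.assoc)
  qed
  then have "ideal.span M \<subseteq> {r. r * f \<in> ideal.span J}"
    using assms(1) by (intro ideal.span_minimal) auto
  then show ?thesis using irrelevant[OF assms(2,3)] by auto
qed

text \<open>If \<open>x\<close> represents a socle element modulo \<open>a\<close>, then \<open>b x = a y\<close> modulo \<open>J\<close> defines the
  corresponding socle element \<open>y\<close> modulo \<open>b\<close>.\<close>
lemma socle_degree_exchange: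
  assumes J: "hom_gens J"
    and a: "comp p a = a" "p > 0" "nzd J a" and b: "comp q b = b" "q > 0" "nzd J b"
    and e: "\<exists>e. socle_degree (insert a J) e"
  shows "\<exists>e. socle_degree (insert b J) e"
proof -
  obtain e where e: "socle_degree (insert a J) e" using assms by blast
  have "comp d y \<in> ideal.span (insert b J)"
    if y: "\<forall>v\<in>M. v * y \<in> ideal.span (insert b J)" and d: "d + p \<noteq> e + q" for d y
  proof -
    have "a * y \<in> ideal.span (insert b J)" using socle_mult[OF _ a(1,2)] y by blast
    then obtain x j where x: "a * y = x * b + j" "j \<in> ideal.span J" by (rule span_insertE)
    have soc: "v * x \<in> ideal.span (insert a J)" if "v \<in> M" for v
    proof -
      have "v * y \<in> ideal.span (insert b J)" using y that by blast
      then obtain z j' where z: "v * y = z * b + j'" "j' \<in> ideal.span J" by (rule span_insertE)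
      \<comment> \<open>Multiply \<open>a * y = x * b + j\<close> by \<open>v\<close> and
        \<open>v * y = z * b + j'\<close> by \<open>a\<close>, and compare.\<close>
      have "b * (v * x - a * z) = a * j' - v * j"
      proof -
        have "b * (v * x - a * z) = v * (x * b + j) - a * (z * b + j') + a * j' - v * j"
          by (simp add: algebra_simps)
        also have "\<dots> = a * j' - v * j"
          unfolding x(1)[symmetric] z(1)[symmetric] by (simp add: algebra_simps)
        finally show ?thesis .
      qed
      also have "\<dots> \<in> ideal.span J" using x(2) z(2) by (simp add: ideal.span_diff ideal.span_scale)
      finally have "v * x - a * z \<in> ideal.span J" using b by (auto simp: nzd_def)
      from span_insertI[OF this, of z a] show ?thesis by (simp add: mult.commute)
    qed
    have "comp (d + p) (a * y) = comp (d + p) (b * x) + comp (d + p) j"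
      by (simp add: x comp_add mult.commute)
    then have eq: "a * comp d y = comp (d + p) (b * x) + comp (d + p) j"
      by (simp add: comp_mult[OF a(1)])
    have j: "comp (d + p) j \<in> ideal.span J" using comp_in_span[OF J x(2)] .
    \<comment> \<open>Degree \<open>d\<close> of \<open>y\<close> corresponds to degree
      \<open>d + p - q\<close> of \<open>x\<close>. If \<open>q > d + p\<close>, then
      \<open>b * x\<close> has no component in degree \<open>d + p\<close> at all.\<close>
    show ?thesis
    proof (cases "q \<le> d + p")
      case False
      then have "a * comp d y \<in> ideal.span J" using eq j by (simp add: comp_mult[OF b(1)])
      then have "comp d y \<in> ideal.span J" using a by (auto simp: nzd_def)
      from span_insertI[OF this, of 0 b] show ?thesis by simp
    next
      case True
      then have "d + p - q \<noteq> e" using d by auto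
      then have "comp (d + p - q) x \<in> ideal.span (insert a J)"
        using e soc by (auto simp: socle_degree_def)
      then obtain w j' where w: "comp (d + p - q) x = w * a + j'" "j' \<in> ideal.span J"
        by (rule span_insertE)
      have "a * (comp d y - b * w) = b * j' + comp (d + p) j"
      proof -
        have "a * (comp d y - b * w) = b * (w * a + j') + comp (d + p) j - a * (b * w)"
          using eq True by (simp add: comp_mult[OF b(1)] w(1) right_diff_distrib)
        then show ?thesis by (simp add: algebra_simps)
      qed
      also have "\<dots> \<in> ideal.span J" using w(2) j by (simp add: ideal.span_add ideal.span_scale)
      finally have "comp d y - b * w \<in> ideal.span J" using a by (auto simp: nzd_def)
      from span_insertI[OF this, of w b] show ?thesis by (simp add: mult.commute)
    qed
  qed
  \<comment> \<open>Truncated subtraction is harmless here, since \<open>d + p = e + q\<close>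
    forces \<open>d = e + q - p\<close>.\<close>
  then have "socle_degree (insert b J) (e + q - p)"
    unfolding socle_degree_def by (metis add_diff_cancel_right')
  then show ?thesis by blast
qed

text \<open>Graded Nakayama: \<open>b f \<in> J\<close> forces \<open>f \<in> a (J : b) + J\<close>, which improves the degree by \<open>p > 0\<close>.\<close>
lemma nzd_swap:
  assumes J: "hom_gens J" and a: "comp p a = a" "p > 0" "nzd J a"
    and b: "comp q b = b" "nzd (insert a J) b"
  shows "nzd J b" "nzd (insert b J) a"
proof -
  have *: "comp d f \<in> ideal.span J" if "b * f \<in> ideal.span J" for d f
    using that
  proof (induction d arbitrary: f rule: less_induct)
    case (less d)
    have "b * f \<in> ideal.span (insert a J)" using span_insertI[OF less.prems, of 0 a] by simp
    then have "f \<in> ideal.span (insert a J)" using b by (auto simp: nzd_def)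
    then obtain f1 j where f1: "f = f1 * a + j" "j \<in> ideal.span J" by (rule span_insertE)
    have "a * (b * f1) = b * f - b * j" by (simp add: f1(1) algebra_simps)
    also have "\<dots> \<in> ideal.span J" using f1(2) less.prems by (simp add: ideal.span_diff ideal.span_scale)
    finally have "b * f1 \<in> ideal.span J" using a by (auto simp: nzd_def)
    then have IH: "d' < d \<Longrightarrow> comp d' f1 \<in> ideal.span J" for d' using less.IH by blast
    have "comp d f = comp d (a * f1) + comp d j" by (simp add: f1 comp_add mult.commute)
    moreover have "comp d (a * f1) \<in> ideal.span J"
      unfolding comp_mult[OF a(1)]
      using ideal.span_scale[OF IH[of "d - p"], of a] a(2) ideal.span_zero[of J] by simp
    ultimately show ?case using ideal.span_add[OF _ comp_in_span[OF J f1(2)]] by simp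
  qed
  then show "nzd J b" by (auto simp: nzd_def intro: in_span_if_comps)
  \<comment> \<open>This half is a formal exchange without any grading: the cofactor
    \<open>g\<close> of \<open>b\<close> is itself a multiple of \<open>a\<close> modulo
    \<open>J\<close>, and then \<open>a\<close> cancels.\<close>
  show "nzd (insert b J) a"
    unfolding nzd_def
  proof (intro allI impI)
    fix f assume "a * f \<in> ideal.span (insert b J)"
    then obtain g j where g: "a * f = g * b + j" "j \<in> ideal.span J" by (rule span_insertE)
    have "b * g = (g * b + j) + (- j)" by (simp add: mult.commute)
    also have "\<dots> = f * a + (- j)" unfolding g(1)[symmetric] by (simp add: mult.commute)
    also have "\<dots> \<in> ideal.span (insert a J)" by (rule span_insertI[OF ideal.span_neg[OF g(2)]])
    finally have "g \<in> ideal.span (insert a J)" using b by (auto simp: nzd_def)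
    then obtain h j' where h: "g = h * a + j'" "j' \<in> ideal.span J" by (rule span_insertE)
    have "a * (f - b * h) = (h * a + j') * b + j - a * (b * h)"
      unfolding h(1)[symmetric] g(1)[symmetric] by (simp add: algebra_simps)
    also have "\<dots> = b * j' + j" by (simp add: algebra_simps)
    also have "\<dots> \<in> ideal.span J" using g(2) h(2) by (simp add: ideal.span_add ideal.span_scale)
    finally have "f - b * h \<in> ideal.span J" using a by (auto simp: nzd_def)
    from span_insertI[OF this, of h b] show "f \<in> ideal.span (insert b J)" by (simp add: mult.commute)
  qed
qed

text \<open>By \<open>nzd_swap\<close>, \<open>c\<close> passes the elements of \<open>as\<close>
  one at a time from right to left. Positive degree is asked of the elements that are passed,
  because the Nakayama argument descends along their degrees.\<close>

lemma regular_on_rotate: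
  assumes "hom_gens J" "\<And>a. a \<in> set as \<Longrightarrow> \<exists>p>0. comp p a = a" "comp q c = c"
    and "regular_on J (as @ [c])"
  shows "nzd J c \<and> regular_on (insert c J) as"
  using assms
proof (induction as arbitrary: J)
  case (Cons a as)
  obtain p where p: "p > 0" "comp p a = a" using Cons.prems by auto
  have "nzd (insert a J) c \<and> regular_on (insert c (insert a J)) as"
    using Cons.prems p by (intro Cons.IH) auto
  then show ?case
    using nzd_swap[OF Cons.prems(1) p(2,1) _ Cons.prems(3)] Cons.prems(4)
    by (auto simp: insert_commute)
qed simp

end

section \<open>Independence of the socle degree from the regular sequence\<close>

text \<open>Since every larger bound works as well, finitely many coefficients of a polynomial can
  share one.\<close>

lemma (in graded) comp_sum_le: "\<exists>N. \<forall>N'\<ge>N. f = (\<Sum>e<N'. comp e f)"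
proof -
  obtain N where N: "f = (\<Sum>e<N. comp e f)" using comp_sum by blast
  have "comp e f = 0" if "e \<ge> N" for e
  proof -
    have "comp e f = (\<Sum>e'<N. comp e (comp e' f))" by (subst N) (simp add: comp_sum_dist)
    also have "\<dots> = 0" using that by (intro sum.neutral) (auto simp: comp_comp)
    finally show ?thesis .
  qed
  then have "(\<Sum>e<N'. comp e f) = (\<Sum>e<N. comp e f)" if "N' \<ge> N" for N'
    using that by (intro sum.mono_neutral_right) auto
  then show ?thesis using N by metis
qed

section \<open>Extension of a graded ring by indeterminates of degree 0\<close>

lemma span_single_0:
  assumes "r \<in> ideal.span M"
  shows "Poly_Mapping.single (0::'m::comm_monoid_add) r \<in> ideal.span (Poly_Mapping.single 0 ` M)"
  using assms
proof (induction rule: ideal.span_induct_alt)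
  case (step c x y)
  have "Poly_Mapping.single (0::'m) (c * x + y)
      = Poly_Mapping.single 0 c * Poly_Mapping.single 0 x + Poly_Mapping.single 0 y"
    by (simp add: mult_single single_add)
  also have "\<dots> \<in> ideal.span (Poly_Mapping.single 0 ` M)"
    by (intro ideal.span_add ideal.span_scale step.IH ideal.span_base) (use step(1) in auto)
  finally show ?case .
qed (simp add: ideal.span_zero)

text \<open>This coefficientwise test for an extended ideal is what carries regularity up to the
  polynomial ring and the socle condition up and down.\<close>

lemma in_span_single_0_iff:
  fixes F :: "'m::cancel_comm_monoid_add \<Rightarrow>\<^sub>0 'r::comm_ring_1"
  shows "F \<in> ideal.span (Poly_Mapping.single 0 ` J) \<longleftrightarrow> (\<forall>\<mu>. Poly_Mapping.lookup F \<mu> \<in> ideal.span J)"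
proof
  have "ideal.subspace {F :: 'm \<Rightarrow>\<^sub>0 'r. \<forall>\<mu>. Poly_Mapping.lookup F \<mu> \<in> ideal.span J}" (is "ideal.subspace ?S")
  proof (rule ideal.subspaceI)
    show "c * F \<in> ?S" if F: "F \<in> ?S" for c F
    proof (induction c rule: pm_induct)
      case (single m)
      have "Poly_Mapping.lookup (Poly_Mapping.single m (Poly_Mapping.lookup c m) * F) \<mu> \<in> ideal.span J" for \<mu>
      proof (cases "\<exists>n. \<mu> = m + n")
        case True
        then show ?thesis using F by (auto simp: lookup_single_mult_add ideal.span_scale)
      next
        case False
        then show ?thesis by (simp add: lookup_single_mult_zero ideal.span_zero)
      qed
      then show ?case by simp
    qed (auto simp: distrib_right lookup_add ideal.span_zero intro: ideal.span_add)
  qed (auto simp: lookup_add ideal.span_zero intro: ideal.span_add)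
  then have "ideal.span (Poly_Mapping.single 0 ` J) \<subseteq> ?S"
    by (intro ideal.span_minimal)
      (auto simp: lookup_single when_def ideal.span_zero intro: ideal.span_base)
  then show "F \<in> ideal.span (Poly_Mapping.single 0 ` J) \<Longrightarrow> \<forall>\<mu>. Poly_Mapping.lookup F \<mu> \<in> ideal.span J"
    by auto
next
  assume *: "\<forall>\<mu>. Poly_Mapping.lookup F \<mu> \<in> ideal.span J"
  have "Poly_Mapping.single \<mu> (Poly_Mapping.lookup F \<mu>)
      = Poly_Mapping.single \<mu> 1 * Poly_Mapping.single 0 (Poly_Mapping.lookup F \<mu>)" for \<mu>
    by (simp add: mult_single)
  then have "Poly_Mapping.single \<mu> (Poly_Mapping.lookup F \<mu>) \<in> ideal.span (Poly_Mapping.single 0 ` J)" for \<mu>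
    using ideal.span_scale[OF span_single_0] * by metis
  then show "F \<in> ideal.span (Poly_Mapping.single 0 ` J)"
    by (subst pm_expand) (intro ideal.span_sum)
qed

lemma lookup_single_0_mult:
  fixes F :: "'m::cancel_comm_monoid_add \<Rightarrow>\<^sub>0 'r::comm_ring_1"
  shows "Poly_Mapping.lookup (Poly_Mapping.single 0 a * F) \<mu> = a * Poly_Mapping.lookup F \<mu>"
  using lookup_single_mult_add[of 0 a F \<mu>] by simp

lemma regular_on_single_0:
  "regular_on J as \<Longrightarrow>
   regular_on (Poly_Mapping.single (0::'m::cancel_comm_monoid_add) ` J) (map (Poly_Mapping.single 0) as)"
proof (induction as arbitrary: J)
  case (Cons a as)
  have "nzd (Poly_Mapping.single (0::'m) ` J) (Poly_Mapping.single 0 a)"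
    using Cons.prems by (auto simp: nzd_def in_span_single_0_iff lookup_single_0_mult)
  then show ?case using Cons by (auto simp flip: image_insert)
qed simp

lemma (in graded) lookup_map_comp [simp]:
  "Poly_Mapping.lookup (Poly_Mapping.map (comp d) F) \<mu> = comp d (Poly_Mapping.lookup F \<mu>)"
  by (simp add: map.rep_eq when_def)

text \<open>With indeterminates of degree 0 the projections act on the coefficients alone, so each
  axiom reduces to the one for the coefficient ring.\<close>

lemma (in graded) graded_extension:
  "graded (\<lambda>d. Poly_Mapping.map (comp d) :: ('m::cancel_comm_monoid_add \<Rightarrow>\<^sub>0 'r) \<Rightarrow> _) (Poly_Mapping.single 0 ` M)"
proof -
  define cT :: "nat \<Rightarrow> ('m \<Rightarrow>\<^sub>0 'r) \<Rightarrow> _" where "cT = (\<lambda>d. Poly_Mapping.map (comp d))"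
  have lk [simp]: "Poly_Mapping.lookup (cT d F) \<mu> = comp d (Poly_Mapping.lookup F \<mu>)" for d F \<mu>
    by (simp add: cT_def)
  have add: "cT d (F + G) = cT d F + cT d G" for d F G
    by (rule poly_mapping_eqI) (simp add: lookup_add comp_add)
  have sing: "cT d (Poly_Mapping.single \<mu> r) = Poly_Mapping.single \<mu> (comp d r)" for d \<mu> r
    by (rule poly_mapping_eqI) (simp add: lookup_single when_def)
  have zero [simp]: "cT d 0 = 0" for d by (rule poly_mapping_eqI) simp
  have "graded cT (Poly_Mapping.single 0 ` M)"
  proof
    fix d e F G
    show "cT d (F + G) = cT d F + cT d G" by (rule add)
    show "cT d (cT e F) = (if d = e then cT e F else 0)"
      by (rule poly_mapping_eqI) (simp add: comp_comp)
    show "\<exists>N. F = (\<Sum>e<N. cT e F)"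
    proof -
      have "\<exists>N. \<forall>N'\<ge>N. F = (\<Sum>e<N'. cT e F)"
      proof (induction F rule: pm_induct)
        case (single m)
        obtain N where "\<forall>N'\<ge>N. Poly_Mapping.lookup F m = (\<Sum>e<N'. comp e (Poly_Mapping.lookup F m))"
          using comp_sum_le by blast
        then show ?case
          by (intro exI[of _ N] allI impI poly_mapping_eqI)
            (auto simp: sing lookup_sum lookup_single when_def)
      next
        case (add F1 F2)
        then obtain N1 N2 where "\<forall>N'\<ge>N1. F1 = (\<Sum>e<N'. cT e F1)" "\<forall>N'\<ge>N2. F2 = (\<Sum>e<N'. cT e F2)"
          by auto
        then have "\<forall>N'\<ge>max N1 N2. F1 + F2 = (\<Sum>e<N'. cT e F1) + (\<Sum>e<N'. cT e F2)"
          by (metis max.bounded_iff)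
        then show ?case unfolding \<open>\<And>F G d. cT d (F + G) = cT d F + cT d G\<close> sum.distrib by blast
      qed auto
      then show ?thesis by blast
    qed
    show "G \<in> ideal.span (Poly_Mapping.single 0 ` M)" if "cT e G = G" "e > 0"
      using irrelevant[of e] that lk[of e G] by (auto simp: in_span_single_0_iff)
    show "cT d (G * F) = (if e \<le> d then G * cT (d - e) F else 0)" if "cT e G = G"
    proof (induction G rule: pm_induct)
      case (single m)
      have c: "comp e (Poly_Mapping.lookup G m) = Poly_Mapping.lookup G m"
        using that lk[of e G m] by simp
      show ?case
        by (induction F rule: pm_induct)
          (auto simp: distrib_left add mult_single sing comp_mult[OF c])
    qed (auto simp: distrib_right add)
  qed
  then show ?thesis by (simp add: cT_def)
qed

section \<open>Coefficients with respect to one fresh indeterminate\<close>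

definition free_of :: "'i \<Rightarrow> (('i \<Rightarrow>\<^sub>0 nat) \<Rightarrow>\<^sub>0 'r::comm_ring_1) \<Rightarrow> bool" where
  "free_of i F \<longleftrightarrow> (\<forall>\<mu>\<in>Poly_Mapping.keys F. Poly_Mapping.lookup \<mu> i = 0)"

text \<open>The coefficient of the \<open>k\<close>-th power of the indeterminate \<open>i\<close>,
  as a polynomial in the others; the inner \<open>push\<close> erases the exponent at
  \<open>i\<close>.\<close>

definition coef :: "'i \<Rightarrow> nat \<Rightarrow> (('i \<Rightarrow>\<^sub>0 nat) \<Rightarrow>\<^sub>0 'r::comm_ring_1) \<Rightarrow> (('i \<Rightarrow>\<^sub>0 nat) \<Rightarrow>\<^sub>0 'r)" where
  "coef i k F = push (push (\<lambda>j. j) (- {i})) {\<mu>. Poly_Mapping.lookup \<mu> i = k} F"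

definition indet :: "'i \<Rightarrow> (('i \<Rightarrow>\<^sub>0 nat) \<Rightarrow>\<^sub>0 'r::comm_ring_1)" where
  "indet i = Poly_Mapping.single (Poly_Mapping.single i 1) 1"

lemma free_of_single_0 [simp]: "free_of i (Poly_Mapping.single 0 r)"
  by (auto simp: free_of_def)

lemma free_of_add: "free_of i F \<Longrightarrow> free_of i G \<Longrightarrow> free_of i (F + G)"
  using keys_add[of F G] by (auto simp: free_of_def)

lemma free_of_mult: "free_of i F \<Longrightarrow> free_of i G \<Longrightarrow> free_of i (F * G)"
  using keys_mult[of F G] by (force simp: free_of_def lookup_add)

lemma free_of_power: "free_of i F \<Longrightarrow> free_of i (F ^ n)"
  using free_of_single_0[of i 1] by (induction n) (auto intro: free_of_mult)

lemma free_of_indet: "i \<noteq> j \<Longrightarrow> free_of i (indet j)"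
  by (auto simp: free_of_def indet_def lookup_single when_def)

lemma coef_add: "coef i k (F + G) = coef i k F + coef i k G"
  by (simp add: coef_def push_add)

lemma push_free_part:
  "Poly_Mapping.lookup \<mu> i = 0 \<Longrightarrow> push (\<lambda>j. j) (- {i}) (\<mu> + \<nu>) = \<mu> + push (\<lambda>j. j) (- {i}) \<nu>"
  by (rule poly_mapping_eqI) (auto simp: lookup_add)

lemma coef_mult_free:
  assumes "free_of i G"
  shows "coef i k (G * F) = G * coef i k F"
proof -
  have "coef i k (G * F) = push (\<lambda>m. m) UNIV G * coef i k F"
    unfolding coef_def using assms
    by (intro push_mult) (auto simp: free_of_def lookup_add push_free_part)
  then show ?thesis by simp
qed

lemma coef_mult_indet: "coef i k (indet i * F) = (if k = 0 then 0 else coef i (k - 1) F)"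
proof -
  have "coef i k (indet i * F) = push (\<lambda>_. 0) UNIV (indet i)
      * push (push (\<lambda>j. j) (- {i})) (if k = 0 then {} else {\<mu>. Poly_Mapping.lookup \<mu> i = k - 1}) F"
    unfolding coef_def
    by (intro push_mult)
      (auto simp: indet_def lookup_add lookup_single push_add intro!: poly_mapping_eqI)
  moreover have "push \<phi> {} F = 0" for \<phi> :: "_ \<Rightarrow> 'a \<Rightarrow>\<^sub>0 nat"
    by (simp add: push_def)
  ultimately show ?thesis
    by (simp add: indet_def coef_def)
qed

lemma coef_expand:
  "\<exists>N. \<forall>N'\<ge>N. F = (\<Sum>k<N'. Poly_Mapping.single (Poly_Mapping.single i k) 1 * coef i k F) \<and> coef i N' F = 0"
proof (induction F rule: pm_induct)
  case (single m)
  have m: "Poly_Mapping.single i (Poly_Mapping.lookup m i) + push (\<lambda>j. j) (- {i}) m = m"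
    by (rule poly_mapping_eqI) (auto simp: lookup_add lookup_single when_def)
  show ?case
    by (intro exI[of _ "Suc (Poly_Mapping.lookup m i)"] allI impI)
      (auto simp: coef_def mult_single if_distrib[of "(*) _"] m cong: if_cong)
next
  case (add F1 F2)
  let ?P = "\<lambda>F N. F = (\<Sum>k<N. Poly_Mapping.single (Poly_Mapping.single i k) 1 * coef i k F) \<and> coef i N F = 0"
  obtain N1 N2 where N: "\<forall>N'\<ge>N1. ?P F1 N'" "\<forall>N'\<ge>N2. ?P F2 N'" using add by blast
  have "?P (F1 + F2) N'" if "N' \<ge> max N1 N2" for N'
  proof -
    have "?P F1 N'" "?P F2 N'" using N that by auto
    then show ?thesis by (simp add: coef_add distrib_left sum.distrib)
  qed
  then show ?case by blast
qed (simp add: coef_def)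

lemma coef_in_span:
  assumes "\<forall>g\<in>J. free_of i g" "F \<in> ideal.span J"
  shows "coef i k F \<in> ideal.span J"
  using assms(2)
proof (induction rule: ideal.span_induct_alt)
  case (step c x y)
  have "coef i k (x * c) = x * coef i k c" using step assms by (intro coef_mult_free) auto
  also have "\<dots> \<in> ideal.span J"
    using ideal.span_scale[OF ideal.span_base[OF step(1)], of "coef i k c"] by (simp add: mult.commute)
  finally show ?case using step by (simp add: coef_add mult.commute[of c] ideal.span_add)
qed (simp add: coef_def ideal.span_zero)

lemma in_span_if_coefs:
  assumes "\<And>k. coef i k F \<in> ideal.span J"
  shows "F \<in> ideal.span J"
proof -
  obtain N where N: "F = (\<Sum>k<N. Poly_Mapping.single (Poly_Mapping.single i k) 1 * coef i k F)"
    using coef_expand[of F i] by (elim exE) (meson order_refl)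
  show ?thesis by (subst N) (intro ideal.span_sum ideal.span_scale assms)
qed

text \<open>The lowest coefficient in the fresh indeterminate detects regularity of \<open>\<alpha>\<close>, the highest
  one that of \<open>\<beta>\<close>.\<close>
lemma nzd_generic:
  assumes J: "\<forall>g\<in>J. free_of i g" and ab: "free_of i \<alpha>" "free_of i \<beta>"
    and nzd: "nzd J \<alpha> \<or> nzd J \<beta>"
  shows "nzd J (\<alpha> + indet i * \<beta>)"
  unfolding nzd_def
proof (intro allI impI)
  fix F assume F: "(\<alpha> + indet i * \<beta>) * F \<in> ideal.span J"
  have "(\<alpha> + indet i * \<beta>) * F = \<alpha> * F + indet i * (\<beta> * F)" by (simp add: algebra_simps)
  then have "coef i k ((\<alpha> + indet i * \<beta>) * F)
      = \<alpha> * coef i k F + (if k = 0 then 0 else \<beta> * coef i (k - 1) F)" for k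
    by (simp add: coef_add coef_mult_indet coef_mult_free ab)
  then have *: "\<alpha> * coef i k F + (if k = 0 then 0 else \<beta> * coef i (k - 1) F) \<in> ideal.span J" for k
    using coef_in_span[OF J F, of k] by simp
  have "coef i k F \<in> ideal.span J" for k
    using nzd
  proof
    assume a: "nzd J \<alpha>"
    show ?thesis
    proof (induction k)
      case 0
      show ?case using *[of 0] a by (simp add: nzd_def)
    next
      case (Suc k)
      have "\<alpha> * coef i (Suc k) F \<in> ideal.span J"
        using ideal.span_diff[OF *[of "Suc k"] ideal.span_scale[OF Suc, of \<beta>]] by simp
      then show ?case using a by (simp add: nzd_def)
    qed
  next
    assume b: "nzd J \<beta>"
    obtain N where N: "\<And>N'. N' \<ge> N \<Longrightarrow> coef i N' F = 0" using coef_expand[of F i] by meson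
    show ?thesis
    proof (cases "k \<ge> N")
      case True
      then show ?thesis by (simp add: N ideal.span_zero)
    next
      case False
      then have "k \<le> N" by simp
      then show ?thesis
      proof (induction rule: inc_induct)
        case base
        show ?case by (simp add: N ideal.span_zero)
      next
        case (step n)
        have "\<beta> * coef i n F \<in> ideal.span J"
          using ideal.span_diff[OF *[of "Suc n"] ideal.span_scale[OF step.IH, of \<alpha>]] by simp
        then show ?case using b by (simp add: nzd_def)
      qed
    qed
  qed
  then show "F \<in> ideal.span J" by (rule in_span_if_coefs)
qed

text \<open>The common ideal grows by elements that involve the indeterminates used so far. The
  induction therefore carries an infinite reserve \<open>Fr\<close> of indeterminates that occur in
  none of the generators or sequence elements.\<close>

lemma (in graded) socle_degree_generic:
  fixes J :: "((nat \<Rightarrow>\<^sub>0 nat) \<Rightarrow>\<^sub>0 'r) set"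
  assumes "T = (\<lambda>d. Poly_Mapping.map (comp d))" "M' = Poly_Mapping.single 0 ` M"
  assumes "graded.hom_gens T J" "length as = length bs"
    and "\<And>a. a \<in> set as \<union> set bs \<Longrightarrow> \<exists>p>0. T p a = a"
    and "regular_on J as" "regular_on J bs"
    and "infinite Fr" "\<And>i g. i \<in> Fr \<Longrightarrow> g \<in> J \<union> set as \<union> set bs \<Longrightarrow> free_of i g"
    and "\<exists>e. graded.socle_degree T M' (J \<union> set as) e"
  shows "\<exists>e. graded.socle_degree T M' (J \<union> set bs) e"
proof -
  interpret T: graded T M' unfolding assms(1,2) by (rule graded_extension)
  show ?thesis
    using assms(3-)
  proof (induction as arbitrary: J bs Fr rule: rev_induct)
    case (snoc \<alpha> as)
    obtain bs' \<beta> where bs: "bs = bs' @ [\<beta>]" "length as = length bs'"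
      using snoc.prems(2) by (cases bs rule: rev_exhaust) auto
    obtain p q where p: "p > 0" "T p \<alpha> = \<alpha>" and q: "q > 0" "T q \<beta> = \<beta>"
      using snoc.prems(3)[of \<alpha>] snoc.prems(3)[of \<beta>] bs by auto
    obtain i where i: "i \<in> Fr" using snoc.prems(6) by fastforce
    \<comment> \<open>The exponents bring both summands to degree \<open>p * q\<close>. Modulo
      \<open>as\<close> the element \<open>\<alpha>\<close> is known to be regular, modulo
      \<open>bs'\<close> it is \<open>\<beta>\<close>, and either one suffices for
      \<open>c\<close>.\<close>
    define c where "c = \<alpha> ^ q + indet i * \<beta> ^ p"
    have T0: "T 0 (indet i) = indet i"
      unfolding assms(1) indet_def
      by (rule poly_mapping_eqI) (simp add: lookup_single when_def comp_one)
    have c: "T (p * q) c = c"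
      using T.comp_power[OF p(2), of q] T.comp_power[OF q(2), of p]
      by (simp add: c_def T.comp_add T.comp_mult[OF T0] mult.commute[of p q])
    have pq: "p * q > 0" using p q by simp
    have regs: "regular_on J as" "nzd (J \<union> set as) \<alpha>" "regular_on J bs'" "nzd (J \<union> set bs') \<beta>"
      using snoc.prems(4,5) by (auto simp: bs regular_on_append)
    have free: "free_of i \<alpha>" "free_of i \<beta>" using snoc.prems(7) i bs by auto
    have nz1: "nzd (J \<union> set as) c"
      unfolding c_def using snoc.prems(7) i free regs
      by (intro nzd_generic) (auto intro: free_of_power nzd_power)
    have nz2: "nzd (J \<union> set bs') c"
      unfolding c_def using snoc.prems(7) i free regs bs
      by (intro nzd_generic) (auto intro: free_of_power nzd_power)
    have hg: "T.hom_gens (J \<union> set as)" "T.hom_gens (J \<union> set bs')"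
      using snoc.prems(1,3) by (auto simp: T.hom_gens_def bs)
    \<comment> \<open>Three moves: \<open>\<alpha>\<close> is exchanged for \<open>c\<close> behind
      \<open>as\<close>, the induction hypothesis leads from \<open>as\<close> to \<open>bs'\<close>
      over \<open>insert c J\<close>, and \<open>c\<close> is exchanged for \<open>\<beta>\<close>
      behind \<open>bs'\<close>.\<close>
    have "\<exists>e. T.socle_degree (insert c (J \<union> set as)) e"
      using T.socle_degree_exchange[OF hg(1) p(2,1) regs(2) c pq nz1] snoc.prems(8) by simp
    moreover have "nzd J c \<and> regular_on (insert c J) as"
      using snoc.prems(1,3) regs nz1 c by (intro T.regular_on_rotate) (auto simp: regular_on_append)
    moreover have "nzd J c \<and> regular_on (insert c J) bs'"
      using snoc.prems(1,3) regs nz2 c by (intro T.regular_on_rotate) (auto simp: regular_on_append bs)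
    ultimately have "\<exists>e. T.socle_degree (insert c J \<union> set bs') e"
    proof (intro snoc.IH[of "insert c J" bs' "Fr - {i}"])
      show "T.hom_gens (insert c J)" using snoc.prems(1) c by auto
      show "\<exists>p>0. T p a = a" if "a \<in> set as \<union> set bs'" for a
        using snoc.prems(3)[of a] that by (auto simp: bs)
      show "free_of j g" if j: "j \<in> Fr - {i}" and g: "g \<in> insert c J \<union> set as \<union> set bs'" for j g
      proof -
        have "free_of j \<alpha>" "free_of j \<beta>" using snoc.prems(7) j bs by auto
        then have "free_of j c"
          unfolding c_def using j by (intro free_of_add free_of_mult free_of_power free_of_indet) auto
        then show ?thesis using g snoc.prems(7)[of j g] j bs by auto
      qed
    qed (use bs snoc.prems(6) in auto)
    then show ?case
      using T.socle_degree_exchange[OF hg(2) c pq nz2 q(2,1) regs(4)] by (simp add: bs)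
  qed simp
qed

text \<open>Everything is moved to the polynomial ring in countably many indeterminates, where
  constants are free of all of them, and the conclusion is read off from the coefficients.\<close>

lemma (in graded) socle_degree_invariant:
  assumes "hom_gens J" "length as = length bs"
    and "\<And>a. a \<in> set as \<union> set bs \<Longrightarrow> \<exists>p>0. comp p a = a"
    and "regular_on J as" "regular_on J bs"
    and "\<exists>e. socle_degree (J \<union> set as) e"
  shows "\<exists>e. socle_degree (J \<union> set bs) e"
proof -
  let ?i = "Poly_Mapping.single (0 :: nat \<Rightarrow>\<^sub>0 nat) :: 'r \<Rightarrow> _"
  let ?T = "\<lambda>d. Poly_Mapping.map (comp d) :: ((nat \<Rightarrow>\<^sub>0 nat) \<Rightarrow>\<^sub>0 'r) \<Rightarrow> _"
  interpret T: graded ?T "?i ` M" by (rule graded_extension)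
  have i: "?T d (?i a) = ?i (comp d a)" for d a
    by (rule poly_mapping_eqI) (simp add: lookup_single when_def)
  have lk: "Poly_Mapping.lookup (?i a * F) \<mu> = a * Poly_Mapping.lookup F \<mu>" for a F \<mu>
    by (rule lookup_single_0_mult)
  have socle: "T.socle_degree (?i ` A) e \<longleftrightarrow> socle_degree A e" for A e
  proof
    assume *: "T.socle_degree (?i ` A) e"
    show "socle_degree A e"
      unfolding socle_degree_def
    proof (intro allI impI)
      fix f d assume f: "\<forall>v\<in>M. v * f \<in> ideal.span A" "d \<noteq> e"
      have "\<forall>v\<in>?i ` M. v * ?i f \<in> ideal.span (?i ` A)"
        using f(1) by (auto simp: mult_single intro: span_single_0)
      then have "?T d (?i f) \<in> ideal.span (?i ` A)"
        using * f(2) unfolding T.socle_degree_def by blast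
      then show "comp d f \<in> ideal.span A"
        unfolding i in_span_single_0_iff by (metis lookup_single_eq)
    qed
  next
    assume *: "socle_degree A e"
    show "T.socle_degree (?i ` A) e"
      unfolding T.socle_degree_def
    proof (intro allI impI)
      fix F d assume F: "\<forall>v\<in>?i ` M. v * F \<in> ideal.span (?i ` A)" "d \<noteq> e"
      then have "\<forall>v\<in>M. v * Poly_Mapping.lookup F \<mu> \<in> ideal.span A" for \<mu>
        by (simp add: in_span_single_0_iff lk)
      then show "?T d F \<in> ideal.span (?i ` A)"
        using * F(2) by (simp add: in_span_single_0_iff socle_degree_def)
    qed
  qed
  have img: "?i ` J \<union> set (map ?i as) = ?i ` (J \<union> set as)" "?i ` J \<union> set (map ?i bs) = ?i ` (J \<union> set bs)"
    by auto
  have "\<exists>e. T.socle_degree (?i ` J \<union> set (map ?i bs)) e"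
  proof (rule socle_degree_generic[where as = "map ?i as" and Fr = UNIV, OF refl refl])
    show "T.hom_gens (?i ` J)" using assms(1) unfolding hom_gens_def T.hom_gens_def by (metis i imageE)
    show "\<exists>p>0. ?T p a = a" if "a \<in> set (map ?i as) \<union> set (map ?i bs)" for a
    proof -
      have "a \<in> ?i ` (set as \<union> set bs)" using that by auto
      then obtain b where "b \<in> set as \<union> set bs" "a = ?i b" by blast
      then show ?thesis using assms(3)[of b] i by metis
    qed
    show "\<exists>e. T.socle_degree (?i ` J \<union> set (map ?i as)) e" unfolding img socle by (rule assms)
  qed (use assms in \<open>auto intro: regular_on_single_0\<close>)
  then show ?thesis unfolding img socle .
qed

section \<open>The standard grading of the polynomial ring\<close>

lemma monomial_degree_superset:
  "finite B \<Longrightarrow> Poly_Mapping.keys m \<subseteq> B \<Longrightarrow> monomial_degree m = (\<Sum>v\<in>B. Poly_Mapping.lookup m v)"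
  unfolding monomial_degree_def by (rule sum.mono_neutral_left) (auto simp: in_keys_iff)

lemma monomial_degree_add: "monomial_degree (m + n) = monomial_degree m + monomial_degree n"
proof -
  let ?B = "Poly_Mapping.keys m \<union> Poly_Mapping.keys n"
  have "monomial_degree k = (\<Sum>v\<in>?B. Poly_Mapping.lookup k v)" if "k \<in> {m, n, m + n}" for k
    using that keys_add[of m n] by (intro monomial_degree_superset) auto
  then show ?thesis by (simp add: lookup_add sum.distrib)
qed

lemma monomial_degree_single [simp]: "monomial_degree (Poly_Mapping.single v k) = k"
  by (cases "k = 0") (simp_all add: monomial_degree_def)

lemma split_off_var:
  assumes "v \<in> Poly_Mapping.keys (m :: 'v \<Rightarrow>\<^sub>0 nat)"
  obtains m' where "m = Poly_Mapping.single v 1 + m'"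
proof
  show "m = Poly_Mapping.single v 1 + (m - Poly_Mapping.single v 1)"
    using assms
    by (intro poly_mapping_eqI)
      (auto simp: lookup_add minus_poly_mapping.rep_eq lookup_single when_def in_keys_iff)
qed

definition hcomp :: "nat \<Rightarrow> ('v, 'k::field) mpoly \<Rightarrow> ('v, 'k) mpoly" where
  "hcomp d = push (\<lambda>m. m) {m. monomial_degree m = d}"

lemma lookup_hcomp [simp]:
  "Poly_Mapping.lookup (hcomp d f) m = (if monomial_degree m = d then Poly_Mapping.lookup f m else 0)"
  by (simp add: hcomp_def)

lemma homogeneous_iff_hcomp: "homogeneous d f \<longleftrightarrow> hcomp d f = f"
  by (auto simp: homogeneous_def poly_mapping_eq_iff fun_eq_iff in_keys_iff)

interpretation mp: graded "hcomp :: nat \<Rightarrow> ('v, 'k::field) mpoly \<Rightarrow> _" "range Var"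
proof
  fix d e and f g :: "('v, 'k) mpoly"
  show "hcomp d (f + g) = hcomp d f + hcomp d g" by (simp add: hcomp_def push_add)
  show "hcomp d (hcomp e f) = (if d = e then hcomp e f else 0)"
    by (rule poly_mapping_eqI) simp
  show "hcomp d (g * f) = (if e \<le> d then g * hcomp (d - e) f else 0)" if "hcomp e g = g"
  proof -
    have e: "monomial_degree m = e" if "m \<in> Poly_Mapping.keys g" for m
      using that \<open>hcomp e g = g\<close> by (auto simp: homogeneous_def simp flip: homogeneous_iff_hcomp)
    have "hcomp d (g * f) = push (\<lambda>m. m) UNIV g
        * push (\<lambda>m. m) (if e \<le> d then {m. monomial_degree m = d - e} else {}) f"
      unfolding hcomp_def by (rule push_mult) (auto simp: monomial_degree_add e)
    then show ?thesis by (simp add: hcomp_def) (simp add: push_def)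
  qed
  show "\<exists>N. f = (\<Sum>e<N. hcomp e f)"
  proof -
    obtain N where N: "\<And>m. m \<in> Poly_Mapping.keys f \<Longrightarrow> monomial_degree m < N"
      using finite_nat_set_iff_bounded[of "monomial_degree ` Poly_Mapping.keys f"] by auto
    have "f = (\<Sum>e<N. hcomp e f)"
      by (rule poly_mapping_eqI) (use N in \<open>auto simp: lookup_sum in_keys_iff\<close>)
    then show ?thesis by blast
  qed
  show "g \<in> ideal.span (range Var)" if "hcomp e g = g" "e > 0"
  proof -
    have "Poly_Mapping.single m c \<in> ideal.span (range Var)" if "m \<in> Poly_Mapping.keys g" for m and c :: 'k
    proof -
      have "monomial_degree m = e"
        using that \<open>hcomp e g = g\<close> by (auto simp: homogeneous_def simp flip: homogeneous_iff_hcomp)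
      then have "Poly_Mapping.keys m \<noteq> {}" using \<open>e > 0\<close> by (auto simp: monomial_degree_def)
      then obtain v where "v \<in> Poly_Mapping.keys m" by blast
      then obtain m' where "m = Poly_Mapping.single v 1 + m'" by (rule split_off_var)
      then have "Poly_Mapping.single m c = Poly_Mapping.single m' c * Var v"
        by (simp add: Var_def mult_single add.commute)
      then show ?thesis by (auto intro: ideal.span_scale ideal.span_base)
    qed
    then show ?thesis by (subst pm_expand) (rule ideal.span_sum)
  qed
qed

section \<open>Levelness tested on a single system of parameters\<close>

lemma span_span_Un: "ideal.span (ideal.span G \<union> B) = ideal.span (G \<union> B)"
proof
  have "ideal.span G \<subseteq> ideal.span (G \<union> B)" "B \<subseteq> ideal.span (G \<union> B)"
    by (auto intro: ideal.span_base ideal.span_mono[THEN subsetD, of G])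
  then show "ideal.span (ideal.span G \<union> B) \<subseteq> ideal.span (G \<union> B)"
    by (intro ideal.span_minimal) auto
  show "ideal.span (G \<union> B) \<subseteq> ideal.span (ideal.span G \<union> B)"
    by (intro ideal.span_mono) (auto intro: ideal.span_base)
qed

lemma add_gens_span: "add_gens (ideal.span G) \<theta> = ideal.span (G \<union> set \<theta>)"
  by (simp add: add_gens_def span_span_Un)

lemma regular_sequence_span_iff:
  "regular_sequence (ideal.span G) \<theta> \<longleftrightarrow> 1 \<notin> ideal.span (G \<union> set \<theta>) \<and> regular_on G \<theta>"
  by (simp add: regular_sequence_def add_gens_span regular_on_iff nzd_def)

text \<open>A homogeneous ideal contains the components of its elements, so the component of degree
  \<open>e\<close> can serve as the homogeneous representative.\<close>

lemma socle_in_one_degree_iff: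
  assumes "mp.hom_gens J"
  shows "socle_in_one_degree (ideal.span J) \<longleftrightarrow> (\<exists>e. mp.socle_degree J e)"
proof
  assume "socle_in_one_degree (ideal.span J)"
  then obtain e where
    e: "\<And>f. \<forall>v. Var v * f \<in> ideal.span J \<Longrightarrow> \<exists>g. homogeneous e g \<and> f - g \<in> ideal.span J"
    by (auto simp: socle_in_one_degree_def)
  have "hcomp d f \<in> ideal.span J" if f: "\<forall>v. Var v * f \<in> ideal.span J" and d: "d \<noteq> e" for f d
  proof -
    obtain g where g: "homogeneous e g" "f - g \<in> ideal.span J" using e[OF f] by blast
    have "hcomp d g = 0" using g(1) d mp.comp_comp[of d e g] by (simp add: homogeneous_iff_hcomp)
    then show ?thesis using mp.comp_in_span[OF assms g(2), of d] by (simp add: mp.comp_minus)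
  qed
  then show "\<exists>e. mp.socle_degree J e" by (auto simp: mp.socle_degree_def)
next
  assume "\<exists>e. mp.socle_degree J e"
  then obtain e where e: "mp.socle_degree J e" by blast
  have "f - hcomp e f \<in> ideal.span J" if "\<forall>v. Var v * f \<in> ideal.span J" for f
  proof (rule mp.in_span_if_comps)
    fix d
    have "d \<noteq> e \<Longrightarrow> hcomp d f \<in> ideal.span J" using e that by (simp add: mp.socle_degree_def)
    then show "hcomp d (f - hcomp e f) \<in> ideal.span J"
      by (auto simp: mp.comp_minus mp.comp_comp ideal.span_zero)
  qed
  moreover have "homogeneous e (hcomp e f)" for f :: "('a, 'b) mpoly"
    by (simp add: homogeneous_iff_hcomp mp.comp_comp)
  ultimately show "socle_in_one_degree (ideal.span J)"
    unfolding socle_in_one_degree_def by blast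
qed

text \<open>All homogeneous systems of parameters have the Krull dimension as their length, so the
  invariance of the socle condition applies to any two of them.\<close>

lemma level_ring_iff:
  assumes G: "mp.hom_gens G"
    and \<theta>: "hsop (ideal.span G) \<theta>" "regular_sequence (ideal.span G) \<theta>"
  shows "level_ring (ideal.span G) \<longleftrightarrow> socle_in_one_degree (add_gens (ideal.span G) \<theta>)"
proof
  show "level_ring (ideal.span G) \<Longrightarrow> socle_in_one_degree (add_gens (ideal.span G) \<theta>)"
    using \<theta> by (auto simp: level_ring_def)
next
  assume *: "socle_in_one_degree (add_gens (ideal.span G) \<theta>)"
  have hom: "mp.hom_gens (G \<union> set \<tau>)" if "hsop (ideal.span G) \<tau>" for \<tau>
    using G that by (auto simp: mp.hom_gens_def hsop_def simp flip: homogeneous_iff_hcomp)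
  have "socle_in_one_degree (add_gens (ideal.span G) \<tau>)"
    if \<tau>: "hsop (ideal.span G) \<tau>" "regular_sequence (ideal.span G) \<tau>" for \<tau>
  proof -
    have "enat (length \<theta>) = enat (length \<tau>)" using \<theta> \<tau> by (simp add: hsop_def)
    then have len: "length \<theta> = length \<tau>" by simp
    have "\<exists>e. mp.socle_degree (G \<union> set \<theta>) e"
      using * socle_in_one_degree_iff[OF hom[OF \<theta>(1)]] by (simp add: add_gens_span)
    then have "\<exists>e. mp.socle_degree (G \<union> set \<tau>) e"
      using \<theta> \<tau>
      by (intro mp.socle_degree_invariant[OF G len])
        (auto simp: hsop_def regular_sequence_span_iff homogeneous_iff_hcomp)
    then show ?thesis
      using socle_in_one_degree_iff[OF hom[OF \<tau>(1)]] by (simp add: add_gens_span)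
  qed
  then show "level_ring (ideal.span G)"
    using \<theta> by (auto simp: level_ring_def cohen_macaulay_def)
qed

section \<open>Krull dimension\<close>

text \<open>The indexed form matters because distinct indices may give equal vectors; then the
  coefficients 1 and -1 form the relation.\<close>

lemma (in vector_space) dependent_family:
  assumes "finite E" "finite B" "card B < card E" "\<And>e. e \<in> E \<Longrightarrow> r e \<in> span B"
  obtains c where "\<exists>e\<in>E. c e \<noteq> 0" "(\<Sum>e\<in>E. c e *s r e) = 0"
proof (cases "inj_on r E")
  case True
  have "dependent (r ` E)"
  proof (rule ccontr)
    assume "independent (r ` E)"
    then have "card (r ` E) \<le> card B" using independent_span_bound[OF assms(2)] assms(4) by blast
    then show False using assms(3) card_image[OF True] by simp
  qed
  then obtain u where "\<exists>v\<in>r ` E. u v \<noteq> 0" "(\<Sum>v\<in>r ` E. u v *s v) = 0"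
    using dependent_finite[of "r ` E"] assms(1) by auto
  then show ?thesis using that[of "\<lambda>e. u (r e)"] True by (auto simp: sum.reindex)
next
  case False
  then obtain a b where ab: "a \<in> E" "b \<in> E" "a \<noteq> b" "r a = r b" by (auto simp: inj_on_def)
  have "(\<Sum>e\<in>E. (if e = a then 1 else if e = b then - 1 else 0) *s r e)
      = (\<Sum>e\<in>{a, b}. (if e = a then 1 else if e = b then - 1 else 0) *s r e)"
    using assms(1) ab by (intro sum.mono_neutral_right) auto
  also have "\<dots> = 0" using ab by simp
  finally show ?thesis using that[of "\<lambda>e. if e = a then 1 else if e = b then - 1 else 0"] ab by fastforce
qed

lemma coeff_scale_single [simp]: "coeff_scale c (Poly_Mapping.single m d) = Poly_Mapping.single m (c * d)"
  by (simp add: coeff_scale_def mult_single)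

lemma push_coeff_scale: "push \<phi> A (coeff_scale c f) = coeff_scale c (push \<phi> A f)"
  by (induction f rule: pm_induct) (auto simp: push_add mpoly.scale_right_distrib)

lemma prime_ideal_power:
  "prime_ideal Q \<Longrightarrow> a \<notin> Q \<Longrightarrow> a ^ k * b \<in> Q \<Longrightarrow> b \<in> Q"
  by (induction k) (auto simp: prime_ideal_def mult.assoc)

text \<open>Following Coquand and Lombardi: among the terms of a polynomial relation between elements
  \<open>x i\<close> chosen along a chain of primes, the lexicographically smallest one survives.\<close>
lemma no_relation_along_prime_chain:
  fixes Q :: "nat \<Rightarrow> ('v, 'k::field) mpoly set"
  assumes Q: "\<And>i. i \<le> n \<Longrightarrow> prime_ideal (Q i)" "\<And>i. i < n \<Longrightarrow> Q i \<subseteq> Q (Suc i)"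
    and x: "\<And>i. i < n \<Longrightarrow> x i \<in> Q (Suc i)" "\<And>i. i < n \<Longrightarrow> x i \<notin> Q i"
    and E: "finite E" "\<And>e e'. e \<in> E \<Longrightarrow> e' \<in> E \<Longrightarrow> (\<forall>j<n. e j = e' j) \<Longrightarrow> e = e'"
    and c: "\<exists>e\<in>E. c e \<noteq> 0"
  shows "(\<Sum>e\<in>E. coeff_scale (c e) (\<Prod>j<n. x j ^ e j)) \<notin> Q 0"
proof
  assume rel: "(\<Sum>e\<in>E. coeff_scale (c e) (\<Prod>j<n. x j ^ e j)) \<in> Q 0"
  let ?t = "\<lambda>i e. coeff_scale (c e) (\<Prod>j\<in>{i..<n}. x j ^ e j)"
  \<comment> \<open>\<open>Z\<close> holds the terms whose exponents of the first \<open>i\<close>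
    elements are lexicographically smallest. These exponents agree throughout \<open>Z\<close>, so
    the later ones must tell its terms apart.\<close>
  have "\<exists>Z. Z \<subseteq> E \<and> Z \<noteq> {} \<and> (\<forall>e\<in>Z. c e \<noteq> 0) \<and> (\<Sum>e\<in>Z. ?t i e) \<in> Q i \<and>
      (\<forall>e\<in>Z. \<forall>e'\<in>Z. (\<forall>j\<in>{i..<n}. e j = e' j) \<longrightarrow> e = e')" if "i \<le> n" for i
    using that
  proof (induction i)
    case 0
    have "(\<Sum>e\<in>{e\<in>E. c e \<noteq> 0}. ?t 0 e) = (\<Sum>e\<in>E. ?t 0 e)"
      by (rule sum.mono_neutral_left) (use E in \<open>auto simp: coeff_scale_def\<close>)
    then show ?case
      using c rel E(2) by (intro exI[of _ "{e\<in>E. c e \<noteq> 0}"]) (auto simp: atLeast0LessThan)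
  next
    case (Suc i)
    then obtain Z where Z: "Z \<subseteq> E" "Z \<noteq> {}" "\<forall>e\<in>Z. c e \<noteq> 0" "(\<Sum>e\<in>Z. ?t i e) \<in> Q i"
      "\<forall>e\<in>Z. \<forall>e'\<in>Z. (\<forall>j\<in>{i..<n}. e j = e' j) \<longrightarrow> e = e'" by auto
    have fin: "finite Z" using Z(1) E(1) finite_subset by blast
    \<comment> \<open>The power \<open>x i ^ m\<close> cancels because \<open>x i\<close> lies
      outside the prime \<open>Q i\<close>; the terms with a larger exponent keep a factor
      \<open>x i\<close> and drop out modulo \<open>Q (Suc i)\<close>.\<close>
    define m where "m = Min ((\<lambda>e. e i) ` Z)"
    have m: "m \<le> e i" if "e \<in> Z" for e using that fin by (simp add: m_def)
    have "m \<in> (\<lambda>e. e i) ` Z" unfolding m_def using fin Z(2) by (intro Min_in) auto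
    then have Zm: "{e\<in>Z. e i = m} \<noteq> {}" by auto
    have split: "?t i e = x i ^ e i * ?t (Suc i) e" for e
      using Suc.prems by (simp add: prod.atLeast_Suc_lessThan coeff_scale_def ac_simps)
    have i: "i < n" "i \<le> n" using Suc.prems by auto
    have eqn: "(\<Sum>e\<in>Z. ?t i e) = x i ^ m * (\<Sum>e\<in>Z. x i ^ (e i - m) * ?t (Suc i) e)"
      unfolding sum_distrib_left
    proof (rule sum.cong)
      fix e assume "e \<in> Z"
      then have "x i ^ e i = x i ^ m * x i ^ (e i - m)" using m by (simp flip: power_add)
      then show "?t i e = x i ^ m * (x i ^ (e i - m) * ?t (Suc i) e)"
        unfolding split by (simp add: mult.assoc)
    qed simp
    have "(\<Sum>e\<in>Z. x i ^ (e i - m) * ?t (Suc i) e) \<in> Q i"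
      by (rule prime_ideal_power[OF Q(1)[OF i(2)] x(2)[OF i(1)]]) (use Z(4) in \<open>unfold eqn\<close>)
    then have Z': "(\<Sum>e\<in>Z. x i ^ (e i - m) * ?t (Suc i) e) \<in> Q (Suc i)" using Q(2)[OF i(1)] by (rule subsetD[rotated])
    have sub: "ideal.subspace (Q (Suc i))" using Q(1) Suc.prems by (auto simp: prime_ideal_def)
    have rest: "(\<Sum>e\<in>Z - {e\<in>Z. e i = m}. x i ^ (e i - m) * ?t (Suc i) e) \<in> Q (Suc i)"
    proof (rule ideal.subspace_sum[OF sub])
      fix e assume "e \<in> Z - {e\<in>Z. e i = m}"
      then have "e i - m = Suc (e i - m - 1)" using m[of e] by auto
      then have "x i ^ (e i - m) = x i ^ (e i - m - 1) * x i" by (metis power_Suc2)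
      then have "x i ^ (e i - m) * ?t (Suc i) e = (x i ^ (e i - m - 1) * ?t (Suc i) e) * x i"
        by (simp only: ac_simps)
      then show "x i ^ (e i - m) * ?t (Suc i) e \<in> Q (Suc i)"
        using ideal.subspace_scale[OF sub x(1)[OF i(1)]] by (simp only:)
    qed
    have "(\<Sum>e\<in>Z. x i ^ (e i - m) * ?t (Suc i) e)
        = (\<Sum>e\<in>Z - {e\<in>Z. e i = m}. x i ^ (e i - m) * ?t (Suc i) e)
          + (\<Sum>e\<in>{e\<in>Z. e i = m}. x i ^ (e i - m) * ?t (Suc i) e)"
      using fin by (intro sum.subset_diff) auto
    with ideal.subspace_diff[OF sub Z' rest]
    have "(\<Sum>e\<in>{e\<in>Z. e i = m}. x i ^ (e i - m) * ?t (Suc i) e) \<in> Q (Suc i)"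
      by (simp only: add_diff_cancel_left')
    moreover have "(\<Sum>e\<in>{e\<in>Z. e i = m}. x i ^ (e i - m) * ?t (Suc i) e)
        = (\<Sum>e\<in>{e\<in>Z. e i = m}. ?t (Suc i) e)" by (rule sum.cong) auto
    moreover have "e = e'" if e: "e \<in> Z" "e' \<in> Z" "e i = m" "e' i = m"
      and eq: "\<forall>j\<in>{Suc i..<n}. e j = e' j" for e e'
    proof -
      have "e j = e' j" if "j \<in> {i..<n}" for j using that eq e by (cases "j = i") auto
      then show ?thesis using Z(5) e by blast
    qed
    ultimately show ?case using Z(1,3) Zm by (intro exI[of _ "{e\<in>Z. e i = m}"]) auto
  qed
  \<comment> \<open>No exponents remain to distinguish terms, so a single nonzero constant lies in
    \<open>Q n\<close>.\<close>
  from this[of n] obtain Z where Z: "Z \<noteq> {}" "\<forall>e\<in>Z. c e \<noteq> 0" "(\<Sum>e\<in>Z. coeff_scale (c e) 1) \<in> Q n"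
    "\<forall>e\<in>Z. \<forall>e'\<in>Z. e = e'" by auto
  then obtain e where e: "Z = {e}" by blast
  have "Poly_Mapping.single 0 (inverse (c e)) * coeff_scale (c e) 1 \<in> Q n"
    using Z(3) Q(1)[of n] by (auto simp: e prime_ideal_def intro: ideal.subspace_scale)
  also have "Poly_Mapping.single 0 (inverse (c e)) * coeff_scale (c e) 1 = (1 :: ('v, 'k) mpoly)"
    using Z(2) by (simp add: coeff_scale_def mult_single e)
  finally show False using Q(1)[of n] by (simp add: prime_ideal_def)
qed

text \<open>Bounding each exponent, rather than the degree, turns the later count of monomials into
  the size of a box.\<close>

definition exp_bound :: "('v, 'k::field) mpoly \<Rightarrow> nat \<Rightarrow> bool" where
  "exp_bound f b \<longleftrightarrow> (\<forall>m\<in>Poly_Mapping.keys f. \<forall>v. Poly_Mapping.lookup m v \<le> b)"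

lemma exp_bound_ex: "\<exists>b. exp_bound f b"
proof -
  let ?S = "(\<lambda>(m, v). Poly_Mapping.lookup m v) ` (SIGMA m:Poly_Mapping.keys f. Poly_Mapping.keys m)"
  have "finite ?S" by (intro finite_imageI finite_SigmaI) auto
  then obtain b where b: "\<forall>k\<in>?S. k \<le> b" using finite_nat_set_iff_bounded_le by auto
  have "Poly_Mapping.lookup m v \<le> b" if "m \<in> Poly_Mapping.keys f" for m v
    using b that by (cases "v \<in> Poly_Mapping.keys m") (force simp: in_keys_iff)+
  then show ?thesis by (auto simp: exp_bound_def)
qed

lemma exp_bound_mono: "exp_bound f b \<Longrightarrow> b \<le> b' \<Longrightarrow> exp_bound f b'"
  unfolding exp_bound_def by (meson order_trans)

lemma exp_bound_mult: "exp_bound f b \<Longrightarrow> exp_bound g b' \<Longrightarrow> exp_bound (f * g) (b + b')"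
  using keys_mult[of f g] by (force simp: exp_bound_def lookup_add intro: add_mono)

lemma exp_bound_one: "exp_bound 1 b"
  by (simp add: exp_bound_def)

lemma exp_bound_power: "exp_bound f b \<Longrightarrow> exp_bound (f ^ k) (k * b)"
  by (induction k) (auto intro: exp_bound_mult exp_bound_one)

lemma exp_bound_prod:
  assumes "\<And>i. i \<in> A \<Longrightarrow> exp_bound (f i) (b i)"
  shows "exp_bound (\<Prod>i\<in>A. f i) (\<Sum>i\<in>A. b i)"
  using assms by (induction A rule: infinite_finite_induct) (auto intro: exp_bound_mult exp_bound_one)

text \<open>A chain with \<open>d + 1\<close> steps would give \<open>d + 1\<close> elements without
  polynomial relation modulo \<open>I\<close>. Their power products with exponents below
  \<open>N\<close> number \<open>N ^ (d + 1)\<close>, whereas the standard parts lie in a space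
  whose dimension is only of order \<open>N ^ d\<close>.\<close>

lemma krull_dim_le:
  fixes I :: "('v, 'k::field) mpoly set"
  assumes I: "\<And>f. push (\<lambda>m. m) G f = 0 \<Longrightarrow> f \<in> I"
    and G: "\<And>b. finite {m \<in> G. \<forall>v. Poly_Mapping.lookup m v \<le> b}"
      "\<And>b. card {m \<in> G. \<forall>v. Poly_Mapping.lookup m v \<le> b} \<le> C * (b + 1) ^ d"
  shows "krull_dim I \<le> enat d"
proof -
  have False
    if Q: "\<And>i. i \<le> Suc d \<Longrightarrow> prime_ideal (Q i)" "I \<subseteq> Q 0" "\<And>i. i < Suc d \<Longrightarrow> Q i \<subset> Q (Suc i)"
    for Q :: "nat \<Rightarrow> ('v, 'k) mpoly set"
  proof -
    define n where "n = Suc d"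
    have "\<forall>i<n. \<exists>y. y \<in> Q (Suc i) \<and> y \<notin> Q i" using Q(3) by (auto simp: n_def)
    then obtain x where x: "\<And>i. i < n \<Longrightarrow> x i \<in> Q (Suc i)" "\<And>i. i < n \<Longrightarrow> x i \<notin> Q i"
      by metis
    obtain b where b: "\<And>i. exp_bound (x i) (b i)"
      using choice[of "\<lambda>i b. exp_bound (x i) b"] exp_bound_ex[of "x _"] by blast
    define D where "D = (\<Sum>i<n. b i)"
    have D: "exp_bound (x i) D" if "i < n" for i
      using that unfolding D_def by (intro exp_bound_mono[OF b] member_le_sum) auto
    \<comment> \<open>Chosen so that \<open>C * (n * (N * D) + 1) ^ d\<close>, which is at most
      \<open>C * (n * D + 1) ^ d * N ^ d\<close>, stays below \<open>N * N ^ d\<close>, the number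
      of exponent tuples.\<close>
    define N where "N = C * (n * D + 1) ^ d + 1"
    define E where "E = PiE {..<n} (\<lambda>_. {..<N})"
    define r where "r = (\<lambda>e. \<Prod>j<n. x j ^ e j)"
    define B where "B = {m \<in> G. \<forall>v. Poly_Mapping.lookup m v \<le> n * (N * D)}"
    have r: "exp_bound (r e) (n * (N * D))" if "e \<in> E" for e
    proof -
      have "exp_bound (r e) (\<Sum>j<n. N * D)"
        unfolding r_def
      proof (intro exp_bound_prod)
        fix j assume j: "j \<in> {..<n}"
        have "e j * D \<le> N * D" using that j by (force simp: E_def PiE_iff intro: less_imp_le)
        then show "exp_bound (x j ^ e j) (N * D)"
          using exp_bound_mono[OF exp_bound_power[OF D]] j by blast
      qed
      then show ?thesis by simp
    qed
    have card: "card B < card E"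
    proof -
      have "card B \<le> C * (n * (N * D) + 1) ^ d" using G(2) by (simp add: B_def)
      also have "\<dots> \<le> C * ((n * D + 1) * N) ^ d"
        by (intro mult_left_mono power_mono) (auto simp: algebra_simps N_def)
      also have "\<dots> = (C * (n * D + 1) ^ d) * N ^ d" by (simp only: power_mult_distrib mult.assoc)
      also have "\<dots> < N * N ^ d" by (intro mult_strict_right_mono) (auto simp: N_def)
      also have "\<dots> = card E" by (simp add: E_def card_PiE n_def)
      finally show ?thesis .
    qed
    have finE: "finite E" by (auto simp: E_def intro!: finite_PiE)
    have finB: "finite B" using G(1) by (simp add: B_def)
    have span: "push (\<lambda>m. m) G (r e) \<in> mpoly.span ((\<lambda>m. Poly_Mapping.single m 1) ` B)"
      if "e \<in> E" for e
      unfolding push_def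
    proof (rule mpoly.span_sum)
      fix m assume m: "m \<in> Poly_Mapping.keys (r e) \<inter> G"
      then have "m \<in> B" using r[OF that] by (auto simp: B_def exp_bound_def)
      then have "coeff_scale (Poly_Mapping.lookup (r e) m) (Poly_Mapping.single m 1)
          \<in> mpoly.span ((\<lambda>m. Poly_Mapping.single m 1) ` B)"
        by (intro mpoly.span_scale mpoly.span_base) auto
      then show "Poly_Mapping.single m (Poly_Mapping.lookup (r e) m)
          \<in> mpoly.span ((\<lambda>m. Poly_Mapping.single m 1) ` B)" by simp
    qed
    have "card ((\<lambda>m. Poly_Mapping.single m (1::'k)) ` B) < card E"
      using card_image_le[OF finB, of "\<lambda>m. Poly_Mapping.single m (1::'k)"] card by simp
    then obtain c
      where c: "\<exists>e\<in>E. c e \<noteq> 0" "(\<Sum>e\<in>E. coeff_scale (c e) (push (\<lambda>m. m) G (r e))) = 0"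
      using mpoly.dependent_family[of E _ "\<lambda>e. push (\<lambda>m. m) G (r e)",
          OF finE finite_imageI[OF finB] _ span] by blast
    have "(\<Sum>e\<in>E. coeff_scale (c e) (r e)) \<in> I"
      using c(2) by (intro I) (simp add: push_sum push_coeff_scale)
    moreover have "(\<Sum>e\<in>E. coeff_scale (c e) (r e)) \<notin> Q 0"
      unfolding r_def
    proof (rule no_relation_along_prime_chain[where n = n])
      show "e = e'" if "e \<in> E" "e' \<in> E" "\<forall>j<n. e j = e' j" for e e'
        using that unfolding E_def by (intro PiE_ext) auto
    qed (use Q x c finE in \<open>auto simp: n_def\<close>)
    ultimately show False using Q(2) by blast
  qed note no_chain = this
  show ?thesis
    unfolding krull_dim_def
  proof (rule Sup_least, clarify)
    fix n and Q :: "nat \<Rightarrow> ('v, 'k) mpoly set"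
    assume Q: "\<forall>i\<le>n. prime_ideal (Q i) \<and> I \<subseteq> Q i" "\<forall>i<n. Q i \<subset> Q (Suc i)"
    show "enat n \<le> enat d"
    proof (rule ccontr)
      assume "\<not> enat n \<le> enat d"
      then have "Suc d \<le> n" by simp
      then show False using Q no_chain[of Q] by auto
    qed
  qed
qed

text \<open>The chain sets the variables \<open>e 0\<close>, ..., \<open>e (d - 1)\<close> to zero
  one after another; all other variables are zero from the start.\<close>

lemma krull_dim_ge:
  fixes I :: "('v, 'k::field) mpoly set"
  assumes e: "inj_on e {..<d}"
    and I: "\<And>f m. f \<in> I \<Longrightarrow> m \<in> Poly_Mapping.keys f \<Longrightarrow> \<not> Poly_Mapping.keys m \<subseteq> e ` {..<d}"
  shows "enat d \<le> krull_dim I"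
proof -
  \<comment> \<open>Renaming the variables to natural numbers makes the exponent vectors linearly
    ordered. The target ring is then a domain, and the kernels \<open>Q i\<close> are prime.\<close>
  define \<phi> where "\<phi> m = (\<Sum>j<d. Poly_Mapping.single j (Poly_Mapping.lookup m (e j)))"
    for m :: "'v \<Rightarrow>\<^sub>0 nat"
  define A where "A i = {m :: 'v \<Rightarrow>\<^sub>0 nat. Poly_Mapping.keys m \<subseteq> e ` {i..<d}}" for i
  define Q where "Q i = {f :: ('v, 'k) mpoly. push \<phi> (A i) f = 0}" for i
  have lk: "Poly_Mapping.lookup (\<phi> m) j = (if j < d then Poly_Mapping.lookup m (e j) else 0)" for m j
    by (simp add: \<phi>_def lookup_sum lookup_single when_def)
  have hom: "push \<phi> (A i) (f * g) = push \<phi> (A i) f * push \<phi> (A i) g" for i and f g :: "('v, 'k) mpoly"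
  proof (rule push_mult)
    show "m + n \<in> A i \<longleftrightarrow> m \<in> A i \<and> n \<in> A i" for m n
      by (auto simp: A_def subset_iff in_keys_iff lookup_add)
    show "\<phi> (m + n) = \<phi> m + \<phi> n" for m n
      by (rule poly_mapping_eqI) (simp add: lk lookup_add)
  qed
  have prime: "prime_ideal (Q i)" for i
  proof -
    have "\<phi> 0 = 0" by (rule poly_mapping_eqI) (simp add: lk)
    moreover have "0 \<in> A i" by (simp add: A_def)
    ultimately show ?thesis
      by (auto simp: prime_ideal_def Q_def hom push_add intro!: ideal.subspaceI)
  qed
  have step: "Q i \<subset> Q (Suc i)" if "i < d" for i
  proof
    have "push \<phi> (A (Suc i)) f = push (\<lambda>\<nu>. \<nu>) {\<nu>. Poly_Mapping.lookup \<nu> i = 0} (push \<phi> (A i) f)"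
      for f :: "('v, 'k) mpoly"
    proof -
      have "A (Suc i) = A i \<inter> {m. \<phi> m \<in> {\<nu>. Poly_Mapping.lookup \<nu> i = 0}}" (is "_ = ?B")
      proof (intro equalityI subsetI)
        fix m assume m: "m \<in> A (Suc i)"
        have "e i \<notin> e ` {Suc i..<d}" using that inj_onD[OF e] by force
        then have "e i \<notin> Poly_Mapping.keys m" using m by (auto simp: A_def)
        moreover have "e ` {Suc i..<d} \<subseteq> e ` {i..<d}" by auto
        ultimately show "m \<in> ?B" using m that by (auto simp: A_def lk in_keys_iff)
      next
        fix m assume m: "m \<in> ?B"
        then have "Poly_Mapping.keys m \<subseteq> e ` {i..<d} - {e i}"
          using that by (auto simp: A_def lk in_keys_iff)
        moreover have "{i..<d} = insert i {Suc i..<d}" using that by auto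
        ultimately show "m \<in> A (Suc i)" by (auto simp: A_def)
      qed
      then show ?thesis by (simp add: push_push)
    qed
    then show "Q i \<subseteq> Q (Suc i)" by (auto simp: Q_def)
    have "(Var (e i) :: ('v, 'k) mpoly) \<in> Q (Suc i)"
      using that inj_onD[OF e] by (force simp: Q_def Var_def A_def)
    moreover have "(Var (e i) :: ('v, 'k) mpoly) \<notin> Q i"
      using that by (auto simp: Q_def Var_def A_def poly_mapping_eq_iff fun_eq_iff lookup_single when_def)
    ultimately show "Q i \<noteq> Q (Suc i)" by blast
  qed
  have "I \<subseteq> Q i" if "i \<le> d" for i
  proof -
    have "push \<phi> (A i) f = 0" if "f \<in> I" for f
    proof -
      have "A i \<subseteq> A 0" by (auto simp: A_def)
      then have "Poly_Mapping.keys f \<inter> A i = {}"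
        using I[OF that] by (auto simp: A_def atLeast0LessThan)
      then show ?thesis by (simp add: push_def)
    qed
    then show ?thesis by (auto simp: Q_def)
  qed
  then show ?thesis
    unfolding krull_dim_def using prime step by (intro Sup_upper) blast
qed

section \<open>Convex geometries\<close>

definition extreme :: "'a set set \<Rightarrow> 'a set \<Rightarrow> 'a set" where
  "extreme \<F> A = {s \<in> A. A - {s} \<in> \<F>}"

text \<open>Modulo the forms \<open>\<theta> q\<close> with \<open>q\<close> in \<open>Q\<close>,
  the variable \<open>Xv q\<close> represents the pair of index \<open>q\<close>.\<close>

definition tr :: "'a set \<Rightarrow> 'a vertex \<Rightarrow> 'a vertex" where
  "tr Q v = (case v of Xv p \<Rightarrow> Xv p | Yv p \<Rightarrow> if p \<in> Q then Xv p else Yv p)"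

abbreviation tr_mon :: "'a set \<Rightarrow> ('a vertex \<Rightarrow>\<^sub>0 nat) \<Rightarrow> ('a vertex \<Rightarrow>\<^sub>0 nat)" where
  "tr_mon Q \<equiv> push (tr Q) UNIV"

abbreviation identify :: "'a set \<Rightarrow> ('a vertex, 'k::field) mpoly \<Rightarrow> ('a vertex, 'k) mpoly" where
  "identify Q \<equiv> push (tr_mon Q) UNIV"

abbreviation \<theta> :: "'a \<Rightarrow> ('a vertex, 'k::field) mpoly" where
  "\<theta> p \<equiv> Var (Xv p) - Var (Yv p)"

definition mon :: "'a set \<Rightarrow> 'a vertex \<Rightarrow>\<^sub>0 nat" where
  "mon C = (\<Sum>p\<in>C. Poly_Mapping.single (Xv p) 1)"

lemma monomial_induct [case_names zero single add]:
  fixes m :: "'v \<Rightarrow>\<^sub>0 nat"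
  assumes "P 0" "\<And>v. P (Poly_Mapping.single v 1)" "\<And>m n. P m \<Longrightarrow> P n \<Longrightarrow> P (m + n)"
  shows "P m"
proof (induction m rule: pm_induct)
  case (single v)
  have "P (Poly_Mapping.single v k)" for k
  proof (induction k)
    case (Suc k)
    have "Poly_Mapping.single v (Suc k) = Poly_Mapping.single v 1 + Poly_Mapping.single v k"
      by (simp flip: single_add)
    then show ?case using assms Suc by metis
  qed (simp add: assms)
  then show ?case .
qed (use assms in auto)

lemma keys_push_nat: "Poly_Mapping.keys (push r UNIV (m :: 'v \<Rightarrow>\<^sub>0 nat)) = r ` Poly_Mapping.keys m"
proof
  show "r ` Poly_Mapping.keys m \<subseteq> Poly_Mapping.keys (push r UNIV m)"
  proof
    fix w assume "w \<in> r ` Poly_Mapping.keys m"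
    then obtain v where "v \<in> Poly_Mapping.keys m" "w = r v" by auto
    then show "w \<in> Poly_Mapping.keys (push r UNIV m)"
      by (auto simp: in_keys_iff lookup_push)
  qed
qed (use keys_push[of r UNIV m] in auto)

lemma lookup_tr_mon [simp]:
  "Poly_Mapping.lookup (tr_mon Q m) (Xv q)
     = Poly_Mapping.lookup m (Xv q) + (if q \<in> Q then Poly_Mapping.lookup m (Yv q) else 0)"
  "Poly_Mapping.lookup (tr_mon Q m) (Yv q) = (if q \<in> Q then 0 else Poly_Mapping.lookup m (Yv q))"
proof -
  have "Poly_Mapping.lookup (tr_mon Q m) (Xv q)
     = Poly_Mapping.lookup m (Xv q) + (if q \<in> Q then Poly_Mapping.lookup m (Yv q) else 0) \<and>
    Poly_Mapping.lookup (tr_mon Q m) (Yv q) = (if q \<in> Q then 0 else Poly_Mapping.lookup m (Yv q))"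
  proof (induction m rule: monomial_induct)
    case (single v)
    show ?case by (cases v) (auto simp: tr_def lookup_single when_def)
  qed (auto simp: push_add lookup_add)
  then show "Poly_Mapping.lookup (tr_mon Q m) (Xv q)
     = Poly_Mapping.lookup m (Xv q) + (if q \<in> Q then Poly_Mapping.lookup m (Yv q) else 0)"
    "Poly_Mapping.lookup (tr_mon Q m) (Yv q) = (if q \<in> Q then 0 else Poly_Mapping.lookup m (Yv q))"
    by blast+
qed

lemma monomial_degree_tr_mon: "monomial_degree (tr_mon Q m) = monomial_degree m"
  by (induction m rule: monomial_induct) (auto simp: push_add monomial_degree_add)

lemma identify_mult: "identify Q (f * g) = identify Q f * identify Q g"
  by (rule push_mult_hom) (simp add: push_add)

lemma identify_empty: "identify {} f = f"
proof -
  have "tr {} = (\<lambda>v. v :: 'a vertex)" by (auto simp: tr_def fun_eq_iff split: vertex.split)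
  then have "tr_mon {} = (\<lambda>m. m :: 'a vertex \<Rightarrow>\<^sub>0 nat)" by (intro ext) simp
  then show ?thesis by simp
qed

lemma identify_Var [simp]: "identify Q (Var v) = Var (tr Q v)"
  by (simp add: Var_def)

lemma prod_Var:
  "finite F \<Longrightarrow> (\<Prod>v\<in>F. Var v) = Poly_Mapping.single (\<Sum>v\<in>F. Poly_Mapping.single v 1) 1"
  by (induction F rule: finite_induct) (auto simp: Var_def mult_single)

lemma lookup_sum_single:
  "finite F \<Longrightarrow> Poly_Mapping.lookup (\<Sum>v\<in>F. Poly_Mapping.single v (Suc 0)) w = (if w \<in> F then 1 else 0)"
  by (simp add: lookup_sum lookup_single when_def)

lemma lookup_mon:
  assumes "finite C"
  shows "Poly_Mapping.lookup (mon C) (Xv p) = (if p \<in> C then 1 else 0)"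
    "Poly_Mapping.lookup (mon C) (Yv p) = 0"
  using assms by (simp_all add: mon_def lookup_sum lookup_single when_def)

lemma keys_mon: "finite C \<Longrightarrow> Poly_Mapping.keys (mon C) = Xv ` C"
proof (rule set_eqI)
  show "finite C \<Longrightarrow> v \<in> Poly_Mapping.keys (mon C) \<longleftrightarrow> v \<in> Xv ` C" for v
    by (cases v) (auto simp: in_keys_iff lookup_mon)
qed

lemma tr_mon_mon: "finite C \<Longrightarrow> tr_mon Q (mon C) = mon C"
proof (rule poly_mapping_eqI)
  show "finite C \<Longrightarrow> Poly_Mapping.lookup (tr_mon Q (mon C)) v = Poly_Mapping.lookup (mon C) v" for v
    by (cases v) (auto simp: lookup_mon)
qed

lemma mon_insert: "finite C \<Longrightarrow> p \<notin> C \<Longrightarrow> mon (insert p C) = Poly_Mapping.single (Xv p) 1 + mon C"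
  by (simp add: mon_def)

lemma monomial_degree_mon: "finite C \<Longrightarrow> monomial_degree (mon C) = card C"
  by (induction C rule: finite_induct) (auto simp: mon_insert monomial_degree_add, simp add: mon_def monomial_degree_def)

lemma lookup_Var_mult [simp]:
  "Poly_Mapping.lookup (Var v * f) (Poly_Mapping.single v (Suc 0) + u) = Poly_Mapping.lookup f u"
  using lookup_single_mult_add[of "Poly_Mapping.single v 1" 1 f u] by (simp add: Var_def)

lemma lookup_Var_mult_zero:
  "Poly_Mapping.lookup w v = 0 \<Longrightarrow> Poly_Mapping.lookup (Var v * f) w = 0"
  unfolding Var_def by (rule lookup_single_mult_zero) (auto simp: lookup_add)

lemma bounded_monomials:
  assumes "finite F"
  shows "finite {m :: 'v \<Rightarrow>\<^sub>0 nat. Poly_Mapping.keys m \<subseteq> F \<and> (\<forall>v. Poly_Mapping.lookup m v \<le> b)} \<and>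
    card {m :: 'v \<Rightarrow>\<^sub>0 nat. Poly_Mapping.keys m \<subseteq> F \<and> (\<forall>v. Poly_Mapping.lookup m v \<le> b)} \<le> (b + 1) ^ card F"
    (is "finite ?S \<and> _")
proof -
  let ?r = "\<lambda>m. restrict (Poly_Mapping.lookup m) F"
  let ?T = "PiE F (\<lambda>_. {..b})"
  have inj: "inj_on ?r ?S"
  proof (rule inj_onI, rule poly_mapping_eqI)
    fix m n v assume mn: "m \<in> ?S" "n \<in> ?S" "?r m = ?r n"
    show "Poly_Mapping.lookup m v = Poly_Mapping.lookup n v"
    proof (cases "v \<in> F")
      case True
      then show ?thesis using fun_cong[OF mn(3), of v] by simp
    next
      case False
      then have "v \<notin> Poly_Mapping.keys m" "v \<notin> Poly_Mapping.keys n" using mn by auto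
      then show ?thesis by (simp add: in_keys_iff)
    qed
  qed
  have sub: "?r ` ?S \<subseteq> ?T" by auto
  have "finite ?T" using assms by (intro finite_PiE) auto
  then show ?thesis
    using inj_on_finite[OF inj sub] card_inj_on_le[OF inj sub] assms by (simp add: card_PiE)
qed

lemma span_diffD: "x - y \<in> ideal.span S \<Longrightarrow> y \<in> ideal.span S \<Longrightarrow> x \<in> ideal.span S"
  using ideal.span_add[of "x - y" S y] by simp

text \<open>The axiom \<open>closure\<close> is the Krein-Milman property of convex geometries: a
  closed set is the hull of its extreme points. The ground set \<open>P\<close> may fail to be
  closed, just as a meet-semilattice may have no top.\<close>

locale convex_family =
  fixes P :: "'a set" and \<F> :: "'a set set"
  assumes fin: "finite P" and sub: "A \<in> \<F> \<Longrightarrow> A \<subseteq> P" and ne: "\<F> \<noteq> {}"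
    and int: "A \<in> \<F> \<Longrightarrow> B \<in> \<F> \<Longrightarrow> A \<inter> B \<in> \<F>"
    and closure: "A \<in> \<F> \<Longrightarrow> B \<in> \<F> \<Longrightarrow> extreme \<F> A \<subseteq> B \<Longrightarrow> A \<subseteq> B"
begin

section \<open>Standard monomials after identifying some pairs of variables\<close>

definition \<Gamma> :: "'a vertex set set" where
  "\<Gamma> = {F. \<exists>A\<in>\<F>. F \<subseteq> Xv ` (P - A) \<union> Yv ` A}"

definition gens :: "('a vertex, 'k::field) mpoly set" where
  "gens = {\<Prod>v\<in>F. Var v | F. finite F \<and> F \<notin> \<Gamma>}"

text \<open>The set \<open>D\<close> fixes a reading of the identified pairs: as \<open>y\<close>
  for \<open>q\<close> in \<open>D\<close>, as \<open>x\<close> otherwise. For a member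
  \<open>A\<close> of the family the condition says that \<open>v\<close>, read in this way, is a
  vertex of the facet of \<open>A\<close>.\<close>

definition compat :: "'a set \<Rightarrow> 'a set \<Rightarrow> 'a set \<Rightarrow> 'a vertex \<Rightarrow> bool" where
  "compat Q D A v = (case v of
      Xv p \<Rightarrow> p \<in> P \<and> (if p \<in> Q then p \<in> A \<longleftrightarrow> p \<in> D else p \<notin> A)
    | Yv p \<Rightarrow> p \<in> P \<and> (if p \<in> Q then p \<in> A \<longleftrightarrow> p \<in> D else p \<in> A))"

text \<open>The standard monomials of \<open>gens \<union> \<theta> ` Q\<close> up to exchanging \<open>x q\<close> and \<open>y q\<close> for \<open>q \<in> Q\<close>:
  their support in \<open>Q\<close> is shattered by the members of \<open>\<F>\<close> compatible with the rest.\<close>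
definition good :: "'a set \<Rightarrow> ('a vertex \<Rightarrow>\<^sub>0 nat) \<Rightarrow> bool" where
  "good Q u \<longleftrightarrow> (\<forall>q\<in>Q. Poly_Mapping.lookup u (Xv q) + Poly_Mapping.lookup u (Yv q) \<le> 1) \<and>
     (\<forall>D. \<exists>A\<in>\<F>. \<forall>v\<in>Poly_Mapping.keys u. compat Q D A v)"

text \<open>An explicit candidate for the ideal generated by \<open>gens\<close> and the forms
  \<open>\<theta> q\<close> with \<open>q\<close> in \<open>Q\<close>, in which membership is a
  condition on coefficients.\<close>

definition normal_ideal :: "'a set \<Rightarrow> ('a vertex, 'k::field) mpoly set" where
  "normal_ideal Q = {f. \<forall>u\<in>Poly_Mapping.keys (identify Q f). \<not> good Q u}"

lemma fin_mem: "A \<in> \<F> \<Longrightarrow> finite A"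
  using sub fin finite_subset by blast

lemma fin_family: "finite \<F>"
  using sub fin by (meson PowI finite_Pow_iff finite_subset subsetI)

text \<open>Deleting several extreme points amounts to intersecting the sets \<open>A - {s}\<close>,
  so a full cube of members hangs below \<open>A\<close>.\<close>

lemma diff_extreme:
  assumes "A \<in> \<F>" "D \<subseteq> extreme \<F> A"
  shows "A - D \<in> \<F>"
proof -
  have "finite D" using assms fin_mem[of A] finite_subset[of D A] by (auto simp: extreme_def)
  then show ?thesis using assms(2)
  proof (induction D)
    case (insert s D)
    then have "A - {s} \<in> \<F>" "A - D \<in> \<F>" by (auto simp: extreme_def)
    moreover have "A - insert s D = (A - {s}) \<inter> (A - D)" by auto
    ultimately show ?case using int by simp
  qed (simp add: assms)
qed

text \<open>\<open>A\<close> is the smallest member that contains \<open>B\<close> and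
  \<open>C\<close>, so minimality confines its extreme points to these sets. If some
  \<open>c\<close> in \<open>C - B\<close> were not extreme, a member containing \<open>B\<close>
  and meeting \<open>C\<close> in \<open>C - {c}\<close> would contain all extreme points of
  \<open>A\<close>, hence \<open>A\<close> by \<open>closure\<close>, although it misses
  \<open>c\<close>.\<close>

lemma cube:
  assumes shat: "\<And>D. \<exists>A\<in>\<F>. B \<subseteq> A \<and> N \<inter> A = {} \<and> A \<inter> C = D \<inter> C"
  obtains A where "A \<in> \<F>" "B \<union> C \<subseteq> A" "N \<inter> A = {}" "extreme \<F> A \<subseteq> B \<union> C" "C - B \<subseteq> extreme \<F> A"
proof -
  let ?S = "{A \<in> \<F>. B \<union> C \<subseteq> A}"
  obtain A0 where A0: "A0 \<in> ?S" "N \<inter> A0 = {}" using shat[of C] by auto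
  define A where "A = arg_min card (\<lambda>A. A \<in> ?S)"
  have A: "A \<in> ?S" unfolding A_def using A0(1) by (rule arg_min_natI)
  have min: "A \<subseteq> A'" if "A' \<in> ?S" for A'
  proof -
    have "A \<inter> A' \<in> ?S" using that A int by auto
    then have "card A \<le> card (A \<inter> A')"
      unfolding A_def[symmetric] using arg_min_nat_le[of "\<lambda>A. A \<in> ?S" _ card, folded A_def] by blast
    then have "A \<inter> A' = A" using A fin_mem[of A] by (intro card_seteq) auto
    then show ?thesis by auto
  qed
  have ext: "extreme \<F> A \<subseteq> B \<union> C"
  proof
    fix s assume s: "s \<in> extreme \<F> A"
    show "s \<in> B \<union> C"
    proof (rule ccontr)
      assume "s \<notin> B \<union> C"
      then have "A - {s} \<in> ?S" using s A by (auto simp: extreme_def)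
      then show False using min s by (auto simp: extreme_def)
    qed
  qed
  have "c \<in> extreme \<F> A" if c: "c \<in> C - B" for c
  proof (rule ccontr)
    assume *: "c \<notin> extreme \<F> A"
    obtain A' where A': "A' \<in> \<F>" "B \<subseteq> A'" "A' \<inter> C = (C - {c}) \<inter> C"
      using shat[of "C - {c}"] by blast
    then have "extreme \<F> A \<subseteq> A'" using ext * by blast
    then have "A \<subseteq> A'" using A A' closure by blast
    then show False using A A' c by blast
  qed
  moreover have "N \<inter> A = {}" using min[OF A0(1)] A0(2) by blast
  ultimately show ?thesis using that[of A] A ext by auto
qed

lemma good_mono:
  assumes "good Q (m + n)" shows "good Q n"
proof -
  have "Poly_Mapping.keys n \<subseteq> Poly_Mapping.keys (m + n)"
    by (auto simp: in_keys_iff lookup_add)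
  moreover have "Poly_Mapping.lookup n v \<le> Poly_Mapping.lookup (m + n) v" for v
    by (simp add: lookup_add)
  ultimately show ?thesis
    using assms unfolding good_def by (meson add_mono order_trans subsetD)
qed

lemma compat_tr: "compat Q D A (tr Q v) \<longleftrightarrow> compat Q D A v"
  by (cases v) (auto simp: compat_def tr_def)

lemma good_tr_mon: "good Q (tr_mon Q m) \<longleftrightarrow> good Q m"
  unfolding good_def keys_push_nat by (auto simp: compat_tr)

lemma subspace_not_good: "ideal.subspace {g :: ('a vertex, 'k::field) mpoly. \<forall>u\<in>Poly_Mapping.keys g. \<not> good Q u}"
  (is "ideal.subspace ?S")
proof (rule ideal.subspaceI)
  show "f + g \<in> ?S" if "f \<in> ?S" "g \<in> ?S" for f g
    using that keys_add[of f g] by blast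
  show "c * f \<in> ?S" if f: "f \<in> ?S" for c f
  proof (intro CollectI ballI notI)
    fix u assume u: "u \<in> Poly_Mapping.keys (c * f)" "good Q u"
    then obtain m n where n: "u = m + n" "n \<in> Poly_Mapping.keys f" using keys_mult[of c f] by blast
    have "good Q n" using u(2) unfolding n(1) by (rule good_mono)
    then show False using f n(2) by auto
  qed
qed simp

lemma subspace_normal_ideal: "ideal.subspace (normal_ideal Q :: ('a vertex, 'k::field) mpoly set)"
proof (rule ideal.subspaceI)
  note S = subspace_not_good[where 'k = 'k, of Q]
  show "f + g \<in> normal_ideal Q" if "f \<in> normal_ideal Q" "g \<in> normal_ideal Q"
    for f g :: "('a vertex, 'k) mpoly"
    using ideal.subspace_add[OF S, of "identify Q f" "identify Q g"] that
    by (simp add: normal_ideal_def push_add)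
  show "c * f \<in> normal_ideal Q" if "f \<in> normal_ideal Q" for c f :: "('a vertex, 'k) mpoly"
    using ideal.subspace_scale[OF S, of "identify Q f" "identify Q c"] that
    by (simp add: normal_ideal_def identify_mult)
qed (simp add: normal_ideal_def)

lemma in_normal_ideal_iff:
  "f \<in> normal_ideal Q \<longleftrightarrow> (\<forall>u. good Q u \<longrightarrow> Poly_Mapping.lookup (identify Q f) u = 0)"
  by (auto simp: normal_ideal_def in_keys_iff)

lemma gens_in_normal_ideal:
  assumes "finite F" "F \<notin> \<Gamma>"
  shows "(\<Prod>v\<in>F. Var v) \<in> normal_ideal Q"
proof -
  let ?u = "\<Sum>v\<in>F. Poly_Mapping.single v (1::nat)"
  have "\<not> good Q ?u"
  proof
    assume *: "good Q ?u"
    have keys: "Poly_Mapping.keys ?u = F"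
      using assms(1) by (auto simp: in_keys_iff lookup_sum_single split: if_splits)
    \<comment> \<open>For this \<open>D\<close> the vertices of \<open>F\<close> are read as they
      stand, so a compatible member exhibits \<open>F\<close> as a face. A pair with both vertices
      in \<open>F\<close> is excluded by the degree bound in \<open>good\<close>.\<close>
    obtain A where A: "A \<in> \<F>" "\<forall>v\<in>F. compat Q {q. Yv q \<in> F} A v"
      using * unfolding good_def keys by blast
    have "v \<in> Xv ` (P - A) \<union> Yv ` A" if "v \<in> F" for v
    proof (cases v)
      case (Xv p)
      have c: "compat Q {q. Yv q \<in> F} A (Xv p)" using A(2) that Xv by blast
      have "Yv p \<notin> F" if "p \<in> Q"
      proof
        assume "Yv p \<in> F"
        then have "Poly_Mapping.lookup ?u (Xv p) + Poly_Mapping.lookup ?u (Yv p) = 2"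
          using \<open>v \<in> F\<close> Xv assms(1) by (simp add: lookup_sum_single)
        then show False using * that by (auto simp: good_def)
      qed
      then show ?thesis using c Xv by (auto simp: compat_def split: if_splits)
    next
      case (Yv p)
      then have "compat Q {q. Yv q \<in> F} A (Yv p)" using A(2) that by blast
      then show ?thesis using that Yv by (auto simp: compat_def split: if_splits)
    qed
    then have "F \<subseteq> Xv ` (P - A) \<union> Yv ` A" by blast
    then show False using assms(2) A(1) unfolding \<Gamma>_def by blast
  qed
  then have "\<not> good Q (tr_mon Q ?u)" by (simp add: good_tr_mon)
  then show ?thesis using assms(1) by (simp add: prod_Var normal_ideal_def)
qed

lemma span_gens_subset: "Q \<subseteq> P \<Longrightarrow> ideal.span (gens \<union> \<theta> ` Q) \<subseteq> normal_ideal Q"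
proof (rule ideal.span_minimal[OF _ subspace_normal_ideal])
  have "\<theta> q \<in> normal_ideal Q" if "q \<in> Q" for q
    using that by (simp add: normal_ideal_def push_minus tr_def)
  then show "gens \<union> \<theta> ` Q \<subseteq> normal_ideal Q"
    by (auto simp: gens_def intro: gens_in_normal_ideal)
qed

text \<open>The variables are replaced one at a time; the induction needs an arbitrary cofactor
  \<open>n\<close> to absorb the variables not under treatment.\<close>

lemma monomial_congruence:
  assumes W: "ideal.subspace (W :: ('v, 'k::field) mpoly set)"
    and r: "\<And>v n c. Poly_Mapping.single (Poly_Mapping.single v 1 + n) c
      - Poly_Mapping.single (Poly_Mapping.single (r v) 1 + n) c \<in> W"
  shows "Poly_Mapping.single m c - Poly_Mapping.single (push r UNIV m) c \<in> W"
proof -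
  have "Poly_Mapping.single (m + n) c - Poly_Mapping.single (push r UNIV m + n) c \<in> W" for n
  proof (induction m arbitrary: n rule: monomial_induct)
    case zero
    show ?case using ideal.subspace_0[OF W] by simp
  next
    case (single v)
    show ?case using r[of v n c] by simp
  next
    case (add m1 m2)
    have "Poly_Mapping.single (m1 + (m2 + n)) c - Poly_Mapping.single (push r UNIV m1 + (m2 + n)) c \<in> W"
      "Poly_Mapping.single (m2 + (push r UNIV m1 + n)) c
        - Poly_Mapping.single (push r UNIV m2 + (push r UNIV m1 + n)) c \<in> W"
      by (rule add.IH)+
    from ideal.subspace_add[OF W this] show ?case by (simp add: push_add ac_simps)
  qed
  from this[of 0] show ?thesis by simp
qed

lemma monomial_in_gens:
  fixes c :: "'k::field"
  assumes "Poly_Mapping.keys u \<notin> \<Gamma>"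
  shows "Poly_Mapping.single u c \<in> ideal.span gens"
proof -
  let ?F = "Poly_Mapping.keys u" and ?u = "\<Sum>v\<in>Poly_Mapping.keys u. Poly_Mapping.single v (1::nat)"
  have "u = (u - ?u) + ?u"
    by (rule poly_mapping_eqI)
      (auto simp: lookup_add minus_poly_mapping.rep_eq lookup_sum_single in_keys_iff)
  then have "Poly_Mapping.single u c = Poly_Mapping.single (u - ?u) c * (\<Prod>v\<in>?F. Var v)"
    by (simp add: prod_Var mult_single)
  moreover have "(\<Prod>v\<in>?F. Var v :: ('a vertex, 'k) mpoly) \<in> gens"
    using assms by (auto simp: gens_def)
  ultimately show ?thesis by (simp add: ideal.span_scale ideal.span_base)
qed

lemma swap_in_span:
  fixes c :: "'k::field"
  assumes "q \<in> Q" "v \<in> {Xv q, Yv q}" "w \<in> {Xv q, Yv q}"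
  shows "Poly_Mapping.single (Poly_Mapping.single v 1 + n) c - Poly_Mapping.single (Poly_Mapping.single w 1 + n) c
    \<in> ideal.span (gens \<union> \<theta> ` Q)"
proof -
  have "Poly_Mapping.single n c * \<theta> q \<in> ideal.span (gens \<union> \<theta> ` Q)"
    using assms(1) by (intro ideal.span_scale ideal.span_base) auto
  also have "Poly_Mapping.single n c * \<theta> q = Poly_Mapping.single (Poly_Mapping.single (Xv q) 1 + n) c
      - Poly_Mapping.single (Poly_Mapping.single (Yv q) 1 + n) c"
    by (simp add: Var_def right_diff_distrib mult_single add.commute)
  finally have "Poly_Mapping.single (Poly_Mapping.single (Xv q) 1 + n) c
      - Poly_Mapping.single (Poly_Mapping.single (Yv q) 1 + n) c \<in> ideal.span (gens \<union> \<theta> ` Q)" .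
  from this ideal.span_neg[OF this] show ?thesis
    using assms(2,3) by (auto simp: ideal.span_zero)
qed

text \<open>Two variables of one identified pair can be swapped into \<open>Xv q\<close> and
  \<open>Yv q\<close>, which share no facet. If instead no member is compatible for some
  \<open>D\<close>, the substitution \<open>r\<close> that reads the pairs according to
  \<open>D\<close> produces a nonface.\<close>

lemma bad_monomial_in_span:
  fixes c :: "'k::field"
  assumes "Q \<subseteq> P" "\<not> good Q u"
  shows "Poly_Mapping.single u c \<in> ideal.span (gens \<union> \<theta> ` Q)" (is "_ \<in> ?W")
proof -
  have gens: "f \<in> ?W" if "f \<in> ideal.span gens" for f :: "('a vertex, 'k) mpoly"
    using that ideal.span_mono[of gens "gens \<union> \<theta> ` Q"] by auto
  consider q where "q \<in> Q" "Poly_Mapping.lookup u (Xv q) + Poly_Mapping.lookup u (Yv q) \<ge> 2"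
    | D where "\<forall>A\<in>\<F>. \<exists>v\<in>Poly_Mapping.keys u. \<not> compat Q D A v"
    using assms(2) by (auto simp: good_def not_le)
  then show ?thesis
  proof cases
    case (1 q)
    then have "Xv q \<in> Poly_Mapping.keys u \<or> Yv q \<in> Poly_Mapping.keys u" by (auto simp: in_keys_iff)
    then obtain v where v: "v \<in> {Xv q, Yv q}" "v \<in> Poly_Mapping.keys u" by auto
    obtain m where m: "u = Poly_Mapping.single v 1 + m" using split_off_var[OF v(2)] .
    have "Xv q \<in> Poly_Mapping.keys m \<or> Yv q \<in> Poly_Mapping.keys m"
      using 1(2) v(1) by (auto simp: m lookup_add lookup_single when_def in_keys_iff)
    then obtain w where w: "w \<in> {Xv q, Yv q}" "w \<in> Poly_Mapping.keys m" by auto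
    obtain n where n: "m = Poly_Mapping.single w 1 + n" using split_off_var[OF w(2)] .
    let ?x = "Poly_Mapping.single (Xv q) (1::nat)" and ?y = "Poly_Mapping.single (Yv q) (1::nat)"
    have "Poly_Mapping.single u c - Poly_Mapping.single (?x + m) c \<in> ?W"
      unfolding m using swap_in_span[OF 1(1) v(1), of "Xv q" m c] by simp
    moreover have "Poly_Mapping.single (?x + m) c
        - Poly_Mapping.single (?y + (?x + n)) c \<in> ?W"
    proof -
      have "?x + m = Poly_Mapping.single w 1 + (?x + n)" by (simp add: n ac_simps)
      then show ?thesis using swap_in_span[OF 1(1) w(1), of "Yv q" "?x + n" c] by simp
    qed
    moreover have "Poly_Mapping.single (?y + (?x + n)) c \<in> ?W"
    proof (rule gens, rule monomial_in_gens)
      have "{Xv q, Yv q} \<subseteq> Poly_Mapping.keys (?y + (?x + n))"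
        by (auto simp: in_keys_iff lookup_add)
      moreover have "{Xv q, Yv q} \<notin> \<Gamma>" by (auto simp: \<Gamma>_def)
      ultimately show "Poly_Mapping.keys (?y + (?x + n)) \<notin> \<Gamma>" unfolding \<Gamma>_def by blast
    qed
    ultimately show ?thesis by (blast intro: span_diffD)
  next
    case (2 D)
    define r where "r v = (case v of Xv p \<Rightarrow> if p \<in> Q \<and> p \<in> D then Yv p else Xv p
      | Yv p \<Rightarrow> if p \<in> Q \<and> p \<notin> D then Xv p else Yv p)" for v
    have "Poly_Mapping.single u c - Poly_Mapping.single (push r UNIV u) c \<in> ?W"
    proof (rule monomial_congruence[OF ideal.subspace_span])
      fix v and n :: "'a vertex \<Rightarrow>\<^sub>0 nat" and c :: 'k
      show "Poly_Mapping.single (Poly_Mapping.single v 1 + n) c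
          - Poly_Mapping.single (Poly_Mapping.single (r v) 1 + n) c \<in> ?W"
      proof (cases "r v = v")
        case False
        then obtain q where "q \<in> Q" "v \<in> {Xv q, Yv q}" "r v \<in> {Xv q, Yv q}"
          by (cases v) (auto simp: r_def split: if_splits)
        then show ?thesis by (rule swap_in_span)
      qed (simp add: ideal.span_zero)
    qed
    moreover have "Poly_Mapping.single (push r UNIV u) c \<in> ?W"
    proof (rule gens, rule monomial_in_gens)
      show "Poly_Mapping.keys (push r UNIV u) \<notin> \<Gamma>"
      proof
        assume "Poly_Mapping.keys (push r UNIV u) \<in> \<Gamma>"
        then obtain A where A: "A \<in> \<F>" "r ` Poly_Mapping.keys u \<subseteq> Xv ` (P - A) \<union> Yv ` A"
          by (auto simp: \<Gamma>_def keys_push_nat)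
        have "compat Q D A v" if "v \<in> Poly_Mapping.keys u" for v
        proof -
          have "r v \<in> Xv ` (P - A) \<union> Yv ` A" using A that by blast
          then show ?thesis
            using sub[OF A(1)] by (cases v) (auto simp: r_def compat_def split: if_splits)
        qed
        then show False using 2 A by blast
      qed
    qed
    ultimately show ?thesis by (rule span_diffD)
  qed
qed

text \<open>A polynomial is congruent to its identification modulo the forms, and for a member of
  \<open>normal_ideal\<close> the identification consists of bad monomials only.\<close>

lemma span_gens_eq:
  assumes "Q \<subseteq> P"
  shows "ideal.span (gens \<union> \<theta> ` Q) = (normal_ideal Q :: ('a vertex, 'k::field) mpoly set)" (is "?W = _")
proof
  show "normal_ideal Q \<subseteq> ?W"
  proof
    fix f :: "('a vertex, 'k) mpoly" assume f: "f \<in> normal_ideal Q"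
    have "g - identify Q g \<in> ?W" for g
    proof (induction g rule: pm_induct)
      case (single m)
      have "Poly_Mapping.single m c - Poly_Mapping.single (tr_mon Q m) c \<in> ?W" for c :: 'k
      proof (rule monomial_congruence[OF ideal.subspace_span])
        fix v and n :: "'a vertex \<Rightarrow>\<^sub>0 nat" and c :: 'k
        show "Poly_Mapping.single (Poly_Mapping.single v 1 + n) c
            - Poly_Mapping.single (Poly_Mapping.single (tr Q v) 1 + n) c \<in> ?W"
        proof (cases "tr Q v = v")
          case False
          then obtain q where "q \<in> Q" "v \<in> {Xv q, Yv q}" "tr Q v \<in> {Xv q, Yv q}"
            by (cases v) (auto simp: tr_def split: if_splits)
          then show ?thesis by (rule swap_in_span)
        qed (simp add: ideal.span_zero)
      qed
      then show ?case by simp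
    next
      case (add g h)
      from ideal.span_add[OF add] show ?case by (simp add: push_add algebra_simps)
    qed (simp add: ideal.span_zero)
    moreover have "identify Q f \<in> ?W"
      by (subst pm_expand, rule ideal.span_sum, rule bad_monomial_in_span[OF assms])
        (use f in \<open>auto simp: normal_ideal_def\<close>)
    ultimately show "f \<in> ?W" by (rule span_diffD)
  qed
qed (rule span_gens_subset[OF assms])

text \<open>The compatible members of \<open>\<F>\<close> contain a full cube over the support in \<open>Q\<close>, and on a cube
  membership of the remaining element \<open>p\<close> is constant.\<close>
lemma good_extend:
  assumes Q: "Q \<subseteq> P" and p: "p \<in> P - Q" and u: "good Q u" "Xv p \<notin> Poly_Mapping.keys u" "Yv p \<notin> Poly_Mapping.keys u"
  shows "good Q (Poly_Mapping.single (Xv p) 1 + u) \<or> good Q (Poly_Mapping.single (Yv p) 1 + u)"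
proof -
  \<comment> \<open>\<open>C\<close> collects the identified indices that occur in \<open>u\<close>
    and are shattered; \<open>B\<close> and \<open>N\<close> hold the indices outside
    \<open>Q\<close> that every compatible member must contain and must avoid, respectively.\<close>
  let ?C = "{q\<in>Q. Xv q \<in> Poly_Mapping.keys u \<or> Yv q \<in> Poly_Mapping.keys u}"
  let ?B = "{q\<in>-Q. Yv q \<in> Poly_Mapping.keys u}" and ?N = "{q\<in>-Q. Xv q \<in> Poly_Mapping.keys u}"
  have "\<exists>A\<in>\<F>. ?B \<subseteq> A \<and> ?N \<inter> A = {} \<and> A \<inter> ?C = D \<inter> ?C" for D
  proof -
    obtain A where "A \<in> \<F>" "\<forall>v\<in>Poly_Mapping.keys u. compat Q D A v"
      using u(1) unfolding good_def by blast
    then show ?thesis by (intro bexI[of _ A]) (force simp: compat_def)+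
  qed
  then obtain A where A: "A \<in> \<F>" "?B \<union> ?C \<subseteq> A" "?N \<inter> A = {}" "?C - ?B \<subseteq> extreme \<F> A"
    by (rule cube) auto
  have C: "?C \<subseteq> extreme \<F> A" using A(4) by auto
  have mem: "A - (?C - D) \<in> \<F>" for D using C by (intro diff_extreme[OF A(1)]) auto
  have P: "q \<in> P" if "v \<in> Poly_Mapping.keys u" "v = Xv q \<or> v = Yv q" for v q
    using u(1) that by (force simp: good_def compat_def)
  have compat: "compat Q D (A - (?C - D)) v" if "v \<in> Poly_Mapping.keys u" for v D
    using that A P[OF that] by (cases v) (auto simp: compat_def)
  have *: "good Q (Poly_Mapping.single v 1 + u)"
    if v: "v \<in> {Xv p, Yv p}" "\<And>D. compat Q D (A - (?C - D)) v" for v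
    unfolding good_def
  proof (intro conjI allI ballI)
    fix q assume "q \<in> Q"
    then show "Poly_Mapping.lookup (Poly_Mapping.single v 1 + u) (Xv q)
        + Poly_Mapping.lookup (Poly_Mapping.single v 1 + u) (Yv q) \<le> 1"
      using u(1) p v(1) by (auto simp: good_def lookup_add lookup_single when_def)
  next
    fix D
    have "w = v \<or> w \<in> Poly_Mapping.keys u" if "w \<in> Poly_Mapping.keys (Poly_Mapping.single v 1 + u)" for w
      using that keys_add[of "Poly_Mapping.single v 1" u] by auto
    then show "\<exists>A\<in>\<F>. \<forall>w\<in>Poly_Mapping.keys (Poly_Mapping.single v 1 + u). compat Q D A w"
      using compat v(2) by (intro bexI[OF _ mem] ballI) blast
  qed
  show ?thesis
  proof (cases "p \<in> A")
    case True
    then have "good Q (Poly_Mapping.single (Yv p) 1 + u)"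
      using p by (intro *) (auto simp: compat_def)
    then show ?thesis ..
  next
    case False
    then have "good Q (Poly_Mapping.single (Xv p) 1 + u)"
      using p by (intro *) (auto simp: compat_def)
    then show ?thesis ..
  qed
qed

lemma good_repeat:
  assumes "p \<notin> Q" "v = Xv p \<or> v = Yv p" "v \<in> Poly_Mapping.keys u" "good Q u"
  shows "good Q (Poly_Mapping.single v 1 + u)"
proof -
  have "Poly_Mapping.keys (Poly_Mapping.single v 1 + u) = Poly_Mapping.keys u"
    using assms(3) by (auto simp: in_keys_iff lookup_add lookup_single when_def split: if_splits)
  then show ?thesis
    using assms by (auto simp: good_def lookup_add lookup_single when_def)
qed

lemma good_not_both:
  assumes "p \<notin> Q" "good Q u"
  shows "Xv p \<notin> Poly_Mapping.keys u \<or> Yv p \<notin> Poly_Mapping.keys u"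
proof (rule ccontr)
  assume *: "\<not> ?thesis"
  obtain A where "\<forall>v\<in>Poly_Mapping.keys u. compat Q {} A v"
    using assms(2) unfolding good_def by blast
  then have "compat Q {} A (Xv p)" "compat Q {} A (Yv p)" using * by auto
  then show False using assms(1) by (simp add: compat_def)
qed

text \<open>A standard \<open>u\<close> remains standard after multiplication by \<open>Xv p\<close>
  or by \<open>Yv p\<close>, and no standard monomial contains both. In the product with
  \<open>\<theta> p\<close>, the coefficient at the enlarged monomial therefore comes from one
  summand alone and is, up to sign, that of \<open>u\<close>.\<close>

lemma nzd_\<theta>:
  assumes Q: "Q \<subseteq> P" and p: "p \<in> P - Q"
  shows "nzd (gens \<union> \<theta> ` Q :: ('a vertex, 'k::field) mpoly set) (\<theta> p)"
  unfolding nzd_def span_gens_eq[OF Q]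
proof (intro allI impI)
  fix f :: "('a vertex, 'k) mpoly" assume f: "\<theta> p * f \<in> normal_ideal Q"
  let ?g = "identify Q f"
  have tr: "tr Q (Xv p) = Xv p" "tr Q (Yv p) = Yv p" using p by (auto simp: tr_def)
  have *: "Poly_Mapping.lookup (Var (Xv p) * ?g) w = Poly_Mapping.lookup (Var (Yv p) * ?g) w"
    if "good Q w" for w
    using f that by (simp add: in_normal_ideal_iff identify_mult left_diff_distrib push_minus lookup_minus tr)
  have "Poly_Mapping.lookup ?g u = 0" if u: "good Q u" for u
  proof -
    have X: ?thesis if "good Q (Poly_Mapping.single (Xv p) 1 + u)"
    proof -
      have "Yv p \<notin> Poly_Mapping.keys (Poly_Mapping.single (Xv p) 1 + u)"
        using good_not_both[OF _ that, of p] p by (auto simp: in_keys_iff lookup_add lookup_single)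
      then have "Poly_Mapping.lookup (Var (Yv p) * ?g) (Poly_Mapping.single (Xv p) 1 + u) = 0"
        by (intro lookup_Var_mult_zero) (simp add: in_keys_iff)
      then show ?thesis using *[OF that] by simp
    qed
    have Y: ?thesis if "good Q (Poly_Mapping.single (Yv p) 1 + u)"
    proof -
      have "Xv p \<notin> Poly_Mapping.keys (Poly_Mapping.single (Yv p) 1 + u)"
        using good_not_both[OF _ that, of p] p by (auto simp: in_keys_iff lookup_add lookup_single)
      then have "Poly_Mapping.lookup (Var (Xv p) * ?g) (Poly_Mapping.single (Yv p) 1 + u) = 0"
        by (intro lookup_Var_mult_zero) (simp add: in_keys_iff)
      then show ?thesis using *[OF that] by simp
    qed
    show ?thesis using X Y good_extend[OF Q p u] good_repeat[OF _ _ _ u] p by blast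
  qed
  then show "f \<in> normal_ideal Q" by (simp add: in_normal_ideal_iff)
qed

lemma regular_on_\<theta>:
  assumes "distinct ps" "set ps = P"
  shows "regular_on gens (map \<theta> ps :: ('a vertex, 'k::field) mpoly list)"
  unfolding regular_on_iff
proof (intro allI impI)
  fix i assume i: "i < length (map \<theta> ps :: ('a vertex, 'k) mpoly list)"
  have "ps ! i \<notin> set (take i ps)" using i assms(1) by (auto simp: in_set_conv_nth nth_eq_iff_index_eq)
  moreover have "set (take i (map \<theta> ps)) = (\<theta> ` set (take i ps) :: ('a vertex, 'k) mpoly set)"
    by (simp add: take_map)
  ultimately show "nzd (gens \<union> set (take i (map \<theta> ps))) (map \<theta> ps ! i :: ('a vertex, 'k) mpoly)"
    using nzd_\<theta>[of "set (take i ps)" "ps ! i", where 'k = 'k] assms(2) i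
    by (simp add: set_take_subset) (metis nth_mem set_take_subset)
qed

lemma card_facet:
  assumes "A \<in> \<F>"
  shows "card (Xv ` (P - A) \<union> Yv ` A) = card P"
proof -
  have "card (Xv ` (P - A) \<union> Yv ` A) = card (Xv ` (P - A)) + card (Yv ` A)"
    using fin fin_mem[OF assms] by (intro card_Un_disjoint) auto
  also have "\<dots> = card (P - A) + card A" by (simp add: card_image inj_on_def)
  also have "\<dots> = card P"
    using sub[OF assms] fin by (metis card_Diff_subset card_mono finite_subset le_add_diff_inverse2)
  finally show ?thesis .
qed

lemma good_empty_iff:
  "good {} u \<longleftrightarrow> (\<exists>A\<in>\<F>. Poly_Mapping.keys u \<subseteq> Xv ` (P - A) \<union> Yv ` A)"
proof -
  have "(\<forall>v\<in>Poly_Mapping.keys u. compat {} D A v) \<longleftrightarrow> Poly_Mapping.keys u \<subseteq> Xv ` (P - A) \<union> Yv ` A"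
    if "A \<in> \<F>" for A D
  proof -
    have "compat {} D A v \<longleftrightarrow> v \<in> Xv ` (P - A) \<union> Yv ` A" for v
      using sub[OF that] by (cases v) (auto simp: compat_def)
    then show ?thesis by auto
  qed
  then show ?thesis by (auto simp: good_def)
qed

text \<open>Standard monomials are those supported on facets, each of which has
  \<open>card P\<close> vertices. Counting them facet by facet bounds the dimension above, and the
  variables of any one facet provide the chain of primes.\<close>

lemma krull_dim_gens: "krull_dim (ideal.span gens :: ('a vertex, 'k::field) mpoly set) = enat (card P)"
proof (rule antisym)
  have I: "ideal.span gens = (normal_ideal {} :: ('a vertex, 'k) mpoly set)"
    using span_gens_eq[of "{}"] by simp
  show "krull_dim (ideal.span gens :: ('a vertex, 'k) mpoly set) \<le> enat (card P)"
  proof (rule krull_dim_le[where G = "Collect (good {})" and C = "card \<F>"])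
    fix f :: "('a vertex, 'k) mpoly" assume f: "push (\<lambda>m. m) (Collect (good {})) f = 0"
    have "Poly_Mapping.lookup f u = 0" if "good {} u" for u
      using that lookup_push_id[of "Collect (good {})" f u] by (simp add: f)
    then show "f \<in> ideal.span gens" by (simp add: I in_normal_ideal_iff identify_empty)
  next
    fix b :: nat
    let ?S = "\<lambda>A. {m. Poly_Mapping.keys m \<subseteq> Xv ` (P - A) \<union> Yv ` A \<and> (\<forall>v. Poly_Mapping.lookup m v \<le> b)}"
    have eq: "{m \<in> Collect (good {}). \<forall>v. Poly_Mapping.lookup m v \<le> b} = (\<Union>A\<in>\<F>. ?S A)"
      by (auto simp: good_empty_iff)
    have S: "finite (?S A) \<and> card (?S A) \<le> (b + 1) ^ card P" if "A \<in> \<F>" for A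
      using bounded_monomials[of "Xv ` (P - A) \<union> Yv ` A" b] fin fin_mem[OF that] card_facet[OF that] by simp
    show "finite {m \<in> Collect (good {}). \<forall>v. Poly_Mapping.lookup m v \<le> b}"
      unfolding eq using fin_family S by blast
    have "card (\<Union>A\<in>\<F>. ?S A) \<le> (\<Sum>A\<in>\<F>. card (?S A))" using fin_family by (rule card_UN_le)
    also have "\<dots> \<le> (\<Sum>A\<in>\<F>. (b + 1) ^ card P)" using S by (intro sum_mono) blast
    finally show "card {m \<in> Collect (good {}). \<forall>v. Poly_Mapping.lookup m v \<le> b} \<le> card \<F> * (b + 1) ^ card P"
      unfolding eq by simp
  qed
  obtain A where A: "A \<in> \<F>" using ne by auto
  let ?F = "Xv ` (P - A) \<union> Yv ` A"
  have "finite ?F" using fin fin_mem[OF A] by simp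
  then obtain e where e: "bij_betw e {..<card P} ?F"
    using ex_bij_betw_nat_finite[of ?F] card_facet[OF A] by (auto simp: atLeast0LessThan)
  show "enat (card P) \<le> krull_dim (ideal.span gens :: ('a vertex, 'k) mpoly set)"
  proof (rule krull_dim_ge[where e = e])
    fix f :: "('a vertex, 'k) mpoly" and m
    assume "f \<in> ideal.span gens" "m \<in> Poly_Mapping.keys f"
    then have "\<not> good {} m" by (simp add: I normal_ideal_def identify_empty)
    then show "\<not> Poly_Mapping.keys m \<subseteq> e ` {..<card P}"
      using e A by (auto simp: good_empty_iff bij_betw_def)
  qed (use e in \<open>auto simp: bij_betw_def\<close>)
qed

section \<open>The Artinian reduction and its socle\<close>

definition shattered :: "'a set \<Rightarrow> bool" where
  "shattered C \<longleftrightarrow> C \<subseteq> P \<and> (\<forall>D. \<exists>A\<in>\<F>. A \<inter> C = D \<inter> C)"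

text \<open>Apply \<open>cube\<close> with nothing forced in or out: the smallest member containing
  a shattered \<open>C\<close> has exactly \<open>C\<close> as extreme points. Conversely, deleting
  subsets of the extreme points realises every trace.\<close>

lemma shattered_iff: "shattered C \<longleftrightarrow> C \<in> extreme \<F> ` \<F>"
proof
  assume "shattered C"
  then have "\<exists>A\<in>\<F>. {} \<subseteq> A \<and> {} \<inter> A = {} \<and> A \<inter> C = D \<inter> C" for D by (simp add: shattered_def)
  then obtain A where "A \<in> \<F>" "extreme \<F> A \<subseteq> {} \<union> C" "C - {} \<subseteq> extreme \<F> A" by (rule cube)
  then show "C \<in> extreme \<F> ` \<F>" by auto
next
  assume "C \<in> extreme \<F> ` \<F>"
  then obtain A where A: "A \<in> \<F>" "C = extreme \<F> A" by auto
  have CA: "C \<subseteq> A" using A by (auto simp: extreme_def)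
  have "\<exists>B\<in>\<F>. B \<inter> C = D \<inter> C" for D
    using CA diff_extreme[OF A(1), of "C - D"] A(2) by (intro bexI[of _ "A - (C - D)"]) auto
  then show "shattered C" using CA sub[OF A(1)] by (auto simp: shattered_def)
qed

lemma shattered_mono: "shattered C \<Longrightarrow> B \<subseteq> C \<Longrightarrow> shattered B"
  unfolding shattered_def
proof safe
  fix D assume *: "B \<subseteq> C" "\<forall>D. \<exists>A\<in>\<F>. A \<inter> C = D \<inter> C"
  then obtain A where "A \<in> \<F>" "A \<inter> C = D \<inter> C" by blast
  then show "\<exists>A\<in>\<F>. A \<inter> B = D \<inter> B" using *(1) by (intro bexI[of _ A]) auto
qed auto

lemma shattered_finite: "shattered C \<Longrightarrow> finite C"
  using fin finite_subset by (auto simp: shattered_def)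

lemma good_mon: "finite C \<Longrightarrow> good P (mon C) \<longleftrightarrow> shattered C"
proof -
  assume C: "finite C"
  have "(\<forall>v\<in>Poly_Mapping.keys (mon C). compat P D A v) \<longleftrightarrow> C \<subseteq> P \<and> A \<inter> C = D \<inter> C" for D A
    unfolding keys_mon[OF C] by (auto simp: compat_def)
  then show ?thesis using ne by (auto simp: good_def shattered_def lookup_mon[OF C])
qed

text \<open>Identification over all of \<open>P\<close> removes the variables \<open>Yv p\<close>
  from a standard monomial, and the bound on each pair makes it squarefree.\<close>

lemma good_tr_mon_eq:
  assumes "good P (tr_mon P m)"
  obtains C where "tr_mon P m = mon C" "shattered C"
proof -
  let ?u = "tr_mon P m"
  define C where "C = {p. Xv p \<in> Poly_Mapping.keys ?u}"
  have verts: "p \<in> P" if "v \<in> Poly_Mapping.keys ?u" "v = Xv p \<or> v = Yv p" for v p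
    using assms that by (force simp: good_def compat_def)
  then have C: "finite C" using fin finite_subset[of C P] by (auto simp: C_def)
  have "?u = mon C"
  proof (rule poly_mapping_eqI)
    fix v
    show "Poly_Mapping.lookup ?u v = Poly_Mapping.lookup (mon C) v"
    proof (cases v)
      case (Xv p)
      have "Poly_Mapping.lookup ?u (Xv p) \<le> 1" if "p \<in> P"
        using assms that unfolding good_def by (meson add_leD1)
      moreover have "Poly_Mapping.lookup ?u (Xv p) = 0" if "p \<notin> P"
        using verts[of "Xv p" p] that by (auto simp: in_keys_iff)
      ultimately have "Poly_Mapping.lookup ?u (Xv p) \<le> 1" by fastforce
      then show ?thesis using Xv C
        by (auto simp del: lookup_tr_mon simp: lookup_mon C_def in_keys_iff)
    next
      case (Yv p)
      have "Poly_Mapping.lookup ?u (Yv p) = 0"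
        using verts[of "Yv p" p] by (cases "p \<in> P") (auto simp del: lookup_tr_mon simp: in_keys_iff, simp)
      then show ?thesis using Yv C by (simp del: lookup_tr_mon add: lookup_mon)
    qed
  qed
  then show ?thesis using that good_mon[OF C] assms by simp
qed

lemma in_normal_ideal_P_iff:
  "f \<in> normal_ideal P \<longleftrightarrow> (\<forall>C. shattered C \<longrightarrow> Poly_Mapping.lookup (identify P f) (mon C) = 0)"
proof
  assume "f \<in> normal_ideal P"
  then show "\<forall>C. shattered C \<longrightarrow> Poly_Mapping.lookup (identify P f) (mon C) = 0"
    using good_mon shattered_finite by (auto simp: in_normal_ideal_iff)
next
  assume *: "\<forall>C. shattered C \<longrightarrow> Poly_Mapping.lookup (identify P f) (mon C) = 0"
  show "f \<in> normal_ideal P"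
    unfolding normal_ideal_def
  proof (intro CollectI ballI notI)
    fix u assume u: "u \<in> Poly_Mapping.keys (identify P f)" "good P u"
    then obtain m where "u = tr_mon P m" using keys_push[of "tr_mon P" UNIV f] by auto
    with u(2) obtain C where "u = mon C" "shattered C" using good_tr_mon_eq by metis
    then show False using * u(1) by (auto simp: in_keys_iff)
  qed
qed

definition normal_form :: "('a vertex, 'k::field) mpoly \<Rightarrow> ('a vertex, 'k) mpoly" where
  "normal_form f = push (\<lambda>m. m) (Collect (good P)) (identify P f)"

lemma normal_form_keys:
  assumes "u \<in> Poly_Mapping.keys (normal_form f)"
  obtains C where "u = mon C" "shattered C" "Poly_Mapping.lookup (identify P f) (mon C) \<noteq> 0"
proof -
  have u: "good P u" "u \<in> Poly_Mapping.keys (identify P f)"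
    using assms by (auto simp: normal_form_def in_keys_iff split: if_splits)
  then obtain m where "u = tr_mon P m" using keys_push[of "tr_mon P" UNIV f] by auto
  with u(1) obtain C where "u = mon C" "shattered C" using good_tr_mon_eq by metis
  then show ?thesis using that u by (auto simp: in_keys_iff)
qed

lemma identify_normal_form: "identify P (normal_form f) = normal_form f"
proof -
  let ?g = "normal_form f"
  have "tr_mon P u = u" if "u \<in> Poly_Mapping.keys ?g" for u
    using that shattered_finite tr_mon_mon by (metis normal_form_keys)
  moreover have "identify P ?g
      = (\<Sum>u\<in>Poly_Mapping.keys ?g. Poly_Mapping.single (tr_mon P u) (Poly_Mapping.lookup ?g u))"
    by (simp add: push_def[of "tr_mon P"])
  ultimately have "identify P ?g = (\<Sum>u\<in>Poly_Mapping.keys ?g. Poly_Mapping.single u (Poly_Mapping.lookup ?g u))"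
    by simp
  then show ?thesis by (simp flip: pm_expand)
qed

lemma diff_normal_form: "f - normal_form f \<in> normal_ideal P"
proof -
  have "Poly_Mapping.lookup (normal_form f) u = Poly_Mapping.lookup (identify P f) u" if "good P u" for u
    using that by (simp add: normal_form_def)
  then show ?thesis
    by (simp add: in_normal_ideal_iff push_minus identify_normal_form lookup_minus)
qed

lemma span_\<theta>_P: "ideal.span (gens \<union> \<theta> ` P) = (normal_ideal P :: ('a vertex, 'k::field) mpoly set)"
  by (rule span_gens_eq) simp

lemma mon_notin: "shattered C \<Longrightarrow> Poly_Mapping.single (mon C) (1::'k::field) \<notin> normal_ideal P"
  using shattered_finite[of C] by (auto simp: in_normal_ideal_P_iff tr_mon_mon)

lemma one_notin: "1 \<notin> (normal_ideal P :: ('a vertex, 'k::field) mpoly set)"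
proof -
  have "shattered {}" using ne by (auto simp: shattered_def)
  from mon_notin[OF this] show ?thesis by (simp add: mon_def)
qed

lemma hsop_\<theta>:
  assumes "distinct ps" "set ps = P"
  shows "hsop (ideal.span gens) (map \<theta> ps :: ('a vertex, 'k::field) mpoly list)"
  unfolding hsop_def
proof (intro conjI)
  show "enat (length (map \<theta> ps :: ('a vertex, 'k) mpoly list)) = krull_dim (ideal.span gens :: ('a vertex, 'k) mpoly set)"
    using distinct_card[OF assms(1)] assms(2) by (simp add: krull_dim_gens)
  have "homogeneous 1 (\<theta> p :: ('a vertex, 'k) mpoly)" for p
    by (simp add: homogeneous_iff_hcomp mp.comp_minus) (simp add: hcomp_def Var_def)
  then show "\<forall>f\<in>set (map \<theta> ps :: ('a vertex, 'k) mpoly list). \<exists>d>0. homogeneous d f" by auto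
  \<comment> \<open>Taking all subsets of \<open>P\<close> makes finiteness evident; the monomials
    of the normal forms are among these.\<close>
  let ?B = "(\<lambda>C. Poly_Mapping.single (mon C) (1::'k)) ` Pow P"
  let ?W = "mpoly.span (?B \<union> normal_ideal P)"
  have "f \<in> ?W" for f :: "('a vertex, 'k) mpoly"
  proof -
    have "normal_form f \<in> ?W"
    proof (subst pm_expand, rule mpoly.span_sum)
      fix u assume "u \<in> Poly_Mapping.keys (normal_form f)"
      then obtain C where "u = mon C" "shattered C" using normal_form_keys by metis
      then have "coeff_scale (Poly_Mapping.lookup (normal_form f) u) (Poly_Mapping.single u 1) \<in> ?W"
        by (intro mpoly.span_scale mpoly.span_base) (auto simp: shattered_def)
      then show "Poly_Mapping.single u (Poly_Mapping.lookup (normal_form f) u) \<in> ?W" by simp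
    qed
    moreover have "f - normal_form f \<in> ?W" using diff_normal_form by (intro mpoly.span_base) auto
    ultimately have "normal_form f + (f - normal_form f) \<in> ?W" by (rule mpoly.span_add)
    then show ?thesis by simp
  qed
  moreover have "add_gens (ideal.span gens) (map \<theta> ps) = (normal_ideal P :: ('a vertex, 'k) mpoly set)"
    using assms(2) by (simp add: add_gens_span span_\<theta>_P)
  ultimately show "\<exists>B. finite B \<and> mpoly.span (B \<union> add_gens (ideal.span gens) (map \<theta> ps))
      = (UNIV :: ('a vertex, 'k) mpoly set)"
    using fin by (intro exI[of _ ?B]) auto
qed

lemma facets_iff:
  "C \<in> facets (extreme \<F> ` \<F>) \<longleftrightarrow> shattered C \<and> (\<forall>p. p \<notin> C \<longrightarrow> \<not> shattered (insert p C))"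
proof
  show "C \<in> facets (extreme \<F> ` \<F>) \<Longrightarrow> shattered C \<and> (\<forall>p. p \<notin> C \<longrightarrow> \<not> shattered (insert p C))"
    unfolding facets_def shattered_iff by blast
  assume *: "shattered C \<and> (\<forall>p. p \<notin> C \<longrightarrow> \<not> shattered (insert p C))"
  have "G = C" if G: "shattered G" "C \<subseteq> G" for G
  proof (rule ccontr)
    assume "G \<noteq> C"
    then obtain p where "p \<in> G" "p \<notin> C" using G(2) by blast
    then show False using * G shattered_mono[OF G(1), of "insert p C"] by auto
  qed
  then show "C \<in> facets (extreme \<F> ` \<F>)"
    using * unfolding facets_def mem_Collect_eq shattered_iff by blast
qed

text \<open>Multiplication by \<open>Xv p\<close> carries the basis element of \<open>C\<close> to
  that of \<open>insert p C\<close>, or to zero if this set is not shattered or \<open>p\<close> is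
  in \<open>C\<close> already. For fixed \<open>p\<close> the nonzero images stay distinct, so each
  term of a socle element is annihilated separately and belongs to a facet.\<close>

lemma socle_iff_pure:
  "socle_in_one_degree (normal_ideal P :: ('a vertex, 'k::field) mpoly set) \<longleftrightarrow> pure_complex (extreme \<F> ` \<F>)"
proof
  assume pure: "pure_complex (extreme \<F> ` \<F>)"
  obtain e where e: "\<And>C. C \<in> facets (extreme \<F> ` \<F>) \<Longrightarrow> card C = e"
    using pure by (metis pure_complex_def)
  show "socle_in_one_degree (normal_ideal P :: ('a vertex, 'k) mpoly set)"
    unfolding socle_in_one_degree_def
  proof (intro exI[of _ e] allI impI)
    fix f :: "('a vertex, 'k) mpoly" assume f: "\<forall>v. Var v * f \<in> normal_ideal P"
    have "homogeneous e (normal_form f)"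
      unfolding homogeneous_def
    proof
      fix u assume "u \<in> Poly_Mapping.keys (normal_form f)"
      then obtain C where C: "u = mon C" "shattered C" "Poly_Mapping.lookup (identify P f) (mon C) \<noteq> 0"
        by (rule normal_form_keys)
      have "\<not> shattered (insert p C)" if "p \<notin> C" for p
      proof
        assume "shattered (insert p C)"
        then have "Poly_Mapping.lookup (identify P (Var (Xv p) * f)) (mon (insert p C)) = 0"
          using f by (simp add: in_normal_ideal_P_iff)
        then show False
          using C(3) shattered_finite[OF C(2)] that by (simp add: identify_mult tr_def mon_insert)
      qed
      then have "C \<in> facets (extreme \<F> ` \<F>)" using C by (simp add: facets_iff)
      then show "monomial_degree u = e"
        using e C shattered_finite by (simp add: monomial_degree_mon)
    qed
    then show "\<exists>g. homogeneous e g \<and> f - g \<in> normal_ideal P" using diff_normal_form by blast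
  qed
next
  assume "socle_in_one_degree (normal_ideal P :: ('a vertex, 'k) mpoly set)"
  then obtain e where e: "\<And>f :: ('a vertex, 'k) mpoly. \<forall>v. Var v * f \<in> normal_ideal P
      \<Longrightarrow> \<exists>g. homogeneous e g \<and> f - g \<in> normal_ideal P"
    by (auto simp: socle_in_one_degree_def)
  have "card C = e" if "C \<in> facets (extreme \<F> ` \<F>)" for C
  proof (rule ccontr)
    assume ce: "card C \<noteq> e"
    have C: "shattered C" "\<And>p. p \<notin> C \<Longrightarrow> \<not> shattered (insert p C)" using that by (auto simp: facets_iff)
    have fC: "finite C" using C shattered_finite by blast
    let ?x = "Poly_Mapping.single (mon C) 1 :: ('a vertex, 'k) mpoly"
    have "Var v * ?x \<in> normal_ideal P" for v
    proof -
      have eq: "Var v * ?x = Poly_Mapping.single (Poly_Mapping.single v 1 + mon C) 1"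
        by (simp add: Var_def mult_single)
      have "\<not> good P (tr_mon P (Poly_Mapping.single v 1 + mon C))"
      proof
        assume g: "good P (tr_mon P (Poly_Mapping.single v 1 + mon C))"
        then obtain C' where C': "tr_mon P (Poly_Mapping.single v 1 + mon C) = mon C'" "shattered C'"
          by (rule good_tr_mon_eq)
        \<comment> \<open>Comparing exponents with the squarefree \<open>mon C'\<close> shows that
          the new variable is some \<open>Xv p\<close> with \<open>p\<close> outside
          \<open>C\<close>, which contradicts maximality.\<close>
        have lk: "Poly_Mapping.lookup (mon C') (Xv q)
            = (if tr P v = Xv q then 1 else 0) + (if q \<in> C then 1 else 0)" for q
          using fC by (simp del: lookup_tr_mon add: C'(1)[symmetric] push_add tr_mon_mon lookup_add lookup_mon lookup_single when_def)
        have "tr P v \<in> Poly_Mapping.keys (tr_mon P (Poly_Mapping.single v 1 + mon C))"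
          unfolding keys_push_nat by (intro imageI) (simp add: in_keys_iff lookup_add)
        then obtain p where tr: "tr P v = Xv p"
          unfolding C'(1) keys_mon[OF shattered_finite[OF C'(2)]] by blast
        have "p \<notin> C" using lk[of p] shattered_finite[OF C'(2)] tr by (auto simp: lookup_mon split: if_splits)
        moreover have "C' = insert p C"
          using lk shattered_finite[OF C'(2)] tr by (force simp: lookup_mon split: if_splits)
        ultimately show False using C C' by auto
      qed
      then show ?thesis unfolding eq by (simp add: normal_ideal_def)
    qed
    then obtain g where g: "homogeneous e g" "?x - g \<in> normal_ideal P" using e by blast
    \<comment> \<open>Identification preserves degrees, so a form of degree \<open>e\<close> cannot
      contribute to \<open>mon C\<close>, whose degree is \<open>card C\<close>.\<close>
    have "Poly_Mapping.lookup (identify P g) (mon C) = 0"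
    proof (rule ccontr)
      assume "Poly_Mapping.lookup (identify P g) (mon C) \<noteq> 0"
      then obtain m where "m \<in> Poly_Mapping.keys g" "mon C = tr_mon P m"
        using keys_push[of "tr_mon P" UNIV g] by (auto simp flip: in_keys_iff)
      then show False
        using g(1) ce monomial_degree_mon[OF fC] monomial_degree_tr_mon[of P m] by (auto simp: homogeneous_def)
    qed
    moreover have "Poly_Mapping.lookup (identify P (?x - g)) (mon C) = 0"
      using g(2) C(1) by (simp add: in_normal_ideal_P_iff)
    ultimately show False by (simp add: push_minus lookup_minus tr_mon_mon[OF fC])
  qed
  then show "pure_complex (extreme \<F> ` \<F>)" by (simp add: pure_complex_def)
qed

theorem level_iff_pure:
  "level_complex TYPE('k::field) \<Gamma> \<longleftrightarrow> pure_complex (extreme \<F> ` \<F>)"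
proof -
  obtain ps where ps: "distinct ps" "set ps = P" using finite_distinct_list[OF fin] by auto
  have hom: "mp.hom_gens (gens :: ('a vertex, 'k) mpoly set)"
  proof -
    have "hcomp (monomial_degree u) (Poly_Mapping.single u (1::'k)) = Poly_Mapping.single u 1" for u :: "'a vertex \<Rightarrow>\<^sub>0 nat"
      by (simp add: hcomp_def)
    then have "\<exists>e. hcomp e (\<Prod>v\<in>F. Var v) = ((\<Prod>v\<in>F. Var v) :: ('a vertex, 'k) mpoly)"
      if "finite F" for F :: "'a vertex set"
      using that by (metis prod_Var)
    then show ?thesis unfolding mp.hom_gens_def gens_def by blast
  qed
  have eq: "add_gens (ideal.span gens) (map \<theta> ps) = (normal_ideal P :: ('a vertex, 'k) mpoly set)"
    using ps by (simp add: add_gens_span span_\<theta>_P)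
  have reg: "regular_sequence (ideal.span gens) (map \<theta> ps :: ('a vertex, 'k) mpoly list)"
    using regular_on_\<theta>[OF ps] one_notin ps(2) by (simp add: regular_sequence_span_iff span_\<theta>_P)
  have "stanley_reisner_ideal \<Gamma> = (ideal.span gens :: ('a vertex, 'k) mpoly set)"
    by (simp add: stanley_reisner_ideal_def gens_def)
  then show ?thesis
    using level_ring_iff[OF hom hsop_\<theta>[OF ps] reg] socle_iff_pure[where 'k = 'k]
    by (simp add: level_complex_def eq)
qed

end

section \<open>Meet-distributive semilattices\<close>

lemma isGlb_iff:
  "isGlb L A m \<longleftrightarrow> m \<in> L \<and> (\<forall>a\<in>A. m \<le> a) \<and> (\<forall>z\<in>L. (\<forall>a\<in>A. z \<le> a) \<longrightarrow> z \<le> m)"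
  by (auto simp: isGlb_def greatestP_def isLb_def setge_def setle_def)

lemma lower_neighborsD:
  assumes "b \<in> lower_neighbors L a"
  shows "b \<in> L" "b < a" "\<And>c. c \<in> L \<Longrightarrow> b \<le> c \<Longrightarrow> c < a \<Longrightarrow> c = b"
  using assms by (auto simp: lower_neighbors_def order_le_less)

locale finite_meet_semilattice =
  fixes L :: "'a::order set"
  assumes finL: "finite L" and semilattice: "meet_semilattice L"
begin

lemma meet_ex:
  assumes "a \<in> L" "b \<in> L"
  obtains m where "m \<in> L" "m \<le> a" "m \<le> b" "\<And>z. z \<in> L \<Longrightarrow> z \<le> a \<Longrightarrow> z \<le> b \<Longrightarrow> z \<le> m"
proof -
  obtain m where "isGlb L {a, b} m" using semilattice assms by (auto simp: meet_semilattice_def)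
  then show ?thesis using that[of m] by (auto simp: isGlb_iff)
qed

lemma L_induct [consumes 1, case_names less]:
  assumes "a \<in> L" "\<And>a. a \<in> L \<Longrightarrow> (\<And>c. c \<in> L \<Longrightarrow> c < a \<Longrightarrow> Q c) \<Longrightarrow> Q a"
  shows "Q a"
  using assms(1)
proof (induction "card {c \<in> L. c \<le> a}" arbitrary: a rule: less_induct)
  case less
  show ?case
  proof (rule assms(2)[OF less.prems])
    fix c assume c: "c \<in> L" "c < a"
    then have "{d \<in> L. d \<le> c} \<subseteq> {d \<in> L. d \<le> a}" by (auto intro: order_trans)
    moreover have "a \<in> {d \<in> L. d \<le> a}" "a \<notin> {d \<in> L. d \<le> c}"
      using c less.prems by (auto simp: less_le_not_le)
    ultimately have "{d \<in> L. d \<le> c} \<subset> {d \<in> L. d \<le> a}" by blast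
    then have "card {d \<in> L. d \<le> c} < card {d \<in> L. d \<le> a}" using finL by (intro psubset_card_mono) auto
    then show "Q c" using less.hyps c(1) by blast
  qed
qed

lemma below_lower_neighbor:
  assumes "x \<in> L" "x < a"
  obtains b where "b \<in> lower_neighbors L a" "x \<le> b"
proof -
  have "finite {c \<in> L. x \<le> c \<and> c < a}" "x \<in> {c \<in> L. x \<le> c \<and> c < a}" using finL assms by auto
  then obtain b where "b \<in> {c \<in> L. x \<le> c \<and> c < a}" "\<forall>c\<in>{c \<in> L. x \<le> c \<and> c < a}. b \<le> c \<longrightarrow> b = c"
    using finite_has_maximal[of "{c \<in> L. x \<le> c \<and> c < a}"] by blast
  then have "b \<in> lower_neighbors L a" "x \<le> b" by (auto simp: lower_neighbors_def)
  then show ?thesis by (rule that)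
qed

lemma ell_mono: "a \<le> b \<Longrightarrow> ell L a \<subseteq> ell L b"
  by (auto simp: ell_def)

text \<open>If the meet of \<open>a\<close> and \<open>b\<close> were below a lower neighbor
  \<open>c\<close> of \<open>a\<close>, then every lower neighbor is below \<open>b\<close> by
  induction, hence below that meet and below \<open>c\<close>. So \<open>c\<close> is the only one,
  \<open>a\<close> is join-irreducible, and \<open>a\<close> itself occurs in
  \<open>ell L b\<close>.\<close>

lemma le_if_ell_subset:
  assumes "a \<in> L" "b \<in> L" "ell L a \<subseteq> ell L b"
  shows "a \<le> b"
  using assms
proof (induction a rule: L_induct)
  case (less a)
  obtain m where m: "m \<in> L" "m \<le> a" "m \<le> b" "\<And>z. z \<in> L \<Longrightarrow> z \<le> a \<Longrightarrow> z \<le> b \<Longrightarrow> z \<le> m"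
    using meet_ex less.hyps less.prems(1) by blast
  show ?case
  proof (cases "m = a")
    case False
    then have "m < a" using m by simp
    then obtain c where c: "c \<in> lower_neighbors L a" "m \<le> c" using below_lower_neighbor m(1) by blast
    have "d = c" if d: "d \<in> lower_neighbors L a" for d
    proof -
      note D = lower_neighborsD[OF d]
      have "d \<le> b"
        using less.IH[OF D(1,2) less.prems(1)] ell_mono[OF less_imp_le[OF D(2)]] less.prems(2) by blast
      then have "d \<le> c" using m(4)[OF D(1) less_imp_le[OF D(2)]] c(2) by auto
      then show ?thesis using D(3)[of c] lower_neighborsD[OF c(1)] by auto
    qed
    with c(1) have "\<exists>!d. d \<in> lower_neighbors L a" by (rule ex1I)
    with less.hyps have "a \<in> ell L a" by (simp add: ell_def join_irreducibles_def)
    then have "a \<in> ell L b" using less.prems(2) by blast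
    then show ?thesis by (simp add: ell_def)
  qed (use m in simp)
qed

lemma finite_meet:
  assumes "finite A" "A \<noteq> {}" "A \<subseteq> L"
  shows "\<exists>m. isGlb L A m"
  using assms
proof (induction rule: finite_ne_induct)
  case (singleton x)
  then show ?case by (auto simp: isGlb_iff)
next
  case (insert x A)
  then obtain m where m: "isGlb L A m" by auto
  then obtain n where "n \<in> L" "n \<le> x" "n \<le> m" "\<And>z. z \<in> L \<Longrightarrow> z \<le> x \<Longrightarrow> z \<le> m \<Longrightarrow> z \<le> n"
    using meet_ex[of x m] insert.prems by (auto simp: isGlb_iff)
  then have "isGlb L (insert x A) n" using m by (auto simp: isGlb_iff)
  then show ?case by blast
qed

lemma lower_meet:
  assumes "a \<in> L" "lower_neighbors L a \<noteq> {}"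
  shows "isGlb L (lower_neighbors L a) (lower_meet L a)"
proof -
  have "lower_neighbors L a \<subseteq> L" by (auto simp: lower_neighbors_def)
  then obtain m where m: "isGlb L (lower_neighbors L a) m"
    using finite_meet[of "lower_neighbors L a"] finL finite_subset assms(2) by blast
  moreover have "n = m" if "isGlb L (lower_neighbors L a) n" for n
    using m that by (auto simp: isGlb_iff intro: antisym)
  ultimately have "(THE m. isGlb L (lower_neighbors L a) m) = m" by (intro the_equality)
  then show ?thesis using m assms(2) by (simp add: lower_meet_def)
qed

lemma S_set_diff_neighbor:
  assumes "a \<in> L" "b \<in> lower_neighbors L a"
  shows "ell L a - ell L b \<subseteq> S_set L a"
proof -
  have "isGlb L (lower_neighbors L a) (lower_meet L a)" using lower_meet assms by blast
  then have "lower_meet L a \<le> b" using assms(2) by (auto simp: isGlb_iff)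
  then show ?thesis using ell_mono[of "lower_meet L a" b] by (auto simp: S_set_def)
qed

text \<open>Otherwise the meet of \<open>a\<close> and \<open>b\<close> lies below some lower
  neighbor \<open>c\<close> of \<open>a\<close>. A join-irreducible below \<open>a\<close> but not
  below \<open>c\<close> belongs to \<open>S_set L a\<close>, so it is below \<open>b\<close>, hence
  below the meet and below \<open>c\<close>.\<close>

lemma S_set_subset_imp_le:
  assumes "a \<in> L" "b \<in> L" "S_set L a \<subseteq> ell L b"
  shows "a \<le> b"
proof (rule ccontr)
  assume "\<not> a \<le> b"
  obtain m where m: "m \<in> L" "m \<le> a" "m \<le> b" "\<And>z. z \<in> L \<Longrightarrow> z \<le> a \<Longrightarrow> z \<le> b \<Longrightarrow> z \<le> m"
    using meet_ex assms(1,2) by blast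
  have "m < a" using m \<open>\<not> a \<le> b\<close> by (auto simp: order_le_less)
  then obtain c where c: "c \<in> lower_neighbors L a" "m \<le> c" using below_lower_neighbor m(1) by blast
  have "\<not> a \<le> c" using lower_neighborsD(2)[OF c(1)] by auto
  then obtain s where s: "s \<in> ell L a" "s \<notin> ell L c"
    using le_if_ell_subset[OF assms(1) lower_neighborsD(1)[OF c(1)]] by blast
  then have "s \<in> ell L b" using S_set_diff_neighbor[OF assms(1) c(1)] assms(3) by blast
  then have "s \<le> m" using s(1) m(4)[of s] by (auto simp: ell_def join_irreducibles_def)
  then show False using s c(2) by (auto simp: ell_def)
qed

end

locale finite_meet_distributive = finite_meet_semilattice +
  assumes meet_distr: "meet_distributive L"
begin

text \<open>Boolean coordinates on the interval from \<open>lower_meet L a\<close> to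
  \<open>a\<close>, in a form that can be reused: \<open>f\<close> is the coordinate map, and
  \<open>x b\<close> is the one point that the lower neighbor \<open>b\<close> misses.\<close>

lemma coatoms:
  assumes a: "a \<in> L" and "lower_neighbors L a \<noteq> {}"
  shows "\<exists>(X :: nat set) f x.
    (\<forall>Y\<subseteq>X. \<exists>c\<in>L. lower_meet L a \<le> c \<and> c \<le> a \<and> f c = Y) \<and>
    (\<forall>c\<in>L. \<forall>d\<in>L. lower_meet L a \<le> c \<and> c \<le> a \<and> lower_meet L a \<le> d \<and> d \<le> a
      \<longrightarrow> (c \<le> d \<longleftrightarrow> f c \<subseteq> f d)) \<and>
    (\<forall>b\<in>lower_neighbors L a. x b \<in> X \<and> f b = X - {x b}) \<and> inj_on x (lower_neighbors L a)"
proof -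
  let ?m = "lower_meet L a"
  have glb: "isGlb L (lower_neighbors L a) ?m" using lower_meet assms by blast
  have m: "?m \<in> L" "\<And>b. b \<in> lower_neighbors L a \<Longrightarrow> ?m \<le> b" using glb by (auto simp: isGlb_iff)
  \<comment> \<open>The interval contains all lower neighbors of \<open>a\<close>, so its bottom is
    their meet within the interval as \<open>meet_distributive\<close> demands.\<close>
  have N: "lower_neighbors L a \<inter> {?m..a} = lower_neighbors L a"
    using m(2) by (auto simp: lower_neighbors_def)
  then have "?m \<le> a" using m(2) assms(2) lower_neighborsD(2) by (meson all_not_in_conv less_imp_le order_trans)
  then have "boolean_lattice (L \<inter> {?m..a})"
    using meet_distr a m(1) glb N unfolding meet_distributive_def by metis
  from this[unfolded boolean_lattice_def] obtain X :: "nat set" and f where "finite X"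
    and f: "bij_betw f (L \<inter> {?m..a}) (Pow X)"
      "\<forall>x\<in>L \<inter> {?m..a}. \<forall>y\<in>L \<inter> {?m..a}. x \<le> y \<longleftrightarrow> f x \<subseteq> f y"
    by (elim exE conjE)
  have surj: "\<exists>c\<in>L. ?m \<le> c \<and> c \<le> a \<and> f c = Y" if "Y \<subseteq> X" for Y
  proof -
    have "Y \<in> f ` (L \<inter> {?m..a})" using f(1) that by (simp add: bij_betw_def)
    then show ?thesis by auto
  qed
  have ord: "c \<le> d \<longleftrightarrow> f c \<subseteq> f d"
    if "c \<in> L" "d \<in> L" "?m \<le> c" "c \<le> a" "?m \<le> d" "d \<le> a" for c d
  proof -
    have "c \<in> L \<inter> {?m..a}" "d \<in> L \<inter> {?m..a}" using that by auto
    then show ?thesis by (rule f(2)[rule_format])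
  qed
  have range: "f c \<subseteq> X" if "c \<in> L" "?m \<le> c" "c \<le> a" for c
    using f(1) that by (auto simp: bij_betw_def)
  have fa: "f a = X"
  proof -
    obtain e where e: "e \<in> L" "?m \<le> e" "e \<le> a" "f e = X" using surj[of X] by auto
    have "a \<le> e" using ord[OF a e(1) \<open>?m \<le> a\<close> order_refl e(2,3)] range[OF a \<open>?m \<le> a\<close> order_refl] e(4) by simp
    then show ?thesis using e by auto
  qed
  have "\<exists>x. x \<in> X \<and> f b = X - {x}" if b: "b \<in> lower_neighbors L a" for b
  proof -
    note B = lower_neighborsD[OF b]
    have mb: "?m \<le> b" "b \<le> a" using m(2)[OF b] B(2) by auto
    have "\<not> a \<le> b" using B(2) by auto
    then have "\<not> f a \<subseteq> f b" using ord[OF a B(1) \<open>?m \<le> a\<close> order_refl mb] by simp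
    then obtain x where x: "x \<in> X" "x \<notin> f b" using fa by auto
    obtain c where c: "c \<in> L" "?m \<le> c" "c \<le> a" "f c = X - {x}" using surj[of "X - {x}"] by auto
    have "b \<le> c" using ord[OF B(1) c(1) mb c(2,3)] c(4) range[OF B(1) mb] x(2) by auto
    moreover have "c \<noteq> a" using c(4) fa x(1) by auto
    ultimately have "c = b" using B(3)[of c] c by auto
    then show ?thesis using c x by auto
  qed
  then have "\<exists>x. \<forall>b\<in>lower_neighbors L a. x b \<in> X \<and> f b = X - {x b}" by (intro bchoice) simp
  then obtain x where x: "\<forall>b\<in>lower_neighbors L a. x b \<in> X \<and> f b = X - {x b}" ..
  moreover have "inj_on x (lower_neighbors L a)"
  proof (rule inj_onI)
    fix c d assume cd: "c \<in> lower_neighbors L a" "d \<in> lower_neighbors L a" "x c = x d"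
    then have "f c = f d" using x by simp
    moreover have "?m \<le> e" "e \<le> a" "e \<in> L" if "e \<in> {c, d}" for e
      using that cd m(2)[of e] lower_neighborsD(1,2)[of e L a] by auto
    ultimately show "c = d" using ord[of c d] ord[of d c] by (intro antisym) auto
  qed
  ultimately show ?thesis
    by (intro exI[of _ X] exI[of _ f] exI[of _ x] conjI allI ballI impI)
      (use surj ord in auto)
qed

text \<open>The element with coordinates \<open>X - {x b, x c}\<close> lies below \<open>b\<close>
  and misses only one point of \<open>c\<close>; anything between it and \<open>c\<close> stays in
  the interval, so the covering relation holds in \<open>L\<close>.\<close>

lemma meet_of_coatoms:
  assumes a: "a \<in> L" and b: "b \<in> lower_neighbors L a" and c: "c \<in> lower_neighbors L a" and "b \<noteq> c"
  obtains m where "m \<in> lower_neighbors L c" "m \<le> b"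
proof -
  let ?m = "lower_meet L a"
  have "lower_neighbors L a \<noteq> {}" using b by auto
  then have glb: "isGlb L (lower_neighbors L a) ?m" by (rule lower_meet[OF a])
  from coatoms[OF a \<open>lower_neighbors L a \<noteq> {}\<close>] obtain X :: "nat set" and f x where
    surj: "\<forall>Y\<subseteq>X. \<exists>c\<in>L. ?m \<le> c \<and> c \<le> a \<and> f c = Y"
    and ord': "\<forall>c\<in>L. \<forall>d\<in>L. ?m \<le> c \<and> c \<le> a \<and> ?m \<le> d \<and> d \<le> a \<longrightarrow> (c \<le> d \<longleftrightarrow> f c \<subseteq> f d)"
    and x: "\<forall>b\<in>lower_neighbors L a. x b \<in> X \<and> f b = X - {x b}"
    and inj: "inj_on x (lower_neighbors L a)"
    by (elim exE conjE)
  let ?B = "\<lambda>c. c \<in> L \<and> ?m \<le> c \<and> c \<le> a"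
  have ord: "c \<le> d \<longleftrightarrow> f c \<subseteq> f d" if "?B c" "?B d" for c d
    using ord' that by blast
  have N: "?B c" "x c \<in> X" "f c = X - {x c}" if "c \<in> lower_neighbors L a" for c
    using glb x lower_neighborsD[OF that] that by (auto simp: isGlb_iff)
  obtain m where m: "?B m" "f m = X - {x b, x c}"
    using surj[rule_format, of "X - {x b, x c}"] by blast
  have mb: "m \<le> b" "m \<le> c" using ord[OF m(1) N(1)[OF b]] ord[OF m(1) N(1)[OF c]] m(2) N(3) b c by auto
  have "m \<noteq> c" using m(2) N(2,3)[OF b] N(3)[OF c] inj_on_eq_iff[OF inj b c] \<open>b \<noteq> c\<close> by auto
  moreover have False if d: "d \<in> L" "m < d" "d < c" for d
  proof -
    have D: "?B d" using d m(1) N(1)[OF c] by (meson less_imp_le order_trans)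
    have "\<not> d \<le> m" "\<not> c \<le> d" "m \<le> d" "d \<le> c" using d by auto
    then show False
      using ord[OF D m(1)] ord[OF N(1)[OF c] D] ord[OF m(1) D] ord[OF D N(1)[OF c]] m(2) N(3)[OF c] by auto
  qed
  ultimately have "m \<in> lower_neighbors L c"
    using m(1) mb(2) by (auto simp: lower_neighbors_def)
  then show ?thesis using mb(1) by (rule that)
qed

text \<open>The element with coordinates \<open>X - {x c, x d}\<close> still has the coordinate
  \<open>x b\<close>, which \<open>b\<close> lacks. The case \<open>c = d\<close> is
  included.\<close>

lemma meet_of_coatoms_not_le:
  assumes a: "a \<in> L" and b: "b \<in> lower_neighbors L a" and c: "c \<in> lower_neighbors L a" "c \<noteq> b"
    and d: "d \<in> lower_neighbors L a" "d \<noteq> b"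
  obtains m where "m \<in> L" "m \<le> c" "m \<le> d" "\<not> m \<le> b"
proof -
  let ?m = "lower_meet L a"
  have "lower_neighbors L a \<noteq> {}" using b by auto
  then have glb: "isGlb L (lower_neighbors L a) ?m" by (rule lower_meet[OF a])
  from coatoms[OF a \<open>lower_neighbors L a \<noteq> {}\<close>] obtain X :: "nat set" and f x where
    surj: "\<forall>Y\<subseteq>X. \<exists>c\<in>L. ?m \<le> c \<and> c \<le> a \<and> f c = Y"
    and ord': "\<forall>c\<in>L. \<forall>d\<in>L. ?m \<le> c \<and> c \<le> a \<and> ?m \<le> d \<and> d \<le> a \<longrightarrow> (c \<le> d \<longleftrightarrow> f c \<subseteq> f d)"
    and x: "\<forall>b\<in>lower_neighbors L a. x b \<in> X \<and> f b = X - {x b}"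
    and inj: "inj_on x (lower_neighbors L a)"
    by (elim exE conjE)
  let ?B = "\<lambda>c. c \<in> L \<and> ?m \<le> c \<and> c \<le> a"
  have ord: "c \<le> d \<longleftrightarrow> f c \<subseteq> f d" if "?B c" "?B d" for c d
    using ord' that by blast
  have N: "?B c" "x c \<in> X" "f c = X - {x c}" if "c \<in> lower_neighbors L a" for c
    using glb x lower_neighborsD[OF that] that by (auto simp: isGlb_iff)
  obtain m where m: "?B m" "f m = X - {x c, x d}"
    using surj[rule_format, of "X - {x c, x d}"] by blast
  have "m \<le> c" "m \<le> d" using ord[OF m(1) N(1)[OF c(1)]] ord[OF m(1) N(1)[OF d(1)]] m(2) N(3) c d by auto
  moreover have "\<not> m \<le> b"
    using ord[OF m(1) N(1)[OF b]] m(2) N(2,3)[OF b] inj_on_eq_iff[OF inj c(1) b] inj_on_eq_iff[OF inj d(1) b] c(2) d(2) by auto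
  ultimately show ?thesis using m(1) by (intro that[of m]) auto
qed

text \<open>If \<open>s\<close> and \<open>t\<close> lie below further lower neighbors \<open>c\<close> and \<open>d\<close> of \<open>a\<close>, then any
  join-irreducible below \<open>c\<close> and \<open>d\<close> but not below \<open>b\<close> equals both of them by induction.\<close>
lemma ell_diff_neighbor_unique:
  assumes "a \<in> L" "b \<in> lower_neighbors L a" "s \<in> ell L a - ell L b" "t \<in> ell L a - ell L b"
  shows "s = t"
  using assms
proof (induction a arbitrary: b s t rule: L_induct)
  case (less a)
  have mem: "r \<in> L" "r \<le> a" "\<not> r \<le> b" if "r \<in> ell L a - ell L b" for r
    using that by (auto simp: ell_def join_irreducibles_def)
  show ?case
  proof (cases "lower_neighbors L a = {b}")
    case True
    have "r = a" if r: "r \<in> ell L a - ell L b" for r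
    proof (rule ccontr)
      assume "r \<noteq> a"
      then have "r < a" using mem[OF r] by simp
      then obtain c where "c \<in> lower_neighbors L a" "r \<le> c" using below_lower_neighbor mem(1)[OF r] by blast
      then show False using True mem(3)[OF r] by auto
    qed
    then show ?thesis using less.prems by blast
  next
    case False
    have nbr: "\<exists>c\<in>lower_neighbors L a. r \<le> c \<and> c \<noteq> b" if r: "r \<in> ell L a - ell L b" for r
    proof -
      have "r \<noteq> a"
      proof
        assume "r = a"
        then have "a \<in> join_irreducibles L" using r by (auto simp: ell_def)
        then show False using False less.prems(1) by (auto simp: join_irreducibles_def)
      qed
      then have "r < a" using mem[OF r] by simp
      then obtain c where "c \<in> lower_neighbors L a" "r \<le> c" using below_lower_neighbor mem(1)[OF r] by blast
      then show ?thesis using mem(3)[OF r] by auto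
    qed
    obtain c where c: "c \<in> lower_neighbors L a" "s \<le> c" "c \<noteq> b" using nbr less.prems(2) by blast
    obtain d where d: "d \<in> lower_neighbors L a" "t \<le> d" "d \<noteq> b" using nbr less.prems(3) by blast
    obtain e where e: "e \<in> L" "e \<le> c" "e \<le> d" "\<not> e \<le> b"
      using meet_of_coatoms_not_le[OF less.hyps less.prems(1) c(1,3) d(1,3)] .
    then obtain u where u: "u \<in> ell L e" "u \<notin> ell L b"
      using le_if_ell_subset[OF e(1) lower_neighborsD(1)[OF less.prems(1)]] by blast
    \<comment> \<open>Used for \<open>s\<close> with \<open>g = c\<close> and for \<open>t\<close>
      with \<open>g = d\<close>. As \<open>m\<close> is covered by \<open>g\<close> and lies below
      \<open>b\<close>, neither \<open>r\<close> nor \<open>u\<close> is below \<open>m\<close>, and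
      the induction hypothesis for \<open>g\<close> applies.\<close>
    have eq: "r = u" if r: "r \<in> ell L a - ell L b" and g: "g \<in> lower_neighbors L a" "r \<le> g" "g \<noteq> b" "e \<le> g" for r g
    proof -
      obtain m where m: "m \<in> lower_neighbors L g" "m \<le> b"
        using meet_of_coatoms[OF less.hyps less.prems(1) g(1)] g(3) by blast
      have "r \<in> ell L g - ell L m" "u \<in> ell L g - ell L m"
        using r u g m(2) by (auto simp: ell_def)
      then show ?thesis using less.IH[OF lower_neighborsD(1,2)[OF g(1)] m(1)] by blast
    qed
    show ?thesis using eq[OF less.prems(2) c(1,2,3) e(2)] eq[OF less.prems(3) d(1,2,3) e(3)] by simp
  qed
qed

text \<open>For \<open>s\<close> in \<open>S_set L a\<close> some lower neighbor \<open>b\<close> is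
  not above \<open>s\<close>, and since \<open>b\<close> loses only one join-irreducible, deleting
  \<open>s\<close> gives \<open>ell L b\<close>. Conversely, a member that loses only
  \<open>s\<close> belongs to an element below a lower neighbor, which must then lose
  \<open>s\<close> too.\<close>

lemma extreme_ell:
  assumes a: "a \<in> L"
  shows "extreme (ell L ` L) (ell L a) = S_set L a"
proof (intro equalityI subsetI)
  fix s assume s: "s \<in> S_set L a"
  have N: "lower_neighbors L a \<noteq> {}" using s by (auto simp: S_set_def lower_meet_def)
  have "\<exists>b\<in>lower_neighbors L a. \<not> s \<le> b"
  proof (rule ccontr)
    assume "\<not> ?thesis"
    then have "s \<le> lower_meet L a"
      using lower_meet[OF a N] s by (auto simp: isGlb_iff S_set_def ell_def join_irreducibles_def)
    then show False using s by (auto simp: S_set_def ell_def)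
  qed
  then obtain b where b: "b \<in> lower_neighbors L a" "\<not> s \<le> b" by blast
  have "s \<in> ell L a - ell L b" using s b by (auto simp: S_set_def ell_def)
  then have "ell L a - ell L b = {s}" using ell_diff_neighbor_unique[OF a b(1)] by blast
  moreover have "ell L b \<subseteq> ell L a" using ell_mono[of b a] lower_neighborsD(2)[OF b(1)] by auto
  ultimately have "ell L a - {s} = ell L b" "s \<in> ell L a" by auto
  then show "s \<in> extreme (ell L ` L) (ell L a)"
    using lower_neighborsD(1)[OF b(1)] by (auto simp: extreme_def)
next
  fix s assume s: "s \<in> extreme (ell L ` L) (ell L a)"
  then obtain c where c: "c \<in> L" "ell L a - {s} = ell L c" "s \<in> ell L a" by (auto simp: extreme_def)
  have "c \<le> a" using le_if_ell_subset[OF c(1) a] c by auto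
  moreover have "c \<noteq> a" using c by auto
  ultimately have "c < a" by simp
  then obtain b where b: "b \<in> lower_neighbors L a" "c \<le> b" using below_lower_neighbor c(1) by blast
  have "\<not> ell L a \<subseteq> ell L b"
    using le_if_ell_subset[OF a lower_neighborsD(1)[OF b(1)]] lower_neighborsD(2)[OF b(1)] by auto
  then have "s \<notin> ell L b" using ell_mono[OF b(2)] c by auto
  then show "s \<in> S_set L a" using S_set_diff_neighbor[OF a b(1)] c(3) by auto
qed

lemma convex_family: "convex_family (join_irreducibles L) (ell L ` L)"
proof
  show "finite (join_irreducibles L)" using finL by (auto simp: join_irreducibles_def)
  show "A \<in> ell L ` L \<Longrightarrow> A \<subseteq> join_irreducibles L" for A by (auto simp: ell_def)
  show "ell L ` L \<noteq> {}" using semilattice by (auto simp: meet_semilattice_def)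
next
  fix A B assume "A \<in> ell L ` L" "B \<in> ell L ` L"
  then obtain a b where ab: "a \<in> L" "b \<in> L" "A = ell L a" "B = ell L b" by auto
  obtain m where m: "m \<in> L" "m \<le> a" "m \<le> b" "\<And>z. z \<in> L \<Longrightarrow> z \<le> a \<Longrightarrow> z \<le> b \<Longrightarrow> z \<le> m"
    using meet_ex ab(1,2) by blast
  then have "A \<inter> B = ell L m" using ab by (auto simp: ell_def join_irreducibles_def)
  then show "A \<inter> B \<in> ell L ` L" using m(1) by auto
  show "A \<subseteq> B" if "extreme (ell L ` L) A \<subseteq> B"
    using S_set_subset_imp_le[OF ab(1,2)] that ab extreme_ell[OF ab(1)] ell_mono by simp
qed

theorem level_iff_pure_S_complex:
  "level_complex TYPE('k::field) (alexander_dual L) \<longleftrightarrow> pure_complex (S_complex L)"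
proof -
  interpret convex_family "join_irreducibles L" "ell L ` L" by (rule convex_family)
  have "\<Gamma> = alexander_dual L" by (simp add: \<Gamma>_def alexander_dual_def dual_facet_def)
  moreover have "extreme (ell L ` L) ` (ell L ` L) = S_complex L"
    unfolding S_complex_def image_image by (rule image_cong) (simp_all add: extreme_ell)
  ultimately show ?thesis using level_iff_pure[where 'k = 'k] by simp
qed

end

section \<open>Lattices of poset ideals\<close>

lemma inj_on_image_subset_iff:
  "inj_on f C \<Longrightarrow> A \<subseteq> C \<Longrightarrow> B \<subseteq> C \<Longrightarrow> f ` A \<subseteq> f ` B \<longleftrightarrow> A \<subseteq> B"
  by (metis inj_on_image_Int inj_on_image_eq_iff le_iff_inf le_infI1)

text \<open>The vertices on the lattice side are the principal ideals \<open>down p\<close>, so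
  purity has to be carried along the injection \<open>down\<close>.\<close>

lemma pure_complex_image:
  assumes inj: "inj_on f (\<Union>\<Delta>)"
  shows "pure_complex ((`) f ` \<Delta>) \<longleftrightarrow> pure_complex \<Delta>"
proof -
  have sub: "f ` F \<subseteq> f ` G \<longleftrightarrow> F \<subseteq> G" if "F \<in> \<Delta>" "G \<in> \<Delta>" for F G
    by (rule inj_on_image_subset_iff[OF inj]) (use that in auto)
  have eq: "f ` F = f ` G \<longleftrightarrow> F = G" if "F \<in> \<Delta>" "G \<in> \<Delta>" for F G
    by (rule inj_on_image_eq_iff[OF inj]) (use that in auto)
  have max: "f ` F \<in> facets ((`) f ` \<Delta>) \<longleftrightarrow> F \<in> facets \<Delta>" if "F \<in> \<Delta>" for F
    using that by (simp add: facets_def sub eq)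
  have "facets ((`) f ` \<Delta>) = (`) f ` facets \<Delta>"
  proof (intro equalityI subsetI)
    fix G assume "G \<in> facets ((`) f ` \<Delta>)"
    moreover from this obtain F where "F \<in> \<Delta>" "G = f ` F" by (auto simp: facets_def)
    ultimately show "G \<in> (`) f ` facets \<Delta>" using max by blast
  next
    fix G assume "G \<in> (`) f ` facets \<Delta>"
    then obtain F where "F \<in> facets \<Delta>" "G = f ` F" by blast
    moreover from this have "F \<in> \<Delta>" by (simp add: facets_def)
    ultimately show "G \<in> facets ((`) f ` \<Delta>)" using max by blast
  qed
  moreover have "card (f ` F) = card F" if "F \<in> facets \<Delta>" for F
    by (rule card_image[OF inj_on_subset[OF inj]]) (use that in \<open>auto simp: facets_def\<close>)
  ultimately show ?thesis by (auto simp: pure_complex_def)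
qed

locale finite_poset =
  fixes P :: "'p::order set"
  assumes finP: "finite P"
begin

abbreviation "\<J> \<equiv> poset_ideals P"

definition down :: "'p \<Rightarrow> 'p set" where
  "down p = {x \<in> P. x \<le> p}"

definition maximals :: "'p set \<Rightarrow> 'p set" where
  "maximals I = {m \<in> I. \<forall>x\<in>I. m \<le> x \<longrightarrow> x = m}"

lemma maximalsD: "m \<in> maximals I \<Longrightarrow> m \<in> I" "m \<in> maximals I \<Longrightarrow> x \<in> I \<Longrightarrow> m \<le> x \<Longrightarrow> x = m"
  by (simp_all add: maximals_def)

lemma maximalsI: "m \<in> I \<Longrightarrow> (\<And>x. x \<in> I \<Longrightarrow> m \<le> x \<Longrightarrow> x = m) \<Longrightarrow> m \<in> maximals I"
  by (simp add: maximals_def)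

lemma ideal_subset: "I \<in> \<J> \<Longrightarrow> I \<subseteq> P"
  by (auto simp: poset_ideals_def)

lemma ideal_down: "I \<in> \<J> \<Longrightarrow> x \<in> I \<Longrightarrow> y \<in> P \<Longrightarrow> y \<le> x \<Longrightarrow> y \<in> I"
  by (auto simp: poset_ideals_def)

lemma below_maximal:
  assumes "I \<subseteq> P" "x \<in> I"
  obtains m where "m \<in> maximals I" "x \<le> m"
proof -
  have "finite {y \<in> I. x \<le> y}" "x \<in> {y \<in> I. x \<le> y}"
    using assms finP finite_subset[OF assms(1)] by auto
  then obtain m where "m \<in> {y \<in> I. x \<le> y}" "\<forall>y\<in>{y \<in> I. x \<le> y}. m \<le> y \<longrightarrow> m = y"
    using finite_has_maximal[of "{y \<in> I. x \<le> y}"] by blast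
  then have "m \<in> maximals I" "x \<le> m" by (auto intro: maximalsI dest: order_trans)
  then show ?thesis by (rule that)
qed

lemma remove_maximal:
  assumes "I \<in> \<J>" "p \<in> I"
  shows "I - {p} \<in> \<J> \<longleftrightarrow> p \<in> maximals I"
proof
  assume *: "I - {p} \<in> \<J>"
  have "x = p" if "x \<in> I" "p \<le> x" for x
    using ideal_down[OF *, of x p] ideal_subset[OF assms(1)] assms(2) that by blast
  then show "p \<in> maximals I" using assms(2) by (rule maximalsI[rotated])
next
  assume *: "p \<in> maximals I"
  have "y \<in> I - {p}" if "x \<in> I - {p}" "y \<in> P" "y \<le> x" for x y
  proof -
    have "y \<in> I" using ideal_down[OF assms(1)] that by blast
    moreover have "y \<noteq> p" using maximalsD(2)[OF *] that by blast
    ultimately show ?thesis by simp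
  qed
  then show "I - {p} \<in> \<J>"
    using ideal_subset[OF assms(1)] unfolding poset_ideals_def by blast
qed

lemma down_ideal: "down p \<in> \<J>"
  unfolding down_def poset_ideals_def by (blast intro: order_trans)

lemma down_subset_iff: "I \<in> \<J> \<Longrightarrow> p \<in> P \<Longrightarrow> down p \<subseteq> I \<longleftrightarrow> p \<in> I"
  unfolding down_def poset_ideals_def by blast

lemma inj_down: "inj_on down P"
  by (rule inj_onI) (auto simp: down_def intro: antisym)

text \<open>For an ideal \<open>J\<close> properly inside \<open>I\<close>, a maximal element of
  \<open>I - J\<close> is maximal in all of \<open>I\<close>, because a down-set containing
  something above it would contain it. Deleting it leaves an ideal that still contains
  \<open>J\<close>.\<close>

lemma lower_neighbors_ideals:
  assumes I: "I \<in> \<J>"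
  shows "lower_neighbors \<J> I = (\<lambda>m. I - {m}) ` maximals I"
proof (intro equalityI subsetI)
  fix J assume J: "J \<in> lower_neighbors \<J> I"
  then have J': "J \<in> \<J>" "J \<subset> I" by (auto simp: lower_neighbors_def)
  then obtain x where "x \<in> I - J" by auto
  then obtain m where m: "m \<in> maximals (I - J)" using below_maximal[of "I - J" x] ideal_subset[OF I] by blast
  note m = maximalsD[OF m]
  have max: "m \<in> maximals I"
  proof (rule maximalsI)
    fix y assume y: "y \<in> I" "m \<le> y"
    have "m \<in> P" "m \<notin> J" using m(1) ideal_subset[OF I] by auto
    then have "y \<notin> J" using ideal_down[OF J'(1) _ _ y(2)] by blast
    then show "y = m" using m(2) y by blast
  qed (use m in blast)
  have "I - {m} \<in> \<J>" using remove_maximal[OF I] m(1) max by blast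
  moreover have "J \<subseteq> I - {m}" "I - {m} < I" using m(1) J' by auto
  ultimately have "J = I - {m}" using lower_neighborsD(3)[OF J, of "I - {m}"] by blast
  then show "J \<in> (\<lambda>m. I - {m}) ` maximals I" using max by blast
next
  fix J assume "J \<in> (\<lambda>m. I - {m}) ` maximals I"
  then obtain m where m: "m \<in> maximals I" "J = I - {m}" by blast
  then have "J \<in> \<J>" "J < I" using remove_maximal[OF I] maximalsD(1)[OF m(1)] by auto
  moreover have "\<not> (J < K \<and> K < I)" for K using m(2) by blast
  ultimately show "J \<in> lower_neighbors \<J> I" by (simp add: lower_neighbors_def)
qed

text \<open>Lower neighbors correspond to maximal elements, so a unique lower neighbor means a
  unique maximal element, and a finite ideal with one maximal element is principal.\<close>

lemma join_irreducibles_ideals: "join_irreducibles \<J> = down ` P"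
proof -
  have eq: "(\<exists>!J. J \<in> lower_neighbors \<J> I) \<longleftrightarrow> (\<exists>p\<in>P. I = down p)" if I: "I \<in> \<J>" for I
  proof
    assume "\<exists>!J. J \<in> lower_neighbors \<J> I"
    then obtain J where J: "J \<in> lower_neighbors \<J> I" "\<And>K. K \<in> lower_neighbors \<J> I \<Longrightarrow> K = J"
      by (elim ex1E) (metis (full_types))
    from J(1) obtain m where m: "m \<in> maximals I" unfolding lower_neighbors_ideals[OF I] by blast
    have "m' = m" if "m' \<in> maximals I" for m'
    proof -
      have "I - {k} = J" if "k \<in> maximals I" for k
        using that by (intro J(2)) (simp add: lower_neighbors_ideals[OF I])
      from this[OF that] this[OF m] have "I - {m'} = I - {m}" by simp
      then show ?thesis using maximalsD(1)[OF m] maximalsD(1)[OF that] by blast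
    qed
    then have *: "x \<le> m" if "x \<in> I" for x using below_maximal[OF ideal_subset[OF I] that] by metis
    have mI: "m \<in> I" "m \<in> P" using maximalsD(1)[OF m] ideal_subset[OF I] by auto
    have "I = down m"
      unfolding down_def using * mI(1) ideal_subset[OF I] ideal_down[OF I mI(1)] by blast
    then show "\<exists>p\<in>P. I = down p" using mI(2) by blast
  next
    assume "\<exists>p\<in>P. I = down p"
    then obtain p where "p \<in> P" "I = down p" by blast
    then have p: "p \<in> I" "\<And>x. x \<in> I \<Longrightarrow> x \<le> p" by (simp_all add: down_def)
    have "p \<in> maximals I" using p(2) by (intro maximalsI p(1) antisym)
    moreover have "m = p" if "m \<in> maximals I" for m
      using maximalsD(2)[OF that p(1)] p(2) maximalsD(1)[OF that] by simp
    ultimately have "maximals I = {p}" by blast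
    then show "\<exists>!J. J \<in> lower_neighbors \<J> I" unfolding lower_neighbors_ideals[OF I] by simp
  qed
  have mem: "I \<in> join_irreducibles \<J> \<longleftrightarrow> I \<in> \<J> \<and> (\<exists>p\<in>P. I = down p)" for I
    unfolding join_irreducibles_def mem_Collect_eq by (rule conj_cong[OF refl eq])
  show ?thesis
  proof (intro equalityI subsetI)
    fix I assume "I \<in> join_irreducibles \<J>"
    then obtain p where "p \<in> P" "I = down p" unfolding mem by (elim conjE bexE)
    then show "I \<in> down ` P" by simp
  next
    fix I assume "I \<in> down ` P"
    then obtain p where p: "p \<in> P" "I = down p" by (elim imageE)
    then show "I \<in> join_irreducibles \<J>" unfolding mem using down_ideal by (intro conjI bexI[of _ p]) simp_all
  qed
qed

lemma ell_ideals:
  assumes "I \<in> \<J>"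
  shows "ell \<J> I = down ` I"
proof (rule set_eqI)
  fix J
  have "J \<in> ell \<J> I \<longleftrightarrow> (\<exists>p\<in>P. J = down p \<and> down p \<subseteq> I)"
    by (auto simp: ell_def join_irreducibles_ideals)
  then show "J \<in> ell \<J> I \<longleftrightarrow> J \<in> down ` I"
    using ideal_subset[OF assms] down_subset_iff[OF assms] by (simp add: image_iff) (metis subsetD)
qed

lemma down_image_mem:
  assumes "A \<subseteq> P"
  shows "down ` A \<in> ell \<J> ` \<J> \<longleftrightarrow> A \<in> \<J>"
proof
  assume "down ` A \<in> ell \<J> ` \<J>"
  then obtain I where I: "I \<in> \<J>" "down ` A = ell \<J> I" by (elim imageE)
  then have "A = I"
    using inj_on_image_eq_iff[OF inj_down assms ideal_subset[OF I(1)]] by (simp add: ell_ideals)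
  then show "A \<in> \<J>" using I(1) by simp
next
  assume "A \<in> \<J>"
  then show "down ` A \<in> ell \<J> ` \<J>" using ell_ideals by (metis image_eqI)
qed

lemma extreme_ideals:
  assumes I: "I \<in> \<J>"
  shows "extreme (ell \<J> ` \<J>) (down ` I) = down ` maximals I"
proof -
  have mem: "down ` I - {down p} \<in> ell \<J> ` \<J> \<longleftrightarrow> p \<in> maximals I" if p: "p \<in> I" for p
  proof -
    note IP = ideal_subset[OF I]
    have "down ` (I - {p}) = down ` I - down ` {p}"
      by (rule inj_on_image_set_diff[OF inj_down]) (use IP p in blast)+
    moreover have "I - {p} \<subseteq> P" using IP by blast
    ultimately show ?thesis
      using down_image_mem[of "I - {p}"] remove_maximal[OF I p] by simp
  qed
  show ?thesis
  proof (intro equalityI subsetI)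
    fix s assume "s \<in> extreme (ell \<J> ` \<J>) (down ` I)"
    then obtain p where "p \<in> I" "s = down p" "down ` I - {s} \<in> ell \<J> ` \<J>"
      unfolding extreme_def by blast
    then show "s \<in> down ` maximals I" using mem by simp
  next
    fix s assume "s \<in> down ` maximals I"
    then obtain p where p: "p \<in> maximals I" "s = down p" by (elim imageE)
    then show "s \<in> extreme (ell \<J> ` \<J>) (down ` I)"
      unfolding extreme_def using mem[OF maximalsD(1)[OF p(1)]] maximalsD(1)[OF p(1)] by simp
  qed
qed

text \<open>The inverse passage sends an antichain to the ideal that it generates.\<close>

lemma antichains_eq: "antichains P = maximals ` \<J>"
proof (intro equalityI subsetI)
  fix A assume A: "A \<in> antichains P"
  let ?I = "{x \<in> P. \<exists>a\<in>A. x \<le> a}"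
  have AP: "A \<subseteq> P" and anti: "\<And>x y. x \<in> A \<Longrightarrow> y \<in> A \<Longrightarrow> x \<le> y \<Longrightarrow> x = y"
    using A unfolding antichains_def by blast+
  have "maximals ?I = A"
  proof (intro equalityI subsetI)
    fix x assume x: "x \<in> maximals ?I"
    then obtain a where a: "a \<in> A" "x \<le> a" using maximalsD(1)[OF x] by blast
    then have "a = x" using maximalsD(2)[OF x] AP by blast
    then show "x \<in> A" using a by simp
  next
    fix x assume x: "x \<in> A"
    show "x \<in> maximals ?I"
    proof (rule maximalsI)
      fix y assume "y \<in> ?I" "x \<le> y"
      moreover from this obtain a where "a \<in> A" "y \<le> a" by blast
      ultimately show "y = x" using anti[OF x] by (metis antisym order_trans)
    qed (use x AP in blast)
  qed
  moreover have "?I \<in> \<J>" unfolding poset_ideals_def by (blast intro: order_trans)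
  ultimately show "A \<in> maximals ` \<J>" by blast
next
  fix A assume "A \<in> maximals ` \<J>"
  then obtain I where I: "I \<in> \<J>" "A = maximals I" by blast
  then show "A \<in> antichains P"
    unfolding antichains_def using ideal_subset[OF I(1)] maximalsD by blast
qed

text \<open>Extreme points of an ideal are its maximal elements, and a finite ideal is generated by
  these; this gives the closure axiom.\<close>

lemma convex_family_ideals: "convex_family (join_irreducibles \<J>) (ell \<J> ` \<J>)"
proof
  show "finite (join_irreducibles \<J>)" using finP by (simp add: join_irreducibles_ideals)
  show "A \<in> ell \<J> ` \<J> \<Longrightarrow> A \<subseteq> join_irreducibles \<J>" for A by (auto simp: ell_def)
  show "ell \<J> ` \<J> \<noteq> {}" using down_ideal by auto
next
  fix A B assume "A \<in> ell \<J> ` \<J>" "B \<in> ell \<J> ` \<J>"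
  then obtain I J where IJ: "I \<in> \<J>" "J \<in> \<J>" "A = down ` I" "B = down ` J" by (auto simp: ell_ideals)
  then have sub: "I \<subseteq> P" "J \<subseteq> P" using ideal_subset by auto
  have "A \<inter> B = down ` (I \<inter> J)" using inj_on_image_Int[OF inj_down sub] IJ by simp
  moreover have "I \<inter> J \<in> \<J>" using IJ by (auto simp: poset_ideals_def)
  ultimately show "A \<inter> B \<in> ell \<J> ` \<J>" using down_image_mem[OF le_infI1[OF sub(1), of J]] by simp
  show "A \<subseteq> B" if "extreme (ell \<J> ` \<J>) A \<subseteq> B"
  proof -
    have "maximals I \<subseteq> P" using sub maximalsD(1) by blast
    then have max: "maximals I \<subseteq> J"
      using that IJ sub inj_on_image_subset_iff[OF inj_down, of "maximals I" J] by (simp add: extreme_ideals)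
    have "I \<subseteq> J"
    proof
      fix x assume x: "x \<in> I"
      obtain m where "m \<in> maximals I" "x \<le> m" using below_maximal[OF sub(1) x] .
      then show "x \<in> J" using ideal_down[OF IJ(2)] max x sub(1) by blast
    qed
    then show ?thesis unfolding IJ by (rule image_mono)
  qed
qed

theorem level_iff_pure_antichains:
  "level_complex TYPE('k::field) (alexander_dual \<J>) \<longleftrightarrow> pure_complex (antichains P)"
proof -
  interpret convex_family "join_irreducibles \<J>" "ell \<J> ` \<J>" by (rule convex_family_ideals)
  have "\<Gamma> = alexander_dual \<J>" by (simp add: \<Gamma>_def alexander_dual_def dual_facet_def)
  moreover have "extreme (ell \<J> ` \<J>) ` (ell \<J> ` \<J>) = (`) down ` antichains P"
    unfolding antichains_eq image_image
  proof (rule image_cong[OF refl])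
    fix I assume I: "I \<in> \<J>"
    show "extreme (ell \<J> ` \<J>) (ell \<J> I) = down ` maximals I"
      unfolding ell_ideals[OF I] by (rule extreme_ideals[OF I])
  qed
  moreover have "inj_on down (\<Union>(antichains P))"
    by (rule inj_on_subset[OF inj_down]) (simp add: antichains_def Sup_le_iff)
  ultimately show ?thesis using level_iff_pure[where 'k = 'k] by (simp add: pure_complex_image)
qed

end

theorem corollary3p4:
  fixes L :: "'a::order set" and P :: "'p::order set"
  shows "(finite L \<and> meet_semilattice L \<and> meet_distributive L \<longrightarrow>
            (level_complex TYPE('k::field) (alexander_dual L) \<longleftrightarrow> pure_complex (S_complex L)))
       \<and> (finite P \<longrightarrow>
            (level_complex TYPE('k) (alexander_dual (poset_ideals P)) \<longleftrightarrow>
             pure_complex (antichains P)))"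
  using finite_meet_distributive.level_iff_pure_S_complex[of L, where 'k = 'k]
    finite_poset.level_iff_pure_antichains[of P, where 'k = 'k]
  by (auto simp: finite_meet_distributive_def finite_meet_distributive_axioms_def
      finite_meet_semilattice_def finite_poset_def)

end
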